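(* Let $A$ be a physical system with Hamiltonian $H^A$ and Gibbs state $\gamma^A$, and let $\psi^A$ be a pure state on $A$. Then, with $\mathfrak{F}$ denoting closed thermal operations assisted by sublinear athermality resources, $$\mathrm{Cost}_\mathfrak{F}(\psi^A,\gamma^A)=D(\psi^A\|\gamma^A),$$ where $D(\rho\|\gamma)=\mathrm{Tr}[\rho\log\rho]-\mathrm{Tr}[\rho\log\gamma]$ is the Umegaki relative entropy.
   Context: Systems are finite dimensional with positive semidefinite Hamiltonians; composites of non-interacting systems have additive Hamiltonians $H^{XY}=H^X\otimes I+I\otimes H^Y$; $A^n$ is $n$ copies of $A$. For fixed $\beta>0$ the Gibbs state is $\gamma^X=e^{-\beta H^X}/\mathrm{Tr}[e^{-\beta H^X}]$, with $\gamma^{A^n}=(\gamma^A)^{\otimes n}$. A thermal operation is a channel obtainable by composing: appending systems in their Gibbs states, unitaries on a composite system commuting with its total Hamiltonian, and tracing out subsystems; $\mathrm{CTO}(X\to Y)$ is the closure of the set of thermal operations from $X$ to $Y$. For real $m\ge1$ let $X$ be a qubit with Hamiltonian diagonal in $\{|0\rangle,|1\rangle\}$ whose Gibbs state is $\mathbf{u}^X_m=\frac1m|0\rangle\langle0|+\frac{m-1}m|1\rangle\langle1|$. For an auxiliary system $R$ with fixed Hamiltonian, the $R$-assisted conversion distance is $d^R_{\mathrm{CTO}}((\rho^X,\gamma^X)\to(\sigma^B,\gamma^B))\coloneqq\inf_{\omega\in\mathfrak{D}(R)}\inf_{\mathcal{E}\in\mathrm{CTO}(XR\to B)}\frac12\|\sigma^B-\mathcal{E}(\rho^X\otimes\omega^R)\|_1$,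 and the $R$-assisted $\varepsilon$-cost is $\mathrm{Cost}^{\varepsilon,R}_{\mathrm{CTO}}(\rho^B,\gamma^B)\coloneqq\log\inf\{m>0: d^R_{\mathrm{CTO}}((|0\rangle\langle0|^X,\mathbf{u}^X_m)\to(\rho^B,\gamma^B))\le\varepsilon\}$. A sublinear athermality resource (SLAR) is a sequence of systems $\{R_n\}_{n\in\mathbb{N}}$ with $|R_n|$ growing polynomially in $n$, for which there are constants $c>0$ and $0\le\alpha<1$ independent of $n$ with $\|H^{R_n}\|_\infty\le cn^\alpha$ for all $n$. Then $\mathrm{Cost}_\mathfrak{F}(\rho,\gamma)\coloneqq\lim_{\varepsilon\to0^+}\inf_{\{R_n\}}\liminf_{n\to\infty}\frac1n\mathrm{Cost}^{\varepsilon,R_n}_{\mathrm{CTO}}(\rho^{\otimes n},\gamma^{\otimes n})$, the infimum being over all SLARs. Logarithms are base 2. *)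

theory Defs
  imports "HOL-Library.Extended_Real" "HOL-Library.Liminf_Limsup" "Jordan_Normal_Form.Matrix"
begin

definition adj :: "complex mat \<Rightarrow> complex mat" where
  "adj A = mat (dim_col A) (dim_row A) (\<lambda>(i,j). cnj (A $$ (j,i)))"

definition tr :: "complex mat \<Rightarrow> complex" where
  "tr A = (\<Sum>i<dim_row A. A $$ (i,i))"

definition hermitian :: "nat \<Rightarrow> complex mat \<Rightarrow> bool" where
  "hermitian n A \<longleftrightarrow> A \<in> carrier_mat n n \<and> adj A = A"

definition qform :: "complex mat \<Rightarrow> complex vec \<Rightarrow> complex" where
  "qform A v = (\<Sum>i<dim_vec v. \<Sum>j<dim_vec v. cnj (v $ i) * A $$ (i,j) * v $ j)"

definition psd :: "nat \<Rightarrow> complex mat \<Rightarrow> bool" where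
  "psd n A \<longleftrightarrow> hermitian n A \<and> (\<forall>v\<in>carrier_vec n. 0 \<le> Re (qform A v))"

definition unitary :: "nat \<Rightarrow> complex mat \<Rightarrow> bool" where
  "unitary n U \<longleftrightarrow> U \<in> carrier_mat n n \<and> adj U * U = one_mat n"

definition density :: "nat \<Rightarrow> complex mat \<Rightarrow> bool" where
  "density n \<rho> \<longleftrightarrow> psd n \<rho> \<and> tr \<rho> = 1"

definition vnorm :: "complex vec \<Rightarrow> real" where
  "vnorm v = sqrt (\<Sum>i<dim_vec v. (cmod (v $ i))\<^sup>2)"

definition ketbra :: "complex vec \<Rightarrow> complex mat" where
  "ketbra v = mat (dim_vec v) (dim_vec v) (\<lambda>(i,j). v $ i * cnj (v $ j))"

definition opnorm :: "complex mat \<Rightarrow> real" where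
  "opnorm A = Sup {vnorm (mult_mat_vec A v) | v. v \<in> carrier_vec (dim_col A) \<and> vnorm v = 1}"

definition rdiag :: "nat \<Rightarrow> (nat \<Rightarrow> real) \<Rightarrow> complex mat" where
  "rdiag n d = mat n n (\<lambda>(i,j). if i = j then complex_of_real (d i) else 0)"

definition herm_fun :: "(real \<Rightarrow> real) \<Rightarrow> complex mat \<Rightarrow> complex mat" where
  "herm_fun f A = (SOME B. \<exists>U d. unitary (dim_row A) U \<and>
      A = U * rdiag (dim_row A) d * adj U \<and> B = U * rdiag (dim_row A) (f \<circ> d) * adj U)"

text \<open>base-2 matrix logarithm (on the support; log 0 = 0 in Isabelle, giving 0 log 0 = 0)\<close>
definition mlog :: "complex mat \<Rightarrow> complex mat" where
  "mlog A = herm_fun (log 2) A"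

definition rel_ent :: "complex mat \<Rightarrow> complex mat \<Rightarrow> real" where
  "rel_ent \<rho> \<gamma> = Re (tr (\<rho> * mlog \<rho>)) - Re (tr (\<rho> * mlog \<gamma>))"

definition tnorm :: "complex mat \<Rightarrow> real" where
  "tnorm A = Re (tr (herm_fun sqrt (adj A * A)))"

definition gibbs :: "real \<Rightarrow> complex mat \<Rightarrow> complex mat" where
  "gibbs \<beta> H = (let E = herm_fun (\<lambda>x. exp (- \<beta> * x)) H in smult_mat (1 / tr E) E)"

definition kron :: "complex mat \<Rightarrow> complex mat \<Rightarrow> complex mat" where
  "kron A B = mat (dim_row A * dim_row B) (dim_col A * dim_col B)
     (\<lambda>(i,j). A $$ (i div dim_row B, j div dim_col B) * B $$ (i mod dim_row B, j mod dim_col B))"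

definition ptr2 :: "nat \<Rightarrow> nat \<Rightarrow> complex mat \<Rightarrow> complex mat" where
  "ptr2 dX dY M = mat dX dX (\<lambda>(i,j). \<Sum>k<dY. M $$ (i * dY + k, j * dY + k))"

definition ptr1 :: "nat \<Rightarrow> nat \<Rightarrow> complex mat \<Rightarrow> complex mat" where
  "ptr1 dX dY M = mat dY dY (\<lambda>(i,j). \<Sum>k<dX. M $$ (k * dY + i, k * dY + j))"

datatype sys = Atom "complex mat" | Comp sys sys

fun ham :: "sys \<Rightarrow> complex mat" where
  "ham (Atom H) = H"
| "ham (Comp X Y) = kron (ham X) (one_mat (dim_row (ham Y))) + kron (one_mat (dim_row (ham X))) (ham Y)"

definition sdim :: "sys \<Rightarrow> nat" where
  "sdim X = dim_row (ham X)"

fun valid :: "sys \<Rightarrow> bool" where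
  "valid (Atom H) \<longleftrightarrow> 0 < dim_row H \<and> psd (dim_row H) H"
| "valid (Comp X Y) \<longleftrightarrow> valid X \<and> valid Y"

fun spow :: "sys \<Rightarrow> nat \<Rightarrow> sys" where
  "spow A 0 = Atom (zero_mat 1 1)"
| "spow A (Suc 0) = A"
| "spow A (Suc (Suc n)) = Comp (spow A (Suc n)) A"

fun tpow :: "complex mat \<Rightarrow> nat \<Rightarrow> complex mat" where
  "tpow \<rho> 0 = one_mat 1"
| "tpow \<rho> (Suc 0) = \<rho>"
| "tpow \<rho> (Suc (Suc n)) = kron (tpow \<rho> (Suc n)) \<rho>"

inductive_set TO :: "real \<Rightarrow> (sys \<times> sys \<times> (complex mat \<Rightarrow> complex mat)) set" for \<beta> :: real where
  unitary_op: "\<lbrakk>valid X; unitary (sdim X) U; U * ham X = ham X * U\<rbrakk>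
      \<Longrightarrow> (X, X, \<lambda>\<rho>. U * \<rho> * adj U) \<in> TO \<beta>"
| append_r: "\<lbrakk>valid X; valid R\<rbrakk> \<Longrightarrow> (X, Comp X R, \<lambda>\<rho>. kron \<rho> (gibbs \<beta> (ham R))) \<in> TO \<beta>"
| append_l: "\<lbrakk>valid X; valid R\<rbrakk> \<Longrightarrow> (X, Comp R X, \<lambda>\<rho>. kron (gibbs \<beta> (ham R)) \<rho>) \<in> TO \<beta>"
| trace_r: "\<lbrakk>valid X; valid Y\<rbrakk> \<Longrightarrow> (Comp X Y, X, ptr2 (sdim X) (sdim Y)) \<in> TO \<beta>"
| trace_l: "\<lbrakk>valid X; valid Y\<rbrakk> \<Longrightarrow> (Comp X Y, Y, ptr1 (sdim X) (sdim Y)) \<in> TO \<beta>"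
| compose: "\<lbrakk>(X, Y, E) \<in> TO \<beta>; (Y, Z, F) \<in> TO \<beta>\<rbrakk> \<Longrightarrow> (X, Z, F \<circ> E) \<in> TO \<beta>"

text \<open>closure of the thermal operations X -> Y (pointwise = norm topology on linear maps)\<close>
definition CTO :: "real \<Rightarrow> sys \<Rightarrow> sys \<Rightarrow> (complex mat \<Rightarrow> complex mat) set" where
  "CTO \<beta> X Y = {E. (\<forall>\<rho>\<in>carrier_mat (sdim X) (sdim X). E \<rho> \<in> carrier_mat (sdim Y) (sdim Y)) \<and>
     (\<exists>T. (\<forall>k. (X, Y, T k) \<in> TO \<beta>) \<and>
        (\<forall>\<rho>\<in>carrier_mat (sdim X) (sdim X). \<forall>i<sdim Y. \<forall>j<sdim Y.
            (\<lambda>k. T k \<rho> $$ (i,j)) \<longlonglongrightarrow> E \<rho> $$ (i,j)))}"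

definition conv_dist :: "real \<Rightarrow> sys \<Rightarrow> complex mat \<Rightarrow> sys \<Rightarrow> sys \<Rightarrow> complex mat \<Rightarrow> real" where
  "conv_dist \<beta> X \<rho> R B \<sigma> = Inf {1/2 * tnorm (\<sigma> - E (kron \<rho> \<omega>)) | \<omega> E.
      density (sdim R) \<omega> \<and> E \<in> CTO \<beta> (Comp X R) B}"

text \<open>Qubit X with diagonal Hamiltonian whose Gibbs state is  u_m = 1/m |0><0| + (m-1)/m |1><1|  (m > 1),
  with the energy shift chosen to keep the Hamiltonian positive semidefinite.\<close>
definition qubit_ham :: "real \<Rightarrow> real \<Rightarrow> complex mat" where
  "qubit_ham \<beta> m = (if 2 \<le> m then rdiag 2 (\<lambda>i. if i = 0 then ln (m - 1) / \<beta> else 0)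
                     else rdiag 2 (\<lambda>i. if i = 0 then 0 else - ln (m - 1) / \<beta>))"

definition ket0 :: "complex mat" where
  "ket0 = mat 2 2 (\<lambda>(i,j). if i = 0 \<and> j = 0 then 1 else 0)"

definition cost_eps :: "real \<Rightarrow> sys \<Rightarrow> sys \<Rightarrow> complex mat \<Rightarrow> real \<Rightarrow> ereal" where
  "cost_eps \<beta> R B \<sigma> \<epsilon> =
     (let M = Inf (ereal ` {m. 1 < m \<and> conv_dist \<beta> (Atom (qubit_ham \<beta> m)) ket0 R B \<sigma> \<le> \<epsilon>})
      in if M = \<infinity> then \<infinity> else ereal (log 2 (real_of_ereal M)))"

definition slar :: "(nat \<Rightarrow> sys) \<Rightarrow> bool" where
  "slar Rs \<longleftrightarrow> (\<forall>n. valid (Rs n)) \<and>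
     (\<exists>C k. \<forall>n\<ge>1. real (sdim (Rs n)) \<le> C * real n ^ k) \<and>
     (\<exists>c \<alpha>. 0 < c \<and> 0 \<le> \<alpha> \<and> \<alpha> < 1 \<and> (\<forall>n\<ge>1. opnorm (ham (Rs n)) \<le> c * real n powr \<alpha>))"

text \<open>inf over SLARs of liminf_n (1/n) Cost^{eps,R_n}(rho^{\<otimes>n}, gamma^{\<otimes>n}); Cost_F is its limit eps -> 0+\<close>
definition cost_rate :: "real \<Rightarrow> sys \<Rightarrow> complex mat \<Rightarrow> real \<Rightarrow> ereal" where
  "cost_rate \<beta> A \<rho> \<epsilon> = (INF Rs\<in>{Rs. slar Rs}.
      liminf (\<lambda>n. ereal (1 / real n) * cost_eps \<beta> (Rs n) (spow A n) (tpow \<rho> n) \<epsilon>))"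

end

theory Submission
  imports Defs "HOL-Analysis.L2_Norm" "Jordan_Normal_Form.Spectral_Radius"
begin

text \<open>
  Let \<open>Z\<close> be the partition function of \<open>A\<close> and \<open>\<mu>\<close> the mean energy of \<open>\<psi>\<close>, so that
  \<open>D(\<psi>\<parallel>\<gamma>) = log Z + \<beta>\<mu> / ln 2\<close>. In an energy eigenbasis the \<open>n\<close>-fold state concentrates, by Chebyshev,
  on energies close to \<open>n\<mu>\<close>.

  Lower bound. Since \<open>|0\<rangle>\<langle>0| \<le> m u\<^sub>m\<close> and any state of \<open>R\<close> is at most \<open>|R| exp(\<beta>\<parallel>H\<parallel>)\<close> times its Gibbs
  state, and thermal operations preserve positivity and Gibbs states, every reachable output is at most
  \<open>m |R| exp(\<beta>\<parallel>H\<parallel>) \<gamma>\<^sup>n\<close>. Testing this against the part of \<open>\<psi>\<^sup>n\<close> with energies at least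
  \<open>n(\<mu> - \<delta>)\<close> bounds \<open>m\<close> from below; the factor coming from \<open>R\<close> is subexponential.

  Upper bound. Cut \<open>\<psi>\<^sup>n\<close> to the energies in a window of width \<open>O(n\<^bsup>2/3\<^esup>)\<close> around \<open>n\<mu>\<close>. The system
  \<open>R\<close> has one level per energy in the window (polynomially many) and carries the coherent superposition.
  The bath is the direct sum of \<open>B\<^bsup>\<otimes>a\<^esup>\<close>, \<open>a \<le> N + 1\<close>, where \<open>B = A\<^sup>n\<close>, with Hamiltonian
  \<open>- ln \<gamma> / \<beta>\<close> on every tensor factor, so that its Gibbs state is uniform over \<open>a\<close>. The energy-conserving
  map \<open>|0\<rangle> |r\<rangle> |w\<rangle> |b\<rangle> \<mapsto> |1\<rangle> |ground\<rangle> |wb\<rangle> |\<phi>\<^sub>r\<rangle>\<close>, with \<open>w\<close> a bath word, absorbs the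
  thermal content \<open>b\<close> of \<open>B\<close> into the bath and writes the energy eigenvector \<open>\<phi>\<^sub>r\<close> of \<open>\<psi>\<^sup>n\<close> into \<open>B\<close>;
  it fails only on the longest words, with probability \<open>1/(N + 2)\<close>.
\<close>

subsection \<open>Matrices, adjoints and functional calculus\<close>

text \<open>Thermal operations commute with the free evolution, so they cannot create the coherence
  between different energies in \<open>\<psi>\<^sup>n\<close>; it has to be imported through R, and
  the retained energies dictate the levels of R. The window must be wider than the standard
  deviation of the energy, of order sqrt n, and yet sublinear in n, or else R is not admissible. The
  value of m is an energy balance. Let t0 be the smallest retained energy and Z now the partition
  function of B. Absorbing b raises the bath by e_b + ln Z / \<beta>, B goes from e_b to t_r, and R
  drops by t_r - t0. The sum is t0 + ln Z / \<beta>, whatever r, w and b are, and X pays it with its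
  gap ln (m - 1) / \<beta>; hence m = 1 + Z exp (\<beta> t0). Words of variable length make the
  absorption injective without any equipartition estimate for the bath. As the conversion distance
  is an infimum, N may grow at fixed n, so that only the cut to the window contributes to the
  error.\<close>

lemma index_mult_sum:
  assumes "A \<in> carrier_mat n m" "B \<in> carrier_mat m p" "i < n" "j < p"
  shows "(A * B) $$ (i,j) = (\<Sum>k<m. A $$ (i,k) * B $$ (k,j))"
  using assms by (auto simp: scalar_prod_def lessThan_atLeast0)

lemma index_mult_vec_sum:
  assumes "A \<in> carrier_mat n m" "v \<in> carrier_vec m" "i < n"
  shows "(A *\<^sub>v v) $ i = (\<Sum>k<m. A $$ (i,k) * v $ k)"
  using assms by (auto simp: scalar_prod_def lessThan_atLeast0)

lemma dim_adj [simp]: "dim_row (adj A) = dim_col A" "dim_col (adj A) = dim_row A"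
  by (auto simp: adj_def)

lemma adj_carrier [simp, intro]: "A \<in> carrier_mat n m \<Longrightarrow> adj A \<in> carrier_mat m n"
  by (auto simp: adj_def)

lemma index_adj [simp]: "i < dim_col A \<Longrightarrow> j < dim_row A \<Longrightarrow> adj A $$ (i,j) = cnj (A $$ (j,i))"
  by (auto simp: adj_def)

lemma adj_adj [simp]: "adj (adj A) = A"
  by (rule eq_matI) auto

lemma adj_one [simp]: "adj (1\<^sub>m n) = 1\<^sub>m n"
  by (rule eq_matI) auto

lemma mat_assoc: "dim_col A = dim_row B \<Longrightarrow> dim_col B = dim_row C \<Longrightarrow> (A * B) * C = A * (B * C)"
  by (rule assoc_mult_mat[of _ "dim_row A" "dim_row B" _ "dim_row C" _ "dim_col C"]) auto

lemma adj_mult [simp]: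
  assumes "dim_col A = dim_row B"
  shows "adj (A * B) = adj B * adj A"
  by (rule eq_matI) (use assms in \<open>auto simp: scalar_prod_def mult.commute intro!: sum.cong\<close>)

lemma adj_add: "A \<in> carrier_mat n m \<Longrightarrow> B \<in> carrier_mat n m \<Longrightarrow> adj (A + B) = adj A + adj B"
  by (rule eq_matI) auto

lemma adj_minus:
  fixes A B :: "complex mat"
  assumes "dim_row B = dim_row A" "dim_col B = dim_col A"
  shows "adj (A - B) = adj A - adj B"
  by (rule eq_matI) (use assms in auto)

lemma adj_smult: "adj (c \<cdot>\<^sub>m A) = cnj c \<cdot>\<^sub>m adj A"
  by (rule eq_matI) auto

lemma rdiag_carrier [simp, intro]: "rdiag n d \<in> carrier_mat n n"
  by (simp add: rdiag_def)

lemma dim_rdiag [simp]: "dim_row (rdiag n d) = n" "dim_col (rdiag n d) = n"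
  by (simp_all add: rdiag_def)

lemma index_rdiag [simp]: "i < n \<Longrightarrow> j < n \<Longrightarrow> rdiag n d $$ (i,j) = (if i = j then complex_of_real (d i) else 0)"
  by (simp add: rdiag_def)

lemma adj_rdiag [simp]: "adj (rdiag n d) = rdiag n d"
  by (rule eq_matI) auto

lemma index_mult_rdiag:
  assumes "A \<in> carrier_mat n m" "i < n" "j < m"
  shows "(A * rdiag m d) $$ (i,j) = A $$ (i,j) * d j"
  using assms by (subst index_mult_sum[of _ n m _ m]) (auto simp: if_distrib cong: if_cong)

lemma index_rdiag_mult:
  assumes "A \<in> carrier_mat n m" "i < n" "j < m"
  shows "(rdiag n d * A) $$ (i,j) = d i * A $$ (i,j)"
proof -
  have "(rdiag n d * A) $$ (i,j) = (\<Sum>k<n. if k = i then d i * A $$ (i,j) else 0)"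
    unfolding index_mult_sum[OF rdiag_carrier assms] using assms by (intro sum.cong) auto
  then show ?thesis using assms by simp
qed

lemma rdiag_cong: "(\<And>i. i < n \<Longrightarrow> d i = e i) \<Longrightarrow> rdiag n d = rdiag n e"
  by (rule eq_matI) auto

lemma hermitianD: "hermitian n A \<Longrightarrow> A \<in> carrier_mat n n" "hermitian n A \<Longrightarrow> adj A = A"
  by (auto simp: hermitian_def)

lemma hermitian_minus: "hermitian n A \<Longrightarrow> hermitian n B \<Longrightarrow> hermitian n (A - B)"
  by (auto simp: hermitian_def adj_minus intro!: minus_carrier_mat)

lemma unitaryD:
  assumes "unitary n U"
  shows "U \<in> carrier_mat n n" "adj U * U = 1\<^sub>m n" "U * adj U = 1\<^sub>m n" "adj U \<in> carrier_mat n n"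
    "dim_row U = n" "dim_col U = n"
  using assms mat_mult_left_right_inverse[of "adj U" n U] by (auto simp: unitary_def)

lemma unitary_adj: assumes "unitary n U" shows "unitary n (adj U)"
  using unitaryD[OF assms] by (simp add: unitary_def)

lemma unitary_one [simp]: "unitary n (1\<^sub>m n)"
  by (auto simp: unitary_def)

lemma unitary_cancel:
  assumes "unitary n U" "dim_row A = n"
  shows "adj U * (U * A) = A" "U * (adj U * A) = A"
  using unitaryD[OF assms(1)] assms(2) mat_assoc[of "adj U" U A] mat_assoc[of U "adj U" A] by auto

lemma unitary_mult:
  assumes U: "unitary n U" and V: "unitary n V"
  shows "unitary n (U * V)"
  using unitaryD[OF U] unitaryD[OF V] unitary_cancel[OF U] by (simp add: unitary_def mat_assoc)

lemma unitary_cols_orthonormal: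
  assumes "unitary n U" "i < n" "j < n"
  shows "(\<Sum>k<n. cnj (U $$ (k,i)) * U $$ (k,j)) = (if i = j then 1 else 0)"
proof -
  note U = unitaryD[OF assms(1)]
  have "(\<Sum>k<n. cnj (U $$ (k,i)) * U $$ (k,j)) = (adj U * U) $$ (i,j)"
    using U assms by (subst index_mult_sum[of _ n n _ n]) auto
  also have "\<dots> = (if i = j then 1 else 0)" using U assms by simp
  finally show ?thesis .
qed

lemma unitary_rows_orthonormal:
  assumes "unitary n U" "i < n" "j < n"
  shows "(\<Sum>k<n. U $$ (i,k) * cnj (U $$ (j,k))) = (if i = j then 1 else 0)"
  using unitary_cols_orthonormal[OF unitary_adj[OF assms(1)] assms(2,3)] unitaryD[OF assms(1)] assms(2,3) by simp

text \<open>The choice in \<open>herm_fun\<close> is unambiguous: \<open>Q = W\<^sup>\<dagger> U\<close> intertwines the two diagonals entrywise, hence also their images under \<open>f\<close>.\<close>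

lemma herm_fun_spectral:
  assumes U: "unitary n U" and A: "A = U * rdiag n d * adj U"
  shows "herm_fun f A = U * rdiag n (f \<circ> d) * adj U"
proof -
  note cU = unitaryD[OF U]
  have dA: "dim_row A = n" using A cU by auto
  let ?P = "\<lambda>B. \<exists>U d. unitary (dim_row A) U \<and>
      A = U * rdiag (dim_row A) d * adj U \<and> B = U * rdiag (dim_row A) (f \<circ> d) * adj U"
  have ex: "?P (U * rdiag n (f \<circ> d) * adj U)" using U A dA by auto
  have uniq: "B = U * rdiag n (f \<circ> d) * adj U" if "?P B" for B
  proof -
    from that dA obtain W e where W: "unitary n W" and AW: "A = W * rdiag n e * adj W"
      and B: "B = W * rdiag n (f \<circ> e) * adj W" by auto
    note cW = unitaryD[OF W]
    define Q where "Q = adj W * U"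
    have cQ: "Q \<in> carrier_mat n n" using cU cW by (auto simp: Q_def)
    have "Q * rdiag n d = adj W * (A * U)"
      unfolding A Q_def using cU cW unitary_cancel[OF U] unitaryD(2)[OF U] by (simp add: mat_assoc)
    also have "\<dots> = rdiag n e * Q"
      unfolding AW Q_def using cU cW unitary_cancel[OF W] by (simp add: mat_assoc)
    finally have com: "Q * rdiag n d = rdiag n e * Q" .
    have com': "Q * rdiag n (f \<circ> d) = rdiag n (f \<circ> e) * Q"
    proof (rule eq_matI)
      fix i j assume "i < dim_row (rdiag n (f \<circ> e) * Q)" "j < dim_col (rdiag n (f \<circ> e) * Q)"
      then have ij: "i < n" "j < n" using cQ by auto
      have "(Q * rdiag n d) $$ (i,j) = (rdiag n e * Q) $$ (i,j)" by (simp add: com)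
      then have "Q $$ (i,j) * d j = e i * Q $$ (i,j)"
        using ij cQ by (simp only: index_mult_rdiag index_rdiag_mult)
      then have "Q $$ (i,j) = 0 \<or> d j = e i" by auto
      then show "(Q * rdiag n (f \<circ> d)) $$ (i,j) = (rdiag n (f \<circ> e) * Q) $$ (i,j)"
        using ij cQ by (auto simp del: index_mult_mat simp: index_mult_rdiag index_rdiag_mult)
    qed (use cQ in auto)
    have "U * rdiag n (f \<circ> d) * adj U = W * (Q * rdiag n (f \<circ> d)) * adj U"
      using cU cW unitary_cancel[OF W] by (simp add: Q_def mat_assoc)
    also have "\<dots> = W * rdiag n (f \<circ> e) * adj W"
      unfolding com' using cU cW unitary_cancel[OF U] unitaryD(3)[OF U] by (simp add: Q_def mat_assoc)
    finally show ?thesis using B by simp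
  qed
  show ?thesis unfolding herm_fun_def
    by (rule someI2[of ?P, OF ex uniq])
qed

lemma unitary_conj_mult:
  assumes W: "unitary n W" and A: "dim_row A = n" "dim_col A = n" and B: "dim_row B = n" "dim_col B = n"
  shows "(W * A * adj W) * (W * B * adj W) = W * (A * B) * adj W"
  using unitaryD[OF W] unitary_cancel[OF W] A B
  by (simp add: mat_assoc)

lemma rdiag_mult: "rdiag n d * rdiag n e = rdiag n (\<lambda>i. d i * e i)"
  by (rule eq_matI) (auto simp del: index_mult_mat(1) simp: index_mult_rdiag[of _ n n])

subsection \<open>Spectral theorem and positive semidefinite matrices\<close>

text \<open>\<open>U\<close> may be rectangular: products such as \<open>K * F a\<close> are again
  factors of this kind, so the entries of a conjugated state are read off without multiplying
  out.\<close>

lemma index_spectral: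
  assumes "U \<in> carrier_mat m n" "i < m" "j < m"
  shows "(U * rdiag n d * adj U) $$ (i,j) = (\<Sum>k<n. d k * (U $$ (i,k) * cnj (U $$ (j,k))))"
proof -
  have "(U * rdiag n d * adj U) $$ (i,j) = (\<Sum>k<n. (U * rdiag n d) $$ (i,k) * adj U $$ (k,j))"
    by (rule index_mult_sum) (use assms in auto)
  also have "\<dots> = (\<Sum>k<n. d k * (U $$ (i,k) * cnj (U $$ (j,k))))"
    using assms by (intro sum.cong refl) (simp del: index_mult_mat(1) add: index_mult_rdiag)
  finally show ?thesis .
qed

lemma hermitian_spectral_form: "U \<in> carrier_mat n m \<Longrightarrow> hermitian n (U * rdiag m d * adj U)"
  by (auto simp: hermitian_def mat_assoc)

text \<open>A reflection along w = c v - e_0 sends e_0 to the normalised multiple c v. The phase of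
  c makes c v_0 a nonpositive real, so that nothing cancels in w_0 and the squared length of w is 2
  (1 + a) > 0.\<close>

lemma householder:
  fixes v :: "complex vec"
  assumes v: "v \<in> carrier_vec (Suc n)" "v \<noteq> 0\<^sub>v (Suc n)"
  shows "\<exists>U c. unitary (Suc n) U \<and> c \<noteq> 0 \<and> (\<forall>i<Suc n. U $$ (i,0) = c * v $ i)"
proof -
  define N where "N = sqrt (\<Sum>i<Suc n. (cmod (v $ i))\<^sup>2)"
  have "\<exists>i0<Suc n. v $ i0 \<noteq> 0"
  proof (rule ccontr)
    assume "\<not> (\<exists>i0<Suc n. v $ i0 \<noteq> 0)"
    then have "v = 0\<^sub>v (Suc n)" using v(1) by (intro eq_vecI) auto
    then show False using v(2) by simp
  qed
  then obtain i0 where "i0 < Suc n" "v $ i0 \<noteq> 0" by auto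
  then have N2: "(\<Sum>i<Suc n. (cmod (v $ i))\<^sup>2) > 0"
    by (intro sum_pos2[of _ i0]) auto
  then have N: "N > 0" "N^2 = (\<Sum>i<Suc n. (cmod (v $ i))\<^sup>2)" by (auto simp: N_def)
  define ph where "ph = (if v $ 0 = 0 then 1 else - cnj (v $ 0) / cmod (v $ 0))"
  have ph: "cmod ph = 1" "ph * v $ 0 = - complex_of_real (cmod (v $ 0))"
    by (auto simp: ph_def norm_divide field_simps complex_norm_square[symmetric] power2_eq_square)
  define c where "c = ph / N"
  define a where "a = cmod (v $ 0) / N"
  have a: "a \<ge> 0" using N by (simp add: a_def)
  have c0: "c \<noteq> 0" using ph N by (auto simp: c_def)
  define w where "w i = c * v $ i - (if i = 0 then 1 else 0)" for i
  have w0: "w 0 = - complex_of_real (1 + a)" using ph by (simp add: w_def c_def a_def)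
  have cm: "cmod c = 1 / N" using ph N by (simp add: c_def norm_divide)
  have wsum: "(\<Sum>k<Suc n. cnj (w k) * w k) = complex_of_real (2 * (1 + a))"
  proof -
    have "(\<Sum>k<Suc n. (cmod (c * v $ k))\<^sup>2) = (\<Sum>k<Suc n. (cmod (v $ k))\<^sup>2) / N\<^sup>2"
      unfolding sum_divide_distrib by (intro sum.cong refl) (simp add: norm_mult cm power_divide)
    then have t: "(\<Sum>k<Suc n. (cmod (c * v $ k))\<^sup>2) = 1" unfolding N(2)[symmetric] using N(1) by simp
    have c0a: "cmod (c * v $ 0) = a" by (simp add: norm_mult cm a_def)
    have "(\<Sum>k<Suc n. (cmod (w k))\<^sup>2) = (1 + a)\<^sup>2 + (\<Sum>k<n. (cmod (c * v $ Suc k))\<^sup>2)"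
    proof -
      have "cmod (w 0) = 1 + a" using a unfolding w0 norm_minus_cancel norm_of_real by simp
      moreover have "w (Suc k) = c * v $ Suc k" for k by (simp add: w_def)
      ultimately show ?thesis unfolding sum.lessThan_Suc_shift by simp
    qed
    moreover have "a\<^sup>2 + (\<Sum>k<n. (cmod (c * v $ Suc k))\<^sup>2) = 1"
      using t c0a unfolding sum.lessThan_Suc_shift by simp
    ultimately have "(\<Sum>k<Suc n. (cmod (w k))\<^sup>2) = 2 * (1 + a)" by (simp add: power2_eq_square algebra_simps)
    then have "complex_of_real (\<Sum>k<Suc n. (cmod (w k))\<^sup>2) = complex_of_real (2 * (1 + a))" by simp
    then show ?thesis by (simp only: of_real_sum complex_norm_square mult.commute)
  qed
  define s where "s = complex_of_real (1 + a)"
  have s0: "s \<noteq> 0" using a by (auto simp: s_def simp flip: of_real_add)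
  have [simp]: "cnj s = s" by (simp add: s_def)
  have ws: "(\<Sum>k<Suc n. cnj (w k) * w k) = 2 * s" using wsum by (simp add: s_def)
  \<comment> \<open>The factor 2 / |w|^2 of a reflection equals 1 / s.\<close>
  define U where "U = mat (Suc n) (Suc n) (\<lambda>(i,j). (if i = j then 1 else 0) - w i * cnj (w j) / s)"
  have cU: "U \<in> carrier_mat (Suc n) (Suc n)" by (simp add: U_def)
  have adjU: "adj U = U"
    by (rule eq_matI) (auto simp: U_def s_def)
  have "U * U = 1\<^sub>m (Suc n)"
  proof (rule eq_matI)
    fix i j assume "i < dim_row (1\<^sub>m (Suc n) :: complex mat)" "j < dim_col (1\<^sub>m (Suc n) :: complex mat)"
    then have ij: "i < Suc n" "j < Suc n" by auto
    have "(U * U) $$ (i,j) = (\<Sum>k<Suc n. U $$ (i,k) * U $$ (k,j))"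
      by (rule index_mult_sum[OF cU cU ij])
    also have "\<dots> = (\<Sum>k<Suc n. (if k = i then (if i = j then 1 else 0) else 0)
         - (if k = i then w i * cnj (w j) / s else 0) - (if k = j then w i * cnj (w j) / s else 0)
         + w i * cnj (w j) / s^2 * (cnj (w k) * w k))"
      using ij by (intro sum.cong refl) (auto simp: U_def algebra_simps power2_eq_square)
    also have "\<dots> = (if i = j then 1 else 0) - w i * cnj (w j) / s - w i * cnj (w j) / s
         + w i * cnj (w j) / s^2 * (2 * s)"
      unfolding sum.distrib sum_subtractf sum_distrib_left[symmetric] ws using ij by (simp del: sum.lessThan_Suc)
    also have "\<dots> = (if i = j then 1 else 0)" using s0 by (simp add: power2_eq_square)
    finally show "(U * U) $$ (i,j) = 1\<^sub>m (Suc n) $$ (i,j)" using ij by simp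
  qed (use cU in auto)
  then have "unitary (Suc n) U" using cU adjU by (simp add: unitary_def)
  moreover have "U $$ (i,0) = c * v $ i" if "i < Suc n" for i
  proof -
    have "U $$ (i,0) = (if i = 0 then 1 else 0) - w i * cnj (w 0) / s" using that by (simp add: U_def)
    also have "w i * cnj (w 0) / s = - w i" using s0 by (simp add: w0 s_def[symmetric] flip: of_real_add)
    finally show ?thesis by (simp add: w_def)
  qed
  ultimately show ?thesis using c0 by blast
qed

text \<open>Deflation: an eigenvector, which exists over the complex numbers, becomes the first
  column of a unitary up to a scalar. Conjugation then clears the rest of the first column,
  Hermiticity clears the first row and makes the eigenvalue real, and the remaining block is
  smaller.\<close>

theorem hermitian_spectral:
  assumes "hermitian n A"
  shows "\<exists>U d. unitary n U \<and> A = U * rdiag n d * adj U"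
  using assms
proof (induction n arbitrary: A)
  case 0
  then have "A = 1\<^sub>m 0 * rdiag 0 (\<lambda>_. 0) * adj (1\<^sub>m 0)"
    by (intro eq_matI) (auto simp: hermitian_def)
  then show ?case using unitary_one by blast
next
  case (Suc n)
  let ?n = "Suc n"
  note cA = hermitianD(1)[OF Suc.prems]
  from spectrum_non_empty[OF cA] obtain l where "eigenvalue A l" by (auto simp: spectrum_def)
  then obtain v where v: "v \<in> carrier_vec ?n" "v \<noteq> 0\<^sub>v ?n" "A *\<^sub>v v = l \<cdot>\<^sub>v v"
    using cA by (auto simp: eigenvalue_def eigenvector_def)
  obtain U c where U: "unitary ?n U" and U0: "\<And>i. i < ?n \<Longrightarrow> U $$ (i,0) = c * v $ i"
    using householder[OF v(1,2)] by blast
  note cU = unitaryD[OF U]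
  have AU0: "(A * U) $$ (i,0) = l * U $$ (i,0)" if "i < ?n" for i
  proof -
    have "(A * U) $$ (i,0) = (\<Sum>k<?n. A $$ (i,k) * (c * v $ k))"
      using that cA cU U0 by (subst index_mult_sum[of _ ?n ?n _ ?n]) (auto simp del: sum.lessThan_Suc)
    also have "\<dots> = c * (A *\<^sub>v v) $ i"
      unfolding index_mult_vec_sum[OF cA v(1) that] by (simp only: sum_distrib_left mult_ac)
    finally show ?thesis using v that U0 by simp
  qed
  define B where "B = adj U * (A * U)"
  have cB: "B \<in> carrier_mat ?n ?n" using cU cA by (auto simp: B_def)
  have hB: "adj B = B" using cU cA hermitianD(2)[OF Suc.prems] by (simp add: B_def mat_assoc)
  have B0: "B $$ (i,0) = (if i = 0 then l else 0)" if "i < ?n" for i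
  proof -
    have "B $$ (i,0) = (\<Sum>k<?n. adj U $$ (i,k) * (A * U) $$ (k,0))"
      unfolding B_def using that cA cU by (intro index_mult_sum[of _ ?n ?n _ ?n]) auto
    also have "\<dots> = l * (\<Sum>k<?n. cnj (U $$ (k,i)) * U $$ (k,0))"
      unfolding sum_distrib_left using that cU by (intro sum.cong refl) (simp del: index_mult_mat(1) add: AU0)
    finally show ?thesis using that by (simp add: unitary_cols_orthonormal[OF U] del: sum.lessThan_Suc)
  qed
  have Bsym: "B $$ (i,j) = cnj (B $$ (j,i))" if "i < ?n" "j < ?n" for i j
    using index_adj[of i B j] cB that unfolding hB by auto
  have B0': "B $$ (0,j) = (if j = 0 then l else 0)" if "j < ?n" for j
    using Bsym[of 0 j] B0[of j] B0[of 0] that by auto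
  have lre: "complex_of_real (Re l) = l"
    using Bsym[of 0 0] B0[of 0] by (simp add: complex_eq_iff)
  define A' where "A' = mat n n (\<lambda>(i,j). B $$ (Suc i, Suc j))"
  have "hermitian n A'"
    unfolding hermitian_def
  proof
    show "adj A' = A'"
      by (rule eq_matI) (simp_all add: A'_def Bsym[symmetric])
  qed (simp add: A'_def)
  from Suc.IH[OF this] obtain U' d' where U': "unitary n U'" and A': "A' = U' * rdiag n d' * adj U'" by blast
  note cU' = unitaryD[OF U']
  \<comment> \<open>The eigenvectors of the smaller block, bordered by e_0.\<close>
  define V where "V = mat ?n ?n (\<lambda>(i,j). case i of 0 \<Rightarrow> (if j = 0 then 1 else 0) | Suc i' \<Rightarrow>
      (case j of 0 \<Rightarrow> 0 | Suc j' \<Rightarrow> U' $$ (i',j')))"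
  define d where "d = case_nat (Re l) d'"
  have cV: "V \<in> carrier_mat ?n ?n" by (simp add: V_def)
  have V: "unitary ?n V"
  proof -
    have "adj V * V = 1\<^sub>m ?n"
    proof (rule eq_matI)
      fix i j assume "i < dim_row (1\<^sub>m ?n :: complex mat)" "j < dim_col (1\<^sub>m ?n :: complex mat)"
      then have ij: "i < ?n" "j < ?n" by auto
      have "(adj V * V) $$ (i,j) = (\<Sum>k<?n. cnj (V $$ (k,i)) * V $$ (k,j))"
        using ij cV by (subst index_mult_sum[of _ ?n ?n _ ?n]) (auto simp del: sum.lessThan_Suc)
      also have "\<dots> = (if i = j then 1 else 0)"
        unfolding sum.lessThan_Suc_shift using ij unitary_cols_orthonormal[OF U']
        by (cases i; cases j) (auto simp: V_def)
      finally show "(adj V * V) $$ (i,j) = 1\<^sub>m ?n $$ (i,j)" using ij by simp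
    qed (use cV in auto)
    then show ?thesis using cV by (simp add: unitary_def)
  qed
  have BV: "B = V * rdiag ?n d * adj V"
  proof (rule eq_matI)
    fix i j assume "i < dim_row (V * rdiag ?n d * adj V)" "j < dim_col (V * rdiag ?n d * adj V)"
    then have ij: "i < ?n" "j < ?n" using cV by auto
    have A'ij: "B $$ (Suc i', Suc j') = (\<Sum>k<n. d' k * (U' $$ (i',k) * cnj (U' $$ (j',k))))" if "i' < n" "j' < n" for i' j'
      using index_spectral[OF cU'(1), of i' j' d'] that unfolding A'[symmetric] by (simp add: A'_def)
    have "(V * rdiag ?n d * adj V) $$ (i,j) = (\<Sum>k<?n. d k * (V $$ (i,k) * cnj (V $$ (j,k))))"
      by (rule index_spectral[OF cV ij])
    also have "\<dots> = B $$ (i,j)"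
      unfolding sum.lessThan_Suc_shift using ij A'ij B0 B0' lre
      by (auto simp: V_def d_def split: nat.splits)
    finally show "B $$ (i,j) = (V * rdiag ?n d * adj V) $$ (i,j)" by simp
  qed (use cB cV in auto)
  have "A = U * B * adj U"
    using cA cU unitary_cancel[OF U] by (simp add: B_def mat_assoc)
  also have "\<dots> = (U * V) * rdiag ?n d * adj (U * V)"
    using cU cV by (simp add: BV mat_assoc)
  finally show ?case using unitary_mult[OF U V] by blast
qed

section \<open>Quadratic forms and positivity\<close>

lemma qform_add:
  assumes "v \<in> carrier_vec n" "A \<in> carrier_mat n n" "B \<in> carrier_mat n n"
  shows "qform (A + B) v = qform A v + qform B v"
  using assms by (simp add: qform_def algebra_simps sum.distrib)

lemma qform_minus:
  assumes "v \<in> carrier_vec n" "A \<in> carrier_mat n n" "B \<in> carrier_mat n n"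
  shows "qform (A - B) v = qform A v - qform B v"
  using assms by (simp add: qform_def algebra_simps sum_subtractf)

lemma qform_smult:
  assumes "v \<in> carrier_vec n" "A \<in> carrier_mat n n"
  shows "qform (c \<cdot>\<^sub>m A) v = c * qform A v"
  using assms by (simp add: qform_def sum_distrib_left mult_ac)

lemma qform_spectral:
  assumes U: "U \<in> carrier_mat n m" and v: "v \<in> carrier_vec n"
  shows "qform (U * rdiag m d * adj U) v = complex_of_real (\<Sum>k<m. d k * (cmod (\<Sum>i<n. cnj (U $$ (i,k)) * v $ i))\<^sup>2)"
proof -
  have "qform (U * rdiag m d * adj U) v =
     (\<Sum>i<n. \<Sum>j<n. \<Sum>k<m. d k * (cnj (v $ i) * U $$ (i,k) * (cnj (U $$ (j,k)) * v $ j)))"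
    unfolding qform_def using v U
    by (intro sum.cong) (auto simp del: index_mult_mat(1) simp: index_spectral[OF U] sum_distrib_left sum_distrib_right mult_ac)
  also have "\<dots> = (\<Sum>k<m. \<Sum>i<n. \<Sum>j<n. d k * (cnj (v $ i) * U $$ (i,k) * (cnj (U $$ (j,k)) * v $ j)))"
    by (subst sum.swap[of _ "{..<m}"], subst (2) sum.swap, rule refl)
  also have "\<dots> = (\<Sum>k<m. d k * (cnj (\<Sum>i<n. cnj (U $$ (i,k)) * v $ i) * (\<Sum>i<n. cnj (U $$ (i,k)) * v $ i)))"
    by (simp add: sum_product sum_distrib_left mult_ac)
  also have "\<dots> = complex_of_real (\<Sum>k<m. d k * (cmod (\<Sum>i<n. cnj (U $$ (i,k)) * v $ i))\<^sup>2)"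
    by (simp only: of_real_sum of_real_mult complex_norm_square mult.commute)
  finally show ?thesis .
qed

lemma qform_eigenvector:
  assumes U: "unitary n U" and k: "k < n"
  shows "qform (U * rdiag n d * adj U) (col U k) = complex_of_real (d k)"
proof -
  note cU = unitaryD[OF U]
  have "qform (U * rdiag n d * adj U) (col U k) =
      complex_of_real (\<Sum>l<n. d l * (cmod (\<Sum>i<n. cnj (U $$ (i,l)) * U $$ (i,k)))\<^sup>2)"
    using cU k by (subst qform_spectral[of _ n n]) auto
  also have "(\<Sum>l<n. d l * (cmod (\<Sum>i<n. cnj (U $$ (i,l)) * U $$ (i,k)))\<^sup>2) = (\<Sum>l<n. if l = k then d l else 0)"
    using k by (intro sum.cong refl) (auto simp: unitary_cols_orthonormal[OF U])
  finally show ?thesis using k by simp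
qed

lemma psd_spectral_form:
  assumes "U \<in> carrier_mat n m" "\<And>k. k < m \<Longrightarrow> d k \<ge> 0"
  shows "psd n (U * rdiag m d * adj U)"
  using assms by (auto simp: psd_def hermitian_spectral_form qform_spectral intro!: sum_nonneg)

lemma psd_spectral_nonneg:
  assumes U: "unitary n U" and p: "psd n (U * rdiag n d * adj U)" and k: "k < n"
  shows "d k \<ge> 0"
proof -
  have "0 \<le> Re (qform (U * rdiag n d * adj U) (col U k))"
    using p unitaryD[OF U] k by (auto simp: psd_def)
  then show ?thesis by (simp add: qform_eigenvector[OF U k])
qed

theorem psd_spectral:
  assumes "psd n A"
  shows "\<exists>U d. unitary n U \<and> A = U * rdiag n d * adj U \<and> (\<forall>k<n. d k \<ge> 0)"
  using assms hermitian_spectral[of n A] psd_spectral_nonneg by (metis psd_def)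

lemma psd_carrier: "psd n A \<Longrightarrow> A \<in> carrier_mat n n"
  by (simp add: psd_def hermitian_def)

lemma psd_add: "psd n A \<Longrightarrow> psd n B \<Longrightarrow> psd n (A + B)"
  by (auto simp: psd_def hermitian_def qform_add adj_add)

lemma psd_smult: "psd n A \<Longrightarrow> c \<ge> 0 \<Longrightarrow> psd n (complex_of_real c \<cdot>\<^sub>m A)"
  by (auto simp: psd_def hermitian_def qform_smult adj_smult)

lemma psd_conj:
  assumes "psd n A" "K \<in> carrier_mat m n"
  shows "psd m (K * A * adj K)"
proof -
  obtain U d where U: "unitary n U" and A: "A = U * rdiag n d * adj U" and d: "\<forall>k<n. d k \<ge> 0"
    using psd_spectral[OF assms(1)] by blast
  have "K * A * adj K = (K * U) * rdiag n d * adj (K * U)"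
    using assms(2) unitaryD[OF U] by (simp add: A mat_assoc)
  then show ?thesis using psd_spectral_form[of "K * U" m n d] d assms(2) unitaryD[OF U] by auto
qed

subsection \<open>Kronecker products and composite systems\<close>

lemma sum_divmod:
  fixes f :: "nat \<Rightarrow> nat \<Rightarrow> 'a :: comm_monoid_add"
  shows "(\<Sum>k<a * b. f (k div b) (k mod b)) = (\<Sum>i<a. \<Sum>j<b. f i j)"
proof -
  have "(\<Sum>k<a * b. f (k div b) (k mod b)) = (\<Sum>i<a. \<Sum>k = i * b..<i * b + b. f (k div b) (k mod b))"
    by (rule sum.nat_group[symmetric])
  also have "\<dots> = (\<Sum>i<a. \<Sum>j<b. f i j)"
  proof (rule sum.cong[OF refl])
    fix i
    have "(\<Sum>k = i * b..<i * b + b. f (k div b) (k mod b)) = (\<Sum>j = 0..<b. f ((j + i * b) div b) ((j + i * b) mod b))"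
      using sum.shift_bounds_nat_ivl[of "\<lambda>k. f (k div b) (k mod b)" 0 "i * b" b] by (simp add: add.commute)
    also have "\<dots> = (\<Sum>j<b. f i j)"
      unfolding lessThan_atLeast0 by (intro sum.cong) auto
    finally show "(\<Sum>k = i * b..<i * b + b. f (k div b) (k mod b)) = (\<Sum>j<b. f i j)" .
  qed
  finally show ?thesis .
qed

lemma sum_mult_shift:
  fixes f :: "nat \<Rightarrow> 'a :: comm_monoid_add"
  shows "(\<Sum>k<a * b. f k) = (\<Sum>i<a. \<Sum>j<b. f (i * b + j))"
proof -
  have "(\<Sum>k<a * b. f k) = (\<Sum>k<a * b. f ((k div b) * b + k mod b))" by simp
  also have "\<dots> = (\<Sum>i<a. \<Sum>j<b. f (i * b + j))" by (rule sum_divmod)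
  finally show ?thesis .
qed

lemma div_mod_less:
  fixes i a b :: nat
  assumes "i < a * b" shows "i div b < a" "i mod b < b"
proof -
  have "b > 0" using assms by (cases b) auto
  then show "i div b < a" "i mod b < b" using assms by (auto simp: less_mult_imp_div_less)
qed

lemma mult_add_less:
  fixes i a b :: nat
  assumes "i < a" "j < b" shows "i * b + j < a * b"
proof -
  have "i * b + j < Suc i * b" using assms by simp
  also have "\<dots> \<le> a * b" using assms by (intro mult_le_mono1) simp
  finally show ?thesis .
qed

lemma dim_kron [simp]: "dim_row (kron A B) = dim_row A * dim_row B" "dim_col (kron A B) = dim_col A * dim_col B"
  by (simp_all add: kron_def)

lemma kron_carrier [simp, intro]: "A \<in> carrier_mat a b \<Longrightarrow> B \<in> carrier_mat c d \<Longrightarrow> kron A B \<in> carrier_mat (a * c) (b * d)"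
  by (auto simp: kron_def)

lemma index_kron:
  "i < dim_row A * dim_row B \<Longrightarrow> j < dim_col A * dim_col B \<Longrightarrow>
   kron A B $$ (i,j) = A $$ (i div dim_row B, j div dim_col B) * B $$ (i mod dim_row B, j mod dim_col B)"
  by (simp add: kron_def)

lemma index_mult_dims:
  "i < dim_row A \<Longrightarrow> j < dim_col B \<Longrightarrow> dim_row B = dim_col A \<Longrightarrow>
   (A * B) $$ (i,j) = (\<Sum>k<dim_col A. A $$ (i,k) * B $$ (k,j))"
  by (simp add: scalar_prod_def lessThan_atLeast0)

lemma kron_mult:
  assumes "dim_col A = dim_row C" "dim_col B = dim_row D"
  shows "kron A B * kron C D = kron (A * C) (B * D)"
proof (rule eq_matI)
  fix i j assume "i < dim_row (kron (A * C) (B * D))" "j < dim_col (kron (A * C) (B * D))"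
  then have ij: "i < dim_row A * dim_row B" "j < dim_col C * dim_col D" by auto
  note dm = div_mod_less[OF ij(1)] div_mod_less[OF ij(2)]
  let ?i1 = "i div dim_row B" and ?i2 = "i mod dim_row B" and ?j1 = "j div dim_col D" and ?j2 = "j mod dim_col D"
  have "(kron A B * kron C D) $$ (i,j) = (\<Sum>k<dim_row C * dim_row D. kron A B $$ (i,k) * kron C D $$ (k,j))"
    using ij assms by (subst index_mult_dims) auto
  also have "\<dots> = (\<Sum>k<dim_row C * dim_row D. (\<lambda>k1 k2. (A $$ (?i1,k1) * C $$ (k1,?j1)) * (B $$ (?i2,k2) * D $$ (k2,?j2)))
       (k div dim_row D) (k mod dim_row D))"
    using ij assms by (intro sum.cong refl) (simp add: index_kron mult_ac)
  also have "\<dots> = (\<Sum>k1<dim_row C. \<Sum>k2<dim_row D. (A $$ (?i1,k1) * C $$ (k1,?j1)) * (B $$ (?i2,k2) * D $$ (k2,?j2)))"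
    by (rule sum_divmod)
  also have "\<dots> = (A * C) $$ (?i1,?j1) * (B * D) $$ (?i2,?j2)"
    using dm assms by (subst (1 2) index_mult_dims) (auto simp: sum_product)
  also have "\<dots> = kron (A * C) (B * D) $$ (i,j)"
    using ij by (simp add: index_kron del: index_mult_mat(1))
  finally show "(kron A B * kron C D) $$ (i,j) = kron (A * C) (B * D) $$ (i,j)" .
qed (use assms in auto)

lemma adj_kron [simp]: "adj (kron A B) = kron (adj A) (adj B)"
proof (rule eq_matI)
  fix i j assume "i < dim_row (kron (adj A) (adj B))" "j < dim_col (kron (adj A) (adj B))"
  then have ij: "i < dim_col A * dim_col B" "j < dim_row A * dim_row B" by auto
  then show "adj (kron A B) $$ (i,j) = kron (adj A) (adj B) $$ (i,j)"
    using div_mod_less[OF ij(1)] div_mod_less[OF ij(2)] by (simp add: index_kron)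
qed auto

lemma div_mod_eq_iff: "(i::nat) div b = j div b \<and> i mod b = j mod b \<longleftrightarrow> i = j"
  by (metis div_mult_mod_eq)

lemma kron_rdiag: "kron (rdiag a d) (rdiag b e) = rdiag (a * b) (\<lambda>i. d (i div b) * e (i mod b))"
proof (rule eq_matI)
  fix i j assume "i < dim_row (rdiag (a * b) (\<lambda>i. d (i div b) * e (i mod b)))"
    "j < dim_col (rdiag (a * b) (\<lambda>i. d (i div b) * e (i mod b)))"
  then have ij: "i < a * b" "j < a * b" by auto
  show "kron (rdiag a d) (rdiag b e) $$ (i,j) = rdiag (a * b) (\<lambda>i. d (i div b) * e (i mod b)) $$ (i,j)"
    using ij div_mod_less[OF ij(1)] div_mod_less[OF ij(2)] div_mod_eq_iff[of i b j] by (auto simp: index_kron)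
qed auto

lemma one_eq_rdiag: "1\<^sub>m n = rdiag n (\<lambda>_. 1)"
  by (rule eq_matI) auto

lemma kron_one [simp]: "kron (1\<^sub>m a) (1\<^sub>m b) = 1\<^sub>m (a * b)"
  by (simp add: one_eq_rdiag kron_rdiag)

lemma unitary_kron:
  assumes "unitary a U" "unitary b V" shows "unitary (a * b) (kron U V)"
  using unitaryD[OF assms(1)] unitaryD[OF assms(2)] by (auto simp: unitary_def kron_mult)

lemma kron_spectral:
  assumes "U \<in> carrier_mat a m" "V \<in> carrier_mat b n"
  shows "kron (U * rdiag m d * adj U) (V * rdiag n e * adj V) =
    kron U V * rdiag (m * n) (\<lambda>i. d (i div n) * e (i mod n)) * adj (kron U V)"
  using assms by (simp add: kron_rdiag[symmetric] kron_mult)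

lemma kron_minus_left:
  assumes "A \<in> carrier_mat a b" "B \<in> carrier_mat a b"
  shows "kron (A - B) C = kron A C - kron B C"
proof (rule eq_matI)
  fix i j assume "i < dim_row (kron A C - kron B C)" "j < dim_col (kron A C - kron B C)"
  then have ij: "i < a * dim_row C" "j < b * dim_col C" using assms by auto
  then show "kron (A - B) C $$ (i,j) = (kron A C - kron B C) $$ (i,j)"
    using div_mod_less[OF ij(1)] div_mod_less[OF ij(2)] assms by (simp add: index_kron algebra_simps)
qed (use assms in auto)

lemma kron_minus_right:
  assumes "A \<in> carrier_mat a b" "B \<in> carrier_mat a b"
  shows "kron C (A - B) = kron C A - kron C B"
proof (rule eq_matI)
  fix i j assume "i < dim_row (kron C A - kron C B)" "j < dim_col (kron C A - kron C B)"
  then have ij: "i < dim_row C * a" "j < dim_col C * b" using assms by auto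
  then show "kron C (A - B) $$ (i,j) = (kron C A - kron C B) $$ (i,j)"
    using div_mod_less[OF ij(1)] div_mod_less[OF ij(2)] assms by (simp add: index_kron algebra_simps)
qed (use assms in auto)

lemma kron_smult_left: "kron (c \<cdot>\<^sub>m A) B = c \<cdot>\<^sub>m kron A B"
proof (rule eq_matI)
  fix i j assume "i < dim_row (c \<cdot>\<^sub>m kron A B)" "j < dim_col (c \<cdot>\<^sub>m kron A B)"
  then have ij: "i < dim_row A * dim_row B" "j < dim_col A * dim_col B" by auto
  then show "kron (c \<cdot>\<^sub>m A) B $$ (i,j) = (c \<cdot>\<^sub>m kron A B) $$ (i,j)"
    using div_mod_less[OF ij(1)] div_mod_less[OF ij(2)] by (simp add: index_kron)
qed auto

lemma kron_smult_right: "kron A (c \<cdot>\<^sub>m B) = c \<cdot>\<^sub>m kron A B"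
proof (rule eq_matI)
  fix i j assume "i < dim_row (c \<cdot>\<^sub>m kron A B)" "j < dim_col (c \<cdot>\<^sub>m kron A B)"
  then have ij: "i < dim_row A * dim_row B" "j < dim_col A * dim_col B" by auto
  then show "kron A (c \<cdot>\<^sub>m B) $$ (i,j) = (c \<cdot>\<^sub>m kron A B) $$ (i,j)"
    using div_mod_less[OF ij(1)] div_mod_less[OF ij(2)] by (simp add: index_kron)
qed auto

lemma mod_mult_div: "(i::nat) mod (b * c) div c = i div c mod b"
proof (cases "c = 0")
  case False
  have "i mod (b * c) div c = (c * (i div c mod b) + i mod c) div c"
    by (simp only: mod_mult2_eq mult.commute[of b c])
  then show ?thesis using False by simp
qed simp

lemma mod_mult_mod: "(i::nat) mod (b * c) mod c = i mod c"
  by (simp add: mod_mod_cancel)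

lemma div_mult_div: "(i::nat) div (b * c) = i div c div b"
  by (simp add: div_mult2_eq[symmetric] mult.commute)

lemma kron_assoc: "kron (kron A B) C = kron A (kron B C)"
proof (rule eq_matI)
  fix i j assume "i < dim_row (kron A (kron B C))" "j < dim_col (kron A (kron B C))"
  then have ij: "i < dim_row A * dim_row B * dim_row C" "j < dim_col A * dim_col B * dim_col C" by (auto simp: mult.assoc)
  note a = div_mod_less[OF ij(1)] div_mod_less[OF ij(2)]
  have ij': "i < dim_row A * (dim_row B * dim_row C)" "j < dim_col A * (dim_col B * dim_col C)" using ij by (auto simp: mult.assoc)
  note b = div_mod_less[OF ij'(1)] div_mod_less[OF ij'(2)]
  have "kron (kron A B) C $$ (i,j) = A $$ (i div dim_row C div dim_row B, j div dim_col C div dim_col B) *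
      B $$ (i div dim_row C mod dim_row B, j div dim_col C mod dim_col B) * C $$ (i mod dim_row C, j mod dim_col C)"
    using ij a by (simp add: index_kron)
  moreover have "kron A (kron B C) $$ (i,j) = A $$ (i div (dim_row B * dim_row C), j div (dim_col B * dim_col C)) *
      (B $$ (i mod (dim_row B * dim_row C) div dim_row C, j mod (dim_col B * dim_col C) div dim_col C) *
       C $$ (i mod (dim_row B * dim_row C) mod dim_row C, j mod (dim_col B * dim_col C) mod dim_col C))"
    using ij' b by (simp add: index_kron)
  ultimately show "kron (kron A B) C $$ (i,j) = kron A (kron B C) $$ (i,j)"
    by (simp only: mod_mult_div mod_mult_mod div_mult_div mult.assoc)
qed (auto simp: mult.assoc)

lemma spectral_add:
  assumes U: "U \<in> carrier_mat n m"
  shows "U * rdiag m d * adj U + U * rdiag m e * adj U = U * rdiag m (\<lambda>i. d i + e i) * adj U"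
proof (rule eq_matI)
  fix i j assume "i < dim_row (U * rdiag m (\<lambda>i. d i + e i) * adj U)" "j < dim_col (U * rdiag m (\<lambda>i. d i + e i) * adj U)"
  then have ij: "i < n" "j < n" using U by auto
  then have "(U * rdiag m d * adj U + U * rdiag m e * adj U) $$ (i,j) =
      (U * rdiag m d * adj U) $$ (i,j) + (U * rdiag m e * adj U) $$ (i,j)" using U by simp
  also have "\<dots> = (U * rdiag m (\<lambda>i. d i + e i) * adj U) $$ (i,j)"
    unfolding index_spectral[OF U ij] by (simp add: sum.distrib ring_distribs)
  finally show "(U * rdiag m d * adj U + U * rdiag m e * adj U) $$ (i,j) = (U * rdiag m (\<lambda>i. d i + e i) * adj U) $$ (i,j)" .
qed (use U in auto)

lemma spectral_smult:
  assumes U: "U \<in> carrier_mat n m"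
  shows "complex_of_real c \<cdot>\<^sub>m (U * rdiag m d * adj U) = U * rdiag m (\<lambda>i. c * d i) * adj U"
proof (rule eq_matI)
  fix i j assume "i < dim_row (U * rdiag m (\<lambda>i. c * d i) * adj U)" "j < dim_col (U * rdiag m (\<lambda>i. c * d i) * adj U)"
  then have ij: "i < n" "j < n" using U by auto
  then have "(complex_of_real c \<cdot>\<^sub>m (U * rdiag m d * adj U)) $$ (i,j) = complex_of_real c * (U * rdiag m d * adj U) $$ (i,j)"
    using U by simp
  also have "\<dots> = (U * rdiag m (\<lambda>i. c * d i) * adj U) $$ (i,j)"
    unfolding index_spectral[OF U ij] by (simp add: sum_distrib_left mult.assoc)
  finally show "(complex_of_real c \<cdot>\<^sub>m (U * rdiag m d * adj U)) $$ (i,j) = (U * rdiag m (\<lambda>i. c * d i) * adj U) $$ (i,j)" .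
qed (use U in auto)

lemma tr_spectral:
  assumes U: "unitary n U"
  shows "tr (U * rdiag n d * adj U) = complex_of_real (\<Sum>k<n. d k)"
proof -
  note cU = unitaryD[OF U]
  have "tr (U * rdiag n d * adj U) = (\<Sum>i<n. \<Sum>k<n. d k * (U $$ (i,k) * cnj (U $$ (i,k))))"
    unfolding tr_def using cU by (intro sum.cong) (auto simp del: index_mult_mat(1) simp: index_spectral[OF cU(1)])
  also have "\<dots> = (\<Sum>k<n. d k * (\<Sum>i<n. cnj (U $$ (i,k)) * U $$ (i,k)))"
    by (subst sum.swap) (simp add: sum_distrib_left mult_ac)
  also have "\<dots> = (\<Sum>k<n. d k)" by (simp add: unitary_cols_orthonormal[OF U])
  finally show ?thesis .
qed

section \<open>Hamiltonians and Gibbs states of composite systems\<close>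

lemma sdim_Atom [simp]: "sdim (Atom H) = dim_row H"
  by (simp add: sdim_def)

lemma dim_ham: "dim_row (ham X) = sdim X" "valid X \<Longrightarrow> dim_col (ham X) = sdim X"
proof -
  show "dim_row (ham X) = sdim X" by (simp add: sdim_def)
  have "valid X \<longrightarrow> dim_col (ham X) = dim_row (ham X)"
    by (induction X) (simp_all, metis carrier_matD(2) psd_carrier)
  then show "valid X \<Longrightarrow> dim_col (ham X) = sdim X" by (simp add: sdim_def)
qed

lemma sdim_Comp [simp]: "sdim (Comp X Y) = sdim X * sdim Y"
  by (simp add: sdim_def)

lemma sdim_pos: "valid X \<Longrightarrow> 0 < sdim X"
  by (induction X) auto

lemma ham_Comp: "ham (Comp X Y) = kron (ham X) (1\<^sub>m (sdim Y)) + kron (1\<^sub>m (sdim X)) (ham Y)"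
  by (simp add: sdim_def)

text \<open>Writing both identities as spectral forms with eigenvalue 1 makes the two summands
  diagonal in the common product basis.\<close>

lemma ham_Comp_spectral:
  assumes U: "unitary (sdim X) U" "ham X = U * rdiag (sdim X) d * adj U"
    and V: "unitary (sdim Y) V" "ham Y = V * rdiag (sdim Y) e * adj V"
  shows "ham (Comp X Y) = kron U V * rdiag (sdim X * sdim Y) (\<lambda>i. d (i div sdim Y) + e (i mod sdim Y)) * adj (kron U V)"
proof -
  note cU = unitaryD[OF U(1)] and cV = unitaryD[OF V(1)]
  have 1: "1\<^sub>m (sdim Y) = V * rdiag (sdim Y) (\<lambda>_. 1) * adj V" "1\<^sub>m (sdim X) = U * rdiag (sdim X) (\<lambda>_. 1) * adj U"
    using cU cV by (simp_all add: one_eq_rdiag[symmetric])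
  have c: "kron U V \<in> carrier_mat (sdim X * sdim Y) (sdim X * sdim Y)" using cU cV by auto
  show ?thesis
    unfolding ham_Comp U(2) V(2) 1 kron_spectral[OF cU(1) cV(1)] spectral_add[OF c] by simp
qed

lemma valid_spectral:
  assumes "valid X"
  shows "\<exists>U e. unitary (sdim X) U \<and> ham X = U * rdiag (sdim X) e * adj U \<and> (\<forall>k<sdim X. e k \<ge> 0)"
  using assms
proof (induction X)
  case (Atom H)
  then show ?case using psd_spectral[of "dim_row H" H] by auto
next
  case (Comp X Y)
  then obtain U d V e where
    U: "unitary (sdim X) U" "ham X = U * rdiag (sdim X) d * adj U" "\<forall>k<sdim X. d k \<ge> 0" and
    V: "unitary (sdim Y) V" "ham Y = V * rdiag (sdim Y) e * adj V" "\<forall>k<sdim Y. e k \<ge> 0" by auto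
  have "\<forall>k<sdim (Comp X Y). d (k div sdim Y) + e (k mod sdim Y) \<ge> 0"
    using U(3) V(3) by (auto simp: div_mod_less)
  then show ?case using unitary_kron[OF U(1) V(1)] ham_Comp_spectral[OF U(1,2) V(1,2)]
    unfolding sdim_Comp by blast
qed

lemma gibbs_spectral:
  assumes U: "unitary n U" and H: "H = U * rdiag n e * adj U"
  shows "gibbs \<beta> H = U * rdiag n (\<lambda>i. exp (- \<beta> * e i) / (\<Sum>k<n. exp (- \<beta> * e k))) * adj U"
proof -
  have f: "herm_fun (\<lambda>x. exp (- \<beta> * x)) H = U * rdiag n (\<lambda>i. exp (- \<beta> * e i)) * adj U"
    using herm_fun_spectral[OF U H] by (simp add: comp_def)
  have "gibbs \<beta> H = complex_of_real (1 / (\<Sum>k<n. exp (- \<beta> * e k))) \<cdot>\<^sub>m (U * rdiag n (\<lambda>i. exp (- \<beta> * e i)) * adj U)"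
    unfolding gibbs_def f Let_def tr_spectral[OF U] by simp
  then show ?thesis unfolding spectral_smult[OF unitaryD(1)[OF U]] by simp
qed

lemma gibbs_Comp:
  assumes "valid X" "valid Y"
  shows "gibbs \<beta> (ham (Comp X Y)) = kron (gibbs \<beta> (ham X)) (gibbs \<beta> (ham Y))"
proof -
  from assms obtain U d V e where
    U: "unitary (sdim X) U" "ham X = U * rdiag (sdim X) d * adj U" and
    V: "unitary (sdim Y) V" "ham Y = V * rdiag (sdim Y) e * adj V" using valid_spectral by metis
  have Z: "(\<Sum>k<sdim X * sdim Y. exp (- \<beta> * (d (k div sdim Y) + e (k mod sdim Y)))) =
     (\<Sum>k<sdim X. exp (- \<beta> * d k)) * (\<Sum>k<sdim Y. exp (- \<beta> * e k))"
    using sum_divmod[of "\<lambda>i j. exp (- \<beta> * (d i + e j))" "sdim Y" "sdim X"]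
    by (simp add: sum_product exp_add[symmetric] algebra_simps)
  show ?thesis
    unfolding gibbs_spectral[OF unitary_kron[OF U(1) V(1)] ham_Comp_spectral[OF U V]] Z
      gibbs_spectral[OF U] gibbs_spectral[OF V] kron_spectral[OF unitaryD(1)[OF U(1)] unitaryD(1)[OF V(1)]]
    by (simp add: exp_add[symmetric] algebra_simps)
qed

subsection \<open>Thermal operations preserve positivity and Gibbs states\<close>

lemma psd_kron:
  assumes "psd a A" "psd b B"
  shows "psd (a * b) (kron A B)"
proof -
  obtain U d V e where U: "unitary a U" "A = U * rdiag a d * adj U" "\<forall>k<a. d k \<ge> 0"
    and V: "unitary b V" "B = V * rdiag b e * adj V" "\<forall>k<b. e k \<ge> 0"
    using assms psd_spectral by metis
  show ?thesis
    unfolding U(2) V(2) kron_spectral[OF unitaryD(1)[OF U(1)] unitaryD(1)[OF V(1)]]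
    by (rule psd_spectral_form) (use U V unitaryD(1)[OF U(1)] unitaryD(1)[OF V(1)] in \<open>auto simp: div_mod_less\<close>)
qed

lemma ptr_carrier [simp, intro]: "ptr1 dX dY M \<in> carrier_mat dY dY" "ptr2 dX dY M \<in> carrier_mat dX dX"
  by (simp_all add: ptr1_def ptr2_def)

lemma dim_ptr [simp]: "dim_row (ptr1 dX dY M) = dY" "dim_col (ptr1 dX dY M) = dY"
    "dim_row (ptr2 dX dY M) = dX" "dim_col (ptr2 dX dY M) = dX"
  by (simp_all add: ptr1_def ptr2_def)

lemma ptr2_kron:
  assumes "A \<in> carrier_mat a a" "B \<in> carrier_mat b b"
  shows "ptr2 a b (kron A B) = tr B \<cdot>\<^sub>m A"
  by (rule eq_matI)
    (use assms in \<open>auto simp: ptr2_def tr_def index_kron mult_add_less sum_distrib_left mult.commute intro!: sum.cong\<close>)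

lemma ptr1_kron:
  assumes "A \<in> carrier_mat a a" "B \<in> carrier_mat b b"
  shows "ptr1 a b (kron A B) = tr A \<cdot>\<^sub>m B"
  by (rule eq_matI)
    (use assms in \<open>auto simp: ptr1_def tr_def index_kron mult_add_less sum_distrib_right intro!: sum.cong\<close>)

text \<open>The vectors on the right are v tensor |k>, in the index convention i * b + k. Positivity
  of the partial trace is immediate from this form; \<open>qform_ptr1\<close> does the same for the
  other factor.\<close>

lemma qform_ptr2:
  assumes v: "v \<in> carrier_vec a"
  shows "qform (ptr2 a b M) v = (\<Sum>k<b. qform M (vec (a * b) (\<lambda>i. if i mod b = k then v $ (i div b) else 0)))"
proof -
  have "qform M (vec (a * b) (\<lambda>i. if i mod b = k then v $ (i div b) else 0)) =
     (\<Sum>i<a. \<Sum>j<a. cnj (v $ i) * M $$ (i * b + k, j * b + k) * v $ j)" if k: "k < b" for k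
  proof -
    have "qform M (vec (a * b) (\<lambda>i. if i mod b = k then v $ (i div b) else 0)) =
      (\<Sum>i<a. \<Sum>x<b. \<Sum>j<a. \<Sum>y<b. if y = k then (if x = k then cnj (v $ i) * M $$ (i * b + k, j * b + k) * v $ j else 0) else 0)"
      unfolding qform_def dim_vec sum_mult_shift[of _ a b] using k
      by (intro sum.cong refl) (simp add: mult_add_less)
    also have "\<dots> = (\<Sum>i<a. \<Sum>x<b. \<Sum>j<a. if x = k then cnj (v $ i) * M $$ (i * b + k, j * b + k) * v $ j else 0)"
      using k by simp
    also have "\<dots> = (\<Sum>i<a. \<Sum>j<a. \<Sum>x<b. if x = k then cnj (v $ i) * M $$ (i * b + k, j * b + k) * v $ j else 0)"
      by (intro sum.cong refl sum.swap)
    finally show ?thesis using k by simp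
  qed
  then have "(\<Sum>k<b. qform M (vec (a * b) (\<lambda>i. if i mod b = k then v $ (i div b) else 0))) =
     (\<Sum>k<b. \<Sum>i<a. \<Sum>j<a. cnj (v $ i) * M $$ (i * b + k, j * b + k) * v $ j)" by simp
  also have "\<dots> = (\<Sum>i<a. \<Sum>j<a. \<Sum>k<b. cnj (v $ i) * M $$ (i * b + k, j * b + k) * v $ j)"
    by (subst sum.swap, intro sum.cong refl sum.swap)
  also have "\<dots> = qform (ptr2 a b M) v"
    using v by (simp add: qform_def ptr2_def sum_distrib_left sum_distrib_right)
  finally show ?thesis by simp
qed

lemma qform_ptr1:
  assumes v: "v \<in> carrier_vec b"
  shows "qform (ptr1 a b M) v = (\<Sum>k<a. qform M (vec (a * b) (\<lambda>i. if i div b = k then v $ (i mod b) else 0)))"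
proof -
  have "qform M (vec (a * b) (\<lambda>i. if i div b = k then v $ (i mod b) else 0)) =
     (\<Sum>i<b. \<Sum>j<b. cnj (v $ i) * M $$ (k * b + i, k * b + j) * v $ j)" if k: "k < a" for k
  proof -
    have "qform M (vec (a * b) (\<lambda>i. if i div b = k then v $ (i mod b) else 0)) =
      (\<Sum>x<a. \<Sum>i<b. \<Sum>y<a. \<Sum>j<b. if y = k then (if x = k then cnj (v $ i) * M $$ (k * b + i, k * b + j) * v $ j else 0) else 0)"
      unfolding qform_def dim_vec sum_mult_shift[of _ a b] using k
      by (intro sum.cong refl) (simp add: mult_add_less)
    also have "\<dots> = (\<Sum>x<a. \<Sum>i<b. \<Sum>j<b. \<Sum>y<a. if y = k then (if x = k then cnj (v $ i) * M $$ (k * b + i, k * b + j) * v $ j else 0) else 0)"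
      by (intro sum.cong refl sum.swap)
    also have "\<dots> = (\<Sum>x<a. \<Sum>i<b. \<Sum>j<b. if x = k then cnj (v $ i) * M $$ (k * b + i, k * b + j) * v $ j else 0)"
      using k by simp
    also have "\<dots> = (\<Sum>i<b. \<Sum>x<a. \<Sum>j<b. if x = k then cnj (v $ i) * M $$ (k * b + i, k * b + j) * v $ j else 0)"
      by (rule sum.swap)
    also have "\<dots> = (\<Sum>i<b. \<Sum>j<b. \<Sum>x<a. if x = k then cnj (v $ i) * M $$ (k * b + i, k * b + j) * v $ j else 0)"
      by (intro sum.cong refl sum.swap)
    finally show ?thesis using k by simp
  qed
  then have "(\<Sum>k<a. qform M (vec (a * b) (\<lambda>i. if i div b = k then v $ (i mod b) else 0))) =
     (\<Sum>k<a. \<Sum>i<b. \<Sum>j<b. cnj (v $ i) * M $$ (k * b + i, k * b + j) * v $ j)" by simp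
  also have "\<dots> = (\<Sum>i<b. \<Sum>j<b. \<Sum>k<a. cnj (v $ i) * M $$ (k * b + i, k * b + j) * v $ j)"
    by (subst sum.swap, intro sum.cong refl sum.swap)
  also have "\<dots> = qform (ptr1 a b M) v"
    using v by (simp add: qform_def ptr1_def sum_distrib_left sum_distrib_right)
  finally show ?thesis by simp
qed

lemma hermitian_index: "hermitian n M \<Longrightarrow> i < n \<Longrightarrow> j < n \<Longrightarrow> cnj (M $$ (j,i)) = M $$ (i,j)"
  by (metis hermitian_def carrier_matD index_adj)

lemma hermitianI:
  assumes "M \<in> carrier_mat n n" "\<And>i j. i < n \<Longrightarrow> j < n \<Longrightarrow> cnj (M $$ (j,i)) = M $$ (i,j)"
  shows "hermitian n M"
  unfolding hermitian_def using assms by (intro conjI eq_matI) auto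

lemma psd_ptr2: assumes "psd (a * b) M" shows "psd a (ptr2 a b M)"
proof -
  have h: "hermitian (a * b) M" using assms by (simp add: psd_def)
  have "hermitian a (ptr2 a b M)"
    by (rule hermitianI) (simp_all add: ptr2_def mult_add_less hermitian_index[OF h])
  moreover have "0 \<le> Re (qform (ptr2 a b M) v)" if "v \<in> carrier_vec a" for v
    unfolding qform_ptr2[OF that] Re_sum using assms by (auto simp: psd_def intro!: sum_nonneg)
  ultimately show ?thesis by (simp add: psd_def)
qed

lemma psd_ptr1: assumes "psd (a * b) M" shows "psd b (ptr1 a b M)"
proof -
  have h: "hermitian (a * b) M" using assms by (simp add: psd_def)
  have "hermitian b (ptr1 a b M)"
    by (rule hermitianI) (simp_all add: ptr1_def mult_add_less hermitian_index[OF h])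
  moreover have "0 \<le> Re (qform (ptr1 a b M) v)" if "v \<in> carrier_vec b" for v
    unfolding qform_ptr1[OF that] Re_sum using assms by (auto simp: psd_def intro!: sum_nonneg)
  ultimately show ?thesis by (simp add: psd_def)
qed

lemma gibbs_psd_trace:
  assumes "valid X"
  shows "psd (sdim X) (gibbs \<beta> (ham X))" "tr (gibbs \<beta> (ham X)) = 1"
proof -
  obtain U e where U: "unitary (sdim X) U" "ham X = U * rdiag (sdim X) e * adj U"
    using valid_spectral[OF assms] by blast
  have Z: "(\<Sum>k<sdim X. exp (- \<beta> * e k)) > 0"
    using sdim_pos[OF assms] by (intro sum_pos) auto
  show "psd (sdim X) (gibbs \<beta> (ham X))"
    unfolding gibbs_spectral[OF U] by (rule psd_spectral_form) (use U Z unitaryD in auto)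
  show "tr (gibbs \<beta> (ham X)) = 1"
    unfolding gibbs_spectral[OF U] tr_spectral[OF U(1)] sum_divide_distrib[symmetric] using Z by simp
qed

lemma gibbs_carrier: "valid X \<Longrightarrow> gibbs \<beta> (ham X) \<in> carrier_mat (sdim X) (sdim X)"
  by (intro psd_carrier gibbs_psd_trace)

text \<open>\<open>U * W\<close> is a second eigenbasis of the Hamiltonian with the same list of
  eigenvalues, so the spectral formula for the Gibbs state may be evaluated in either basis.\<close>

lemma gibbs_unitary:
  assumes X: "valid X" and U: "unitary (sdim X) U" "U * ham X = ham X * U"
  shows "U * gibbs \<beta> (ham X) * adj U = gibbs \<beta> (ham X)"
proof -
  obtain W e where W: "unitary (sdim X) W" "ham X = W * rdiag (sdim X) e * adj W"
    using valid_spectral[OF X] by blast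
  note c = unitaryD[OF U(1)] unitaryD[OF W(1)] dim_ham[of X] X
  have "ham X = ham X * (U * adj U)" using c by simp
  also have "\<dots> = U * ham X * adj U" unfolding U(2) using c by (simp add: mat_assoc)
  also have "\<dots> = (U * W) * rdiag (sdim X) e * adj (U * W)" unfolding W(2) using c by (simp add: mat_assoc)
  finally have "ham X = (U * W) * rdiag (sdim X) e * adj (U * W)" .
  from gibbs_spectral[OF unitary_mult[OF U(1) W(1)] this] gibbs_spectral[OF W, of \<beta>]
  show ?thesis using c by (simp add: mat_assoc)
qed

lemma conj_linear:
  assumes "U \<in> carrier_mat m n" "M \<in> carrier_mat n n" "N \<in> carrier_mat n n"
  shows "U * (a \<cdot>\<^sub>m M - N) * adj U = a \<cdot>\<^sub>m (U * M * adj U) - U * N * adj U"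
proof -
  have "U * (a \<cdot>\<^sub>m M - N) = a \<cdot>\<^sub>m (U * M) - U * N"
    using assms by (simp add: mult_minus_distrib_mat[of _ m n _ n] mult_smult_distrib[of _ m n _ n])
  also have "\<dots> * adj U = (a \<cdot>\<^sub>m (U * M)) * adj U - U * N * adj U"
    by (rule minus_mult_distrib_mat[of _ m n]) (use assms in auto)
  also have "(a \<cdot>\<^sub>m (U * M)) * adj U = a \<cdot>\<^sub>m (U * M * adj U)"
    by (rule mult_smult_assoc_mat[of _ m n]) (use assms in auto)
  finally show ?thesis .
qed

lemma ptr2_linear:
  assumes "M \<in> carrier_mat (a * b) (a * b)" "N \<in> carrier_mat (a * b) (a * b)"
  shows "ptr2 a b (x \<cdot>\<^sub>m M - N) = x \<cdot>\<^sub>m ptr2 a b M - ptr2 a b N"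
  by (rule eq_matI) (use assms in \<open>auto simp: ptr2_def mult_add_less sum_subtractf sum_distrib_left\<close>)

lemma ptr1_linear:
  assumes "M \<in> carrier_mat (a * b) (a * b)" "N \<in> carrier_mat (a * b) (a * b)"
  shows "ptr1 a b (x \<cdot>\<^sub>m M - N) = x \<cdot>\<^sub>m ptr1 a b M - ptr1 a b N"
  by (rule eq_matI) (use assms in \<open>auto simp: ptr1_def mult_add_less sum_subtractf sum_distrib_left\<close>)

text \<open>These are the invariants behind the lower bound, all stable under composition. Linearity
  is recorded for a M - N, the shape in which domination by a multiple of the Gibbs state is
  expressed.\<close>

lemma TO_properties:
  assumes "(X, Y, E) \<in> TO \<beta>"
  shows "valid X \<and> valid Y \<and> (\<forall>M\<in>carrier_mat (sdim X) (sdim X). E M \<in> carrier_mat (sdim Y) (sdim Y)) \<and>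
    (\<forall>M. psd (sdim X) M \<longrightarrow> psd (sdim Y) (E M)) \<and> E (gibbs \<beta> (ham X)) = gibbs \<beta> (ham Y) \<and>
    (\<forall>a. \<forall>M\<in>carrier_mat (sdim X) (sdim X). \<forall>N\<in>carrier_mat (sdim X) (sdim X).
       E (a \<cdot>\<^sub>m M - N) = a \<cdot>\<^sub>m E M - E N)"
  using assms
proof (induction rule: TO.induct)
  case (unitary_op X U)
  then show ?case
    using unitaryD[OF unitary_op(2)] psd_conj[of "sdim X" _ U "sdim X"] gibbs_unitary conj_linear[of U "sdim X" "sdim X"]
    by (auto intro!: mult_carrier_mat[of _ _ "sdim X"])
next
  case (append_r X R)
  note g = gibbs_psd_trace[OF append_r(2), of \<beta>] gibbs_carrier[OF append_r(2), of \<beta>]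
  have "kron (a \<cdot>\<^sub>m M - N) G = a \<cdot>\<^sub>m kron M G - kron N G"
    if "M \<in> carrier_mat (sdim X) (sdim X)" "N \<in> carrier_mat (sdim X) (sdim X)" for a M N G
    using that by (simp add: kron_minus_left[of _ "sdim X" "sdim X"] kron_smult_left)
  then show ?case using append_r g psd_kron by (auto simp del: ham.simps simp: gibbs_Comp)
next
  case (append_l X R)
  note g = gibbs_psd_trace[OF append_l(2), of \<beta>] gibbs_carrier[OF append_l(2), of \<beta>]
  have "kron G (a \<cdot>\<^sub>m M - N) = a \<cdot>\<^sub>m kron G M - kron G N"
    if "M \<in> carrier_mat (sdim X) (sdim X)" "N \<in> carrier_mat (sdim X) (sdim X)" for a M N G
    using that by (simp add: kron_minus_right[of _ "sdim X" "sdim X"] kron_smult_right)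
  then show ?case using append_l g psd_kron by (auto simp del: ham.simps simp: gibbs_Comp)
next
  case (trace_r X Y)
  have "ptr2 (sdim X) (sdim Y) (gibbs \<beta> (ham (Comp X Y))) = gibbs \<beta> (ham X)"
    unfolding gibbs_Comp[OF trace_r] using trace_r
    by (subst ptr2_kron) (auto simp: gibbs_carrier gibbs_psd_trace)
  then show ?case using trace_r psd_ptr2 by (auto simp del: ham.simps simp: ptr2_linear)
next
  case (trace_l X Y)
  have "ptr1 (sdim X) (sdim Y) (gibbs \<beta> (ham (Comp X Y))) = gibbs \<beta> (ham Y)"
    unfolding gibbs_Comp[OF trace_l] using trace_l
    by (subst ptr1_kron) (auto simp: gibbs_carrier gibbs_psd_trace)
  then show ?case using trace_l psd_ptr1 by (auto simp del: ham.simps simp: ptr1_linear)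
next
  case (compose X Y E Z F)
  then show ?case by simp
qed

lemma psd_limit:
  assumes T: "\<And>k. psd n (T k)" and L: "L \<in> carrier_mat n n"
    and lim: "\<And>i j. i < n \<Longrightarrow> j < n \<Longrightarrow> (\<lambda>k. T k $$ (i,j)) \<longlonglongrightarrow> L $$ (i,j)"
  shows "psd n L"
proof -
  have h: "hermitian n (T k)" for k using T by (simp add: psd_def)
  have "hermitian n L"
  proof (rule hermitianI[OF L])
    fix i j assume ij: "i < n" "j < n"
    have "(\<lambda>k. cnj (T k $$ (j,i))) \<longlonglongrightarrow> cnj (L $$ (j,i))" by (intro tendsto_cnj lim ij)
    then have "(\<lambda>k. T k $$ (i,j)) \<longlonglongrightarrow> cnj (L $$ (j,i))" by (simp add: hermitian_index[OF h ij])
    then show "cnj (L $$ (j,i)) = L $$ (i,j)" using lim[OF ij] LIMSEQ_unique by blast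
  qed
  moreover have "0 \<le> Re (qform L v)" if v: "v \<in> carrier_vec n" for v
  proof (rule LIMSEQ_le_const)
    show "(\<lambda>k. Re (qform (T k) v)) \<longlonglongrightarrow> Re (qform L v)"
      unfolding qform_def using v by (intro tendsto_intros lim) auto
    show "\<exists>N. \<forall>k\<ge>N. 0 \<le> Re (qform (T k) v)" using T v by (auto simp: psd_def)
  qed
  ultimately show ?thesis by (simp add: psd_def)
qed

text \<open>The approximating thermal operations are applied to c \<gamma> - M. They map Gibbs state
  to Gibbs state, so the images are c \<gamma> minus the image of M, and the positive cone is closed
  under entrywise limits.\<close>

lemma CTO_properties:
  assumes E: "E \<in> CTO \<beta> X Y" and M: "psd (sdim X) M"
  shows "psd (sdim Y) (E M)"
    "psd (sdim X) (complex_of_real c \<cdot>\<^sub>m gibbs \<beta> (ham X) - M) \<Longrightarrow>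
     psd (sdim Y) (complex_of_real c \<cdot>\<^sub>m gibbs \<beta> (ham Y) - E M)"
proof -
  note cM = psd_carrier[OF M]
  obtain T where T: "\<And>k. (X, Y, T k) \<in> TO \<beta>"
    and lim: "\<And>i j. i < sdim Y \<Longrightarrow> j < sdim Y \<Longrightarrow> (\<lambda>k. T k M $$ (i,j)) \<longlonglongrightarrow> E M $$ (i,j)"
    and cE: "E M \<in> carrier_mat (sdim Y) (sdim Y)"
    using E cM unfolding CTO_def by blast
  note TP = TO_properties[OF T]
  have v: "valid X" "valid Y" using TP by auto
  show "psd (sdim Y) (E M)" by (rule psd_limit[OF _ cE lim]) (use TP M in auto)
  assume p: "psd (sdim X) (complex_of_real c \<cdot>\<^sub>m gibbs \<beta> (ham X) - M)"
  note g = gibbs_carrier[OF v(1), of \<beta>] gibbs_carrier[OF v(2), of \<beta>]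
  have eq: "T k (complex_of_real c \<cdot>\<^sub>m gibbs \<beta> (ham X) - M) = complex_of_real c \<cdot>\<^sub>m gibbs \<beta> (ham Y) - T k M" for k
    using TP[of k] g cM by auto
  have cT: "T k M \<in> carrier_mat (sdim Y) (sdim Y)" for k using TP cM by auto
  show "psd (sdim Y) (complex_of_real c \<cdot>\<^sub>m gibbs \<beta> (ham Y) - E M)"
  proof (rule psd_limit)
    show "psd (sdim Y) (complex_of_real c \<cdot>\<^sub>m gibbs \<beta> (ham Y) - T k M)" for k
      using TP[of k] p unfolding eq[symmetric] by blast
    show "complex_of_real c \<cdot>\<^sub>m gibbs \<beta> (ham Y) - E M \<in> carrier_mat (sdim Y) (sdim Y)"
      using g cE by auto
    show "(\<lambda>k. (complex_of_real c \<cdot>\<^sub>m gibbs \<beta> (ham Y) - T k M) $$ (i,j)) \<longlonglongrightarrow>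
       (complex_of_real c \<cdot>\<^sub>m gibbs \<beta> (ham Y) - E M) $$ (i,j)" if ij: "i < sdim Y" "j < sdim Y" for i j
    proof -
      have 1: "(complex_of_real c \<cdot>\<^sub>m gibbs \<beta> (ham Y) - N) $$ (i,j) = complex_of_real c * gibbs \<beta> (ham Y) $$ (i,j) - N $$ (i,j)"
        if "N \<in> carrier_mat (sdim Y) (sdim Y)" for N
        using that ij g by simp
      show ?thesis unfolding 1[OF cT] 1[OF cE] by (intro tendsto_intros lim ij)
    qed
  qed
qed

lemma TO_imp_CTO: "(X, Y, E) \<in> TO \<beta> \<Longrightarrow> E \<in> CTO \<beta> X Y"
  using TO_properties[of X Y E \<beta>] unfolding CTO_def by (auto intro!: exI[of _ "\<lambda>_. E"])

text \<open>Appending the target in its Gibbs state and discarding the source is always allowed.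
  This keeps the set inside \<open>conv_dist\<close> nonempty, so that its real \<open>Inf\<close>
  is meaningful.\<close>

lemma CTO_nonempty:
  assumes "valid X" "valid Y" shows "\<exists>E. E \<in> CTO \<beta> X Y"
  using TO.compose[OF TO.append_r[OF assms] TO.trace_l[OF assms]] TO_imp_CTO by blast

subsection \<open>Trace norm and operator norm\<close>

lemma spectral_sq:
  assumes U: "unitary n U" and A: "A = U * rdiag n d * adj U"
  shows "adj A * A = U * rdiag n (\<lambda>k. (d k)\<^sup>2) * adj U"
proof -
  note c = unitaryD[OF U]
  have "adj A * A = (U * rdiag n d * adj U) * (U * rdiag n d * adj U)"
    using hermitianD(2)[OF hermitian_spectral_form[OF c(1), of d]] A by simp
  also have "\<dots> = U * rdiag n (\<lambda>k. (d k)\<^sup>2) * adj U"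
    using c by (subst unitary_conj_mult[OF U]) (simp_all add: rdiag_mult power2_eq_square)
  finally show ?thesis .
qed

lemma tnorm_spectral:
  assumes U: "unitary n U" and A: "A = U * rdiag n d * adj U"
  shows "tnorm A = (\<Sum>k<n. \<bar>d k\<bar>)"
proof -
  have "herm_fun sqrt (adj A * A) = U * rdiag n (\<lambda>k. \<bar>d k\<bar>) * adj U"
    using herm_fun_spectral[OF U spectral_sq[OF U A], of sqrt] by (simp add: comp_def)
  then show ?thesis by (simp add: tnorm_def tr_spectral[OF U])
qed

lemma tnorm_nonneg: "hermitian n A \<Longrightarrow> 0 \<le> tnorm A"
  using hermitian_spectral[of n A] by (auto simp: tnorm_spectral intro: sum_nonneg)

lemma qform_one: "v \<in> carrier_vec n \<Longrightarrow> qform (1\<^sub>m n) v = complex_of_real (\<Sum>i<n. (cmod (v $ i))\<^sup>2)"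
  using qform_spectral[of "1\<^sub>m n" n n v "\<lambda>_. 1"]
  by (simp add: one_eq_rdiag[symmetric] if_distrib[of cnj] if_distrib[of "\<lambda>x. x * _"] cong: if_cong)

lemma parseval:
  assumes U: "unitary n U" and v: "v \<in> carrier_vec n"
  shows "(\<Sum>k<n. (cmod (\<Sum>i<n. cnj (U $$ (i,k)) * v $ i))\<^sup>2) = (\<Sum>i<n. (cmod (v $ i))\<^sup>2)"
proof -
  note c = unitaryD[OF U]
  have "qform (U * rdiag n (\<lambda>_. 1) * adj U) v = qform (1\<^sub>m n) v"
    using c by (simp add: one_eq_rdiag[symmetric])
  then show ?thesis unfolding qform_spectral[OF c(1) v] qform_one[OF v] of_real_eq_iff by simp
qed

text \<open>In an eigenbasis of A the squared overlaps with v are at most 1 each, so the quadratic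
  form sums the eigenvalues with weights at most 1. It turns a trace distance into a statement about
  one test vector.\<close>

lemma qform_le_tnorm:
  assumes A: "hermitian n A" and v: "v \<in> carrier_vec n" "(\<Sum>i<n. (cmod (v $ i))\<^sup>2) \<le> 1"
  shows "\<bar>Re (qform A v)\<bar> \<le> tnorm A"
proof -
  obtain U d where U: "unitary n U" "A = U * rdiag n d * adj U" using hermitian_spectral[OF A] by blast
  let ?p = "\<lambda>k. (cmod (\<Sum>i<n. cnj (U $$ (i,k)) * v $ i))\<^sup>2"
  have le1: "?p k \<le> 1" if "k < n" for k
  proof -
    have "?p k \<le> (\<Sum>k<n. ?p k)" using that by (intro member_le_sum) auto
    then show ?thesis using parseval[OF U(1) v(1)] v(2) by simp
  qed
  have "\<bar>Re (qform A v)\<bar> = \<bar>\<Sum>k<n. d k * ?p k\<bar>"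
    unfolding U(2) qform_spectral[OF unitaryD(1)[OF U(1)] v(1)] by simp
  also have "\<dots> \<le> (\<Sum>k<n. \<bar>d k * ?p k\<bar>)" by (rule sum_abs)
  also have "\<dots> \<le> (\<Sum>k<n. \<bar>d k\<bar>)"
    using le1 by (intro sum_mono) (auto simp: abs_mult intro: mult_left_le)
  finally show ?thesis by (simp add: tnorm_spectral[OF U])
qed

lemma vnorm_nonneg: "0 \<le> vnorm v" by (simp add: vnorm_def sum_nonneg)

lemma vnorm_sq: "(vnorm v)\<^sup>2 = (\<Sum>i<dim_vec v. (cmod (v $ i))\<^sup>2)" by (simp add: vnorm_def sum_nonneg)

lemma index_adj_mult_self:
  assumes A: "A \<in> carrier_mat n m" "i < m" "j < m"
  shows "(adj A * A) $$ (i,j) = (\<Sum>k<n. cnj (A $$ (k,i)) * A $$ (k,j))"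
  using assms by (subst index_mult_sum[of _ m n _ m]) auto

lemma qform_mult_vec:
  assumes M: "M \<in> carrier_mat n n" and v: "v \<in> carrier_vec n"
  shows "qform M v = (\<Sum>i<n. cnj (v $ i) * (M *\<^sub>v v) $ i)"
  unfolding qform_def using M v
  by (intro sum.cong) (simp_all del: index_mult_mat_vec add: index_mult_vec_sum[OF M v] sum_distrib_left mult.assoc)

lemma inner_mult_vec:
  assumes K: "K \<in> carrier_mat n m" and v: "v \<in> carrier_vec n" and y: "y \<in> carrier_vec m"
  shows "(\<Sum>i<n. cnj (v $ i) * (K *\<^sub>v y) $ i) = (\<Sum>j<m. cnj ((adj K *\<^sub>v v) $ j) * y $ j)"
proof -
  have "(\<Sum>i<n. cnj (v $ i) * (K *\<^sub>v y) $ i) = (\<Sum>i<n. \<Sum>j<m. cnj (v $ i) * (K $$ (i,j) * y $ j))"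
    by (intro sum.cong refl) (simp del: index_mult_mat_vec add: index_mult_vec_sum[OF K y] sum_distrib_left)
  also have "\<dots> = (\<Sum>j<m. \<Sum>i<n. cnj (v $ i) * (K $$ (i,j) * y $ j))" by (rule sum.swap)
  also have "\<dots> = (\<Sum>j<m. cnj ((adj K *\<^sub>v v) $ j) * y $ j)"
    using K by (intro sum.cong refl)
      (simp del: index_mult_mat_vec add: index_mult_vec_sum[OF adj_carrier[OF K] v] sum_distrib_left sum_distrib_right mult_ac)
  finally show ?thesis .
qed

lemma vnorm_mult_sq:
  assumes A: "A \<in> carrier_mat n m" and v: "v \<in> carrier_vec m"
  shows "(vnorm (A *\<^sub>v v))\<^sup>2 = Re (qform (adj A * A) v)"
proof -
  have Av: "A *\<^sub>v v \<in> carrier_vec n" by (rule mult_mat_vec_carrier[OF A v])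
  have "qform (adj A * A) v = (\<Sum>i<m. cnj (v $ i) * (adj A *\<^sub>v (A *\<^sub>v v)) $ i)"
    unfolding qform_mult_vec[OF mult_carrier_mat[OF adj_carrier[OF A] A] v]
      assoc_mult_mat_vec[OF adj_carrier[OF A] A v] ..
  also have "\<dots> = (\<Sum>k<n. cnj ((A *\<^sub>v v) $ k) * (A *\<^sub>v v) $ k)"
    unfolding inner_mult_vec[OF adj_carrier[OF A] v Av] adj_adj ..
  also have "\<dots> = complex_of_real (\<Sum>k<n. (cmod ((A *\<^sub>v v) $ k))\<^sup>2)"
    by (simp only: of_real_sum complex_norm_square mult.commute)
  finally show ?thesis by (simp add: vnorm_sq carrier_matD(1)[OF A] del: index_mult_mat_vec)
qed

lemma vnorm_spectral_le:
  assumes U: "unitary n U" and A: "A = U * rdiag n d * adj U"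
    and b: "\<And>k. k < n \<Longrightarrow> \<bar>d k\<bar> \<le> b" "0 \<le> b" and v: "v \<in> carrier_vec n" "vnorm v = 1"
  shows "vnorm (A *\<^sub>v v) \<le> b"
proof -
  note c = unitaryD[OF U]
  have cA: "A \<in> carrier_mat n n" using A c by auto
  have "(vnorm (A *\<^sub>v v))\<^sup>2 = (\<Sum>k<n. (d k)\<^sup>2 * (cmod (\<Sum>i<n. cnj (U $$ (i,k)) * v $ i))\<^sup>2)"
    unfolding vnorm_mult_sq[OF cA v(1)] spectral_sq[OF U A] qform_spectral[OF c(1) v(1)] by simp
  also have "\<dots> \<le> (\<Sum>k<n. b\<^sup>2 * (cmod (\<Sum>i<n. cnj (U $$ (i,k)) * v $ i))\<^sup>2)"
    using b by (intro sum_mono mult_right_mono) (auto simp: abs_le_square_iff[symmetric])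
  also have "\<dots> = b\<^sup>2 * (vnorm v)\<^sup>2"
    unfolding vnorm_sq using parseval[OF U v(1)] v(1) by (simp add: sum_distrib_left[symmetric])
  finally have "(vnorm (A *\<^sub>v v))\<^sup>2 \<le> b\<^sup>2" using v(2) by simp
  then show ?thesis using b(2) by (rule power2_le_imp_le)
qed

lemma opnorm_le:
  assumes n: "0 < n" and U: "unitary n U" and A: "A = U * rdiag n d * adj U"
    and b: "\<And>k. k < n \<Longrightarrow> \<bar>d k\<bar> \<le> b" "0 \<le> b"
  shows "opnorm A \<le> b"
proof -
  have dc: "dim_col A = n" using A unitaryD[OF U] by auto
  \<comment> \<open>A real \<open>Sup\<close> can be bounded from above only over a nonempty set;
    the unit vector exists because the dimension is positive.\<close>
  have "vnorm (unit_vec n 0) = 1"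
    using n by (simp add: vnorm_def unit_vec_def if_distrib[of cmod] if_distrib[of "\<lambda>x. x\<^sup>2"] cong: if_cong)
  then have "{vnorm (A *\<^sub>v v) | v. v \<in> carrier_vec (dim_col A) \<and> vnorm v = 1} \<noteq> {}"
    using dc unit_vec_carrier[of n 0] by blast
  then show ?thesis unfolding opnorm_def dc
    by (intro cSup_least) (auto intro: vnorm_spectral_le[OF U A b])
qed

lemma eigenvalue_le_opnorm:
  assumes U: "unitary n U" and A: "A = U * rdiag n d * adj U" and k: "k < n"
  shows "\<bar>d k\<bar> \<le> opnorm A"
proof -
  note c = unitaryD[OF U]
  have cA: "A \<in> carrier_mat n n" using A c by auto
  have dc: "dim_col A = n" using cA by auto
  let ?b = "\<Sum>k<n. \<bar>d k\<bar>"
  have b: "\<bar>d k\<bar> \<le> ?b" if "k < n" for k using that by (intro member_le_sum) auto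
  \<comment> \<open>A real \<open>Sup\<close> dominates its members only if the set is bounded; the
    crude bound \<open>?b\<close> is enough for that.\<close>
  have bdd: "bdd_above {vnorm (A *\<^sub>v v) | v. v \<in> carrier_vec (dim_col A) \<and> vnorm v = 1}"
    unfolding dc by (rule bdd_aboveI[of _ ?b]) (auto intro!: vnorm_spectral_le[OF U A b] sum_nonneg)
  define x where "x = col U k"
  have x: "x \<in> carrier_vec n" using c k by (auto simp: x_def)
  have xi: "(\<Sum>i<n. cnj (U $$ (i,l)) * x $ i) = (if l = k then 1 else 0)" if "l < n" for l
    using unitary_cols_orthonormal[OF U that k] c k by (simp add: x_def)
  have "(vnorm x)\<^sup>2 = 1"
    unfolding vnorm_sq using parseval[OF U x] x xi k by (simp add: if_distrib[of cmod] if_distrib[of "\<lambda>x. x\<^sup>2"] cong: if_cong)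
  then have x1: "vnorm x = 1" using vnorm_nonneg[of x] by (simp add: power2_eq_1_iff)
  have "(vnorm (A *\<^sub>v x))\<^sup>2 = (\<Sum>l<n. (d l)\<^sup>2 * (cmod (\<Sum>i<n. cnj (U $$ (i,l)) * x $ i))\<^sup>2)"
    unfolding vnorm_mult_sq[OF cA x] spectral_sq[OF U A] qform_spectral[OF c(1) x] by simp
  also have "\<dots> = (\<Sum>l<n. if l = k then (d l)\<^sup>2 else 0)"
    by (intro sum.cong refl) (auto simp: xi)
  finally have "(vnorm (A *\<^sub>v x))\<^sup>2 = \<bar>d k\<bar>\<^sup>2" using k by simp
  then have "vnorm (A *\<^sub>v x) = \<bar>d k\<bar>" using vnorm_nonneg power2_eq_iff_nonneg abs_ge_zero by blast
  then show ?thesis unfolding opnorm_def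
    using cSup_upper[OF _ bdd] x x1 dc by force
qed

subsection \<open>Gibbs domination of reachable states\<close>

text \<open>The two operators need not commute, so they are compared through the identity.
  Eigenvalues of a density matrix are at most 1, while each Gibbs weight is at least exp (- \<beta>
  opnorm) / dim, because energies are nonnegative and hence Z is at most the dimension.\<close>

lemma density_le_gibbs:
  assumes R: "valid R" and w: "density (sdim R) \<omega>" and b: "0 < \<beta>"
  shows "psd (sdim R) (complex_of_real (sdim R * exp (\<beta> * opnorm (ham R))) \<cdot>\<^sub>m gibbs \<beta> (ham R) - \<omega>)"
proof -
  let ?n = "sdim R" and ?K = "sdim R * exp (\<beta> * opnorm (ham R))"
  obtain U e where U: "unitary ?n U" "ham R = U * rdiag ?n e * adj U" and e: "\<forall>k<?n. e k \<ge> 0"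
    using valid_spectral[OF R] by blast
  obtain V d where V: "unitary ?n V" "\<omega> = V * rdiag ?n d * adj V" "\<forall>k<?n. d k \<ge> 0"
    using w psd_spectral by (metis density_def)
  have "complex_of_real (\<Sum>k<?n. d k) = 1" using w tr_spectral[OF V(1), of d] V(2) by (simp add: density_def)
  then have d1: "(\<Sum>k<?n. d k) = 1" using of_real_eq_1_iff by blast
  have dle: "d k \<le> 1" if "k < ?n" for k
    unfolding d1[symmetric] using that V(3) by (intro member_le_sum) auto
  let ?Z = "\<Sum>k<?n. exp (- \<beta> * e k)"
  let ?g = "\<lambda>k. exp (- \<beta> * e k) / ?Z"
  have Z0: "?Z > 0" using sdim_pos[OF R] by (intro sum_pos) auto
  have "?Z \<le> (\<Sum>k<?n. 1)" using e b by (intro sum_mono) auto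
  then have Z: "?Z \<le> ?n" by simp
  have g: "?K * ?g k \<ge> 1" if k: "k < ?n" for k
  proof -
    have "e k \<le> opnorm (ham R)" using eigenvalue_le_opnorm[OF U k] e k by auto
    then have "\<beta> * opnorm (ham R) + - \<beta> * e k \<ge> 0" using b by (simp add: mult_left_mono)
    then have "exp (\<beta> * opnorm (ham R)) * exp (- \<beta> * e k) \<ge> 1" unfolding exp_add[symmetric] by simp
    moreover have "?n / ?Z \<ge> 1" using Z Z0 by simp
    ultimately have "(?n / ?Z) * (exp (\<beta> * opnorm (ham R)) * exp (- \<beta> * e k)) \<ge> 1 * 1" by (intro mult_mono) auto
    then show ?thesis by simp
  qed
  note cU = unitaryD[OF U(1)] and cV = unitaryD[OF V(1)]
  have G: "complex_of_real ?K \<cdot>\<^sub>m gibbs \<beta> (ham R) = U * rdiag ?n (\<lambda>k. ?K * ?g k) * adj U"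
    unfolding gibbs_spectral[OF U] spectral_smult[OF cU(1)] ..
  have "0 \<le> Re (qform (U * rdiag ?n (\<lambda>k. ?K * ?g k) * adj U - V * rdiag ?n d * adj V) v)" if v: "v \<in> carrier_vec ?n" for v
  proof -
    have "(\<Sum>k<?n. d k * (cmod (\<Sum>i<?n. cnj (V $$ (i,k)) * v $ i))\<^sup>2) \<le> (\<Sum>k<?n. 1 * (cmod (\<Sum>i<?n. cnj (V $$ (i,k)) * v $ i))\<^sup>2)"
      using dle by (intro sum_mono mult_right_mono) auto
    also have "\<dots> = (\<Sum>k<?n. 1 * (cmod (\<Sum>i<?n. cnj (U $$ (i,k)) * v $ i))\<^sup>2)"
      using parseval[OF U(1) v] parseval[OF V(1) v] by simp
    also have "\<dots> \<le> (\<Sum>k<?n. (?K * ?g k) * (cmod (\<Sum>i<?n. cnj (U $$ (i,k)) * v $ i))\<^sup>2)"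
      using g by (intro sum_mono mult_right_mono) auto
    finally show ?thesis
      by (subst qform_minus[OF v]) (use cU cV v in \<open>auto simp: qform_spectral\<close>)
  qed
  moreover have "hermitian ?n (U * rdiag ?n (\<lambda>k. ?K * ?g k) * adj U - V * rdiag ?n d * adj V)"
    by (intro hermitian_minus hermitian_spectral_form cU(1) cV(1))
  ultimately show ?thesis unfolding G V(2) psd_def by blast
qed

section \<open>The qubit X and the bound on all reachable outputs\<close>

lemma rdiag_spectral: "rdiag n d = 1\<^sub>m n * rdiag n d * adj (1\<^sub>m n)"
  by simp

lemma psd_rdiag: "(\<And>k. k < n \<Longrightarrow> 0 \<le> d k) \<Longrightarrow> psd n (rdiag n d)"
  using psd_spectral_form[of "1\<^sub>m n" n n d] by simp

lemma gibbs_rdiag: "gibbs \<beta> (rdiag n e) = rdiag n (\<lambda>i. exp (- \<beta> * e i) / (\<Sum>k<n. exp (- \<beta> * e k)))"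
  using gibbs_spectral[OF unitary_one rdiag_spectral, of \<beta> n e] by simp

lemma valid_rdiag: "0 < n \<Longrightarrow> (\<And>k. k < n \<Longrightarrow> 0 \<le> e k) \<Longrightarrow> valid (Atom (rdiag n e))"
  by (simp add: psd_rdiag)

lemma qubit_ham_eq: "qubit_ham \<beta> m = rdiag 2 (\<lambda>i. if 2 \<le> m then (if i = 0 then ln (m - 1) / \<beta> else 0)
    else (if i = 0 then 0 else - ln (m - 1) / \<beta>))"
  by (auto simp: qubit_ham_def)

lemma valid_qubit:
  assumes "1 < m" "0 < \<beta>" shows "valid (Atom (qubit_ham \<beta> m))" "sdim (Atom (qubit_ham \<beta> m)) = 2"
proof -
  show "valid (Atom (qubit_ham \<beta> m))"
    unfolding qubit_ham_eq by (rule valid_rdiag) (use assms in \<open>auto simp: divide_le_0_iff\<close>)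
qed (simp add: qubit_ham_eq)

text \<open>In both branches of the energy shift the Boltzmann weight of level 0 relative to level 1
  is 1 / (m - 1).\<close>

lemma gibbs_qubit:
  assumes m: "1 < m" and b: "0 < \<beta>"
  shows "gibbs \<beta> (qubit_ham \<beta> m) = rdiag 2 (\<lambda>i. if i = 0 then 1 / m else (m - 1) / m)"
proof -
  have x: "exp (- ln (m - 1)) = 1 / (m - 1)" "exp (ln (m - 1)) = m - 1"
    using m by (simp_all add: exp_minus inverse_eq_divide)
  have y: "1 / (m - 1) + 1 = m / (m - 1)" using m by (simp add: field_simps)
  show ?thesis unfolding qubit_ham_eq gibbs_rdiag
  proof (rule rdiag_cong)
    fix i :: nat assume "i < 2"
    then have "i = 0 \<or> i = 1" by auto
    then show "exp (- \<beta> * (if 2 \<le> m then if i = 0 then ln (m - 1) / \<beta> else 0 else if i = 0 then 0 else - ln (m - 1) / \<beta>)) /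
         (\<Sum>k<2::nat. exp (- \<beta> * (if 2 \<le> m then if k = 0 then ln (m - 1) / \<beta> else 0 else if k = 0 then 0 else - ln (m - 1) / \<beta>))) =
         (if i = 0 then 1 / m else (m - 1) / m)"
      using m b by (auto simp: numeral_2_eq_2 x y)
  qed
qed

lemma minus_add_minus_cancel:
  fixes P Q R :: "complex mat"
  assumes "P \<in> carrier_mat n m" "Q \<in> carrier_mat n m" "R \<in> carrier_mat n m"
  shows "P - Q + (Q - R) = P - R"
  by (rule eq_matI) (use assms in auto)

lemma ket0_le_gibbs:
  assumes m: "1 < m" and b: "0 < \<beta>"
  shows "psd 2 (complex_of_real m \<cdot>\<^sub>m gibbs \<beta> (qubit_ham \<beta> m) - ket0)"
proof -
  have "complex_of_real m \<cdot>\<^sub>m gibbs \<beta> (qubit_ham \<beta> m) - ket0 = rdiag 2 (\<lambda>i. if i = 0 then 0 else m - 1)"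
    unfolding gibbs_qubit[OF m b] by (rule eq_matI) (use m in \<open>auto simp: ket0_def\<close>)
  then show ?thesis using m by (auto intro!: psd_rdiag)
qed

lemma ket0_rdiag: "ket0 = rdiag 2 (\<lambda>i. if i = 0 then 1 else 0)"
  by (rule eq_matI) (auto simp: ket0_def)

lemma psd_ket0: "psd 2 ket0"
  unfolding ket0_rdiag by (rule psd_rdiag) auto

text \<open>Domination is multiplicative over tensor products by the telescoping A \<otimes> B - P
  \<otimes> Q = (A - P) \<otimes> B + P \<otimes> (B - Q), in which both terms are positive. Here A
  and B are the Gibbs states scaled by m and \<open>?K\<close>; a closed thermal operation carries
  the bound to the output.\<close>

lemma conversion_bound:
  assumes b: "0 < \<beta>" and m: "1 < m" and B: "valid B" and R: "valid R" and w: "density (sdim R) \<omega>"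
    and E: "E \<in> CTO \<beta> (Comp (Atom (qubit_ham \<beta> m)) R) B"
  shows "psd (sdim B) (E (kron ket0 \<omega>))"
    "psd (sdim B) (complex_of_real (m * (sdim R * exp (\<beta> * opnorm (ham R)))) \<cdot>\<^sub>m gibbs \<beta> (ham B) - E (kron ket0 \<omega>))"
proof -
  let ?X = "Atom (qubit_ham \<beta> m)" and ?n = "sdim R" and ?K = "sdim R * exp (\<beta> * opnorm (ham R))"
  have pw: "psd ?n \<omega>" using w by (simp add: density_def)
  note vX = valid_qubit[OF m b]
  have dX: "dim_row (qubit_ham \<beta> m) = 2" by (simp add: qubit_ham_eq)
  have p: "psd (sdim (Comp ?X R)) (kron ket0 \<omega>)" using psd_kron[OF psd_ket0 pw] dX by simp
  show "psd (sdim B) (E (kron ket0 \<omega>))" by (rule CTO_properties(1)[OF E p])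
  let ?gX = "gibbs \<beta> (qubit_ham \<beta> m)" and ?gR = "gibbs \<beta> (ham R)"
  have gX: "?gX \<in> carrier_mat 2 2" unfolding gibbs_qubit[OF m b] by simp
  note gR = gibbs_carrier[OF R, of \<beta>] and cw = psd_carrier[OF pw]
  have k0: "ket0 \<in> carrier_mat 2 2" by (simp add: ket0_def)
  have pK: "psd ?n (complex_of_real ?K \<cdot>\<^sub>m ?gR)"
    using gibbs_psd_trace(1)[OF R] by (rule psd_smult) auto
  let ?A = "complex_of_real m \<cdot>\<^sub>m ?gX" and ?B = "complex_of_real ?K \<cdot>\<^sub>m ?gR"
  have cA: "?A \<in> carrier_mat 2 2" "?B \<in> carrier_mat ?n ?n" using gX gR by auto
  have "psd (2 * ?n) (kron (?A - ket0) ?B + kron ket0 (?B - \<omega>))"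
    by (intro psd_add psd_kron ket0_le_gibbs m b pK psd_ket0 density_le_gibbs R w)
  also have "kron (?A - ket0) ?B + kron ket0 (?B - \<omega>) = kron ?A ?B - kron ket0 \<omega>"
    unfolding kron_minus_left[OF cA(1) k0] kron_minus_right[OF cA(2) cw]
    by (rule minus_add_minus_cancel[OF kron_carrier[OF cA] kron_carrier[OF k0 cA(2)] kron_carrier[OF k0 cw]])
  also have "kron ?A ?B = complex_of_real (m * ?K) \<cdot>\<^sub>m kron ?gX ?gR"
    unfolding kron_smult_left kron_smult_right by (rule eq_matI) auto
  also have "kron ?gX ?gR = gibbs \<beta> (ham (Comp ?X R))"
    using gibbs_Comp[OF vX(1) R, of \<beta>] by simp
  finally have "psd (sdim (Comp ?X R)) (complex_of_real (m * ?K) \<cdot>\<^sub>m gibbs \<beta> (ham (Comp ?X R)) - kron ket0 \<omega>)"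
    using dX by (simp del: ham.simps)
  then show "psd (sdim B) (complex_of_real (m * ?K) \<cdot>\<^sub>m gibbs \<beta> (ham B) - E (kron ket0 \<omega>))"
    by (rule CTO_properties(2)[OF E p])
qed

subsection \<open>Energy distribution of many copies\<close>

lemma qform_conj:
  assumes K: "K \<in> carrier_mat n m" and M: "M \<in> carrier_mat m m" and v: "v \<in> carrier_vec n"
  shows "qform (K * M * adj K) v = qform M (adj K *\<^sub>v v)"
proof -
  have cv: "adj K *\<^sub>v v \<in> carrier_vec m" by (rule mult_mat_vec_carrier[OF adj_carrier[OF K] v])
  have "(K * M * adj K) *\<^sub>v v = K *\<^sub>v (M *\<^sub>v (adj K *\<^sub>v v))"
    using assoc_mult_mat_vec[of "K * M" n m "adj K" n v] assoc_mult_mat_vec[OF K M cv] K M v by simp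
  moreover have "K * M * adj K \<in> carrier_mat n n" using K by (intro carrier_matI) auto
  moreover have "M *\<^sub>v (adj K *\<^sub>v v) \<in> carrier_vec m" by (rule mult_mat_vec_carrier[OF M cv])
  ultimately show ?thesis
    by (simp only: qform_mult_vec[OF _ v] inner_mult_vec[OF K v] qform_mult_vec[OF M cv])
qed

lemma qform_unitary_conj:
  assumes W: "unitary n W" and M: "M \<in> carrier_mat n n" and x: "x \<in> carrier_vec n"
  shows "qform (W * M * adj W) (W *\<^sub>v x) = qform M x"
proof -
  note c = unitaryD[OF W]
  have "adj W *\<^sub>v (W *\<^sub>v x) = x"
    using assoc_mult_mat_vec[OF c(4) c(1) x] c x by simp
  then show ?thesis using qform_conj[OF c(1) M, of "W *\<^sub>v x"] c x by simp
qed

lemma vec_norm_unitary: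
  assumes W: "unitary n W" and x: "x \<in> carrier_vec n"
  shows "(\<Sum>i<n. (cmod ((W *\<^sub>v x) $ i))\<^sup>2) = (\<Sum>i<n. (cmod (x $ i))\<^sup>2)"
proof -
  have "qform (W * 1\<^sub>m n * adj W) (W *\<^sub>v x) = qform (1\<^sub>m n) x"
    by (rule qform_unitary_conj[OF W _ x]) simp
  moreover have "W * 1\<^sub>m n * adj W = 1\<^sub>m n" using unitaryD[OF W] by simp
  moreover have "W *\<^sub>v x \<in> carrier_vec n" using unitaryD[OF W] x by simp
  ultimately show ?thesis by (simp only: qform_one[OF x] qform_one of_real_eq_iff)
qed

lemma ketbra_carrier: "v \<in> carrier_vec n \<Longrightarrow> ketbra v \<in> carrier_mat n n"
  by (simp add: ketbra_def)

lemma dim_ketbra [simp]: "dim_row (ketbra v) = dim_vec v" "dim_col (ketbra v) = dim_vec v"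
  by (simp_all add: ketbra_def)

lemma index_ketbra [simp]: "i < dim_vec v \<Longrightarrow> j < dim_vec v \<Longrightarrow> ketbra v $$ (i,j) = v $ i * cnj (v $ j)"
  by (simp add: ketbra_def)

lemma qform_ketbra:
  assumes "v \<in> carrier_vec n" "x \<in> carrier_vec n"
  shows "qform (ketbra v) x = complex_of_real ((cmod (\<Sum>i<n. cnj (x $ i) * v $ i))\<^sup>2)"
proof -
  have "qform (ketbra v) x = (\<Sum>i<n. cnj (x $ i) * v $ i) * cnj (\<Sum>i<n. cnj (x $ i) * v $ i)"
    using assms by (simp add: qform_def sum_product mult_ac)
  then show ?thesis by (simp only: complex_norm_square)
qed

lemma psd_ketbra: "v \<in> carrier_vec n \<Longrightarrow> psd n (ketbra v)"
  by (auto simp: psd_def qform_ketbra intro!: hermitianI)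

lemma ketbra_mult_vec:
  assumes W: "W \<in> carrier_mat n m" and x: "x \<in> carrier_vec m"
  shows "ketbra (W *\<^sub>v x) = W * ketbra x * adj W"
proof (rule eq_matI)
  have kx: "ketbra x \<in> carrier_mat m m" by (rule ketbra_carrier[OF x])
  fix i j assume "i < dim_row (W * ketbra x * adj W)" "j < dim_col (W * ketbra x * adj W)"
  then have ij: "i < n" "j < n" using W by auto
  have 1: "(W * ketbra x) $$ (i,k) = (W *\<^sub>v x) $ i * cnj (x $ k)" if "k < m" for k
    using index_mult_sum[OF W kx ij(1) that] index_mult_vec_sum[OF W x ij(1)] x that
    by (simp del: index_mult_mat_vec index_mult_mat(1) add: sum_distrib_right mult.assoc)
  have "(W * ketbra x * adj W) $$ (i,j) = (\<Sum>k<m. (W * ketbra x) $$ (i,k) * adj W $$ (k,j))"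
    by (rule index_mult_sum) (use W kx ij in auto)
  also have "\<dots> = (W *\<^sub>v x) $ i * cnj (\<Sum>k<m. W $$ (j,k) * x $ k)"
    using W ij by (simp del: index_mult_mat_vec index_mult_mat(1) add: 1 sum_distrib_left mult_ac)
  also have "\<dots> = ketbra (W *\<^sub>v x) $$ (i,j)"
    using W ij index_mult_vec_sum[OF W x ij(2)] by (simp del: index_mult_mat_vec)
  finally show "ketbra (W *\<^sub>v x) $$ (i,j) = (W * ketbra x * adj W) $$ (i,j)" by simp
qed (use W in auto)

lemma kron_ketbra:
  "kron (ketbra (vec a f)) (ketbra (vec b g)) = ketbra (vec (a * b) (\<lambda>i. f (i div b) * g (i mod b)))"
proof (rule eq_matI)
  let ?h = "\<lambda>i. f (i div b) * g (i mod b)"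
  fix i j assume "i < dim_row (ketbra (vec (a * b) ?h))" "j < dim_col (ketbra (vec (a * b) ?h))"
  then have ij: "i < a * b" "j < a * b" by auto
  then show "kron (ketbra (vec a f)) (ketbra (vec b g)) $$ (i,j) = ketbra (vec (a * b) ?h) $$ (i,j)"
    using div_mod_less[OF ij(1)] div_mod_less[OF ij(2)] by (simp add: index_kron)
qed auto

text \<open>The columns of \<open>W\<close> are energy eigenvectors with eigenvalues \<open>e\<close>, and \<open>c\<close> are the amplitudes of the pure state \<open>\<rho>\<close> in this basis.\<close>

definition energy_frame :: "sys \<Rightarrow> complex mat \<Rightarrow> complex mat \<Rightarrow> (nat \<Rightarrow> real) \<Rightarrow> (nat \<Rightarrow> complex) \<Rightarrow> bool" where
  "energy_frame X \<rho> W e c \<longleftrightarrow> unitary (sdim X) W \<and> ham X = W * rdiag (sdim X) e * adj W \<and>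
     \<rho> = W * ketbra (vec (sdim X) c) * adj W \<and> (\<forall>k<sdim X. 0 \<le> e k)"

lemma energy_frame_exists:
  assumes "valid X" "v \<in> carrier_vec (sdim X)"
  shows "\<exists>W e c. energy_frame X (ketbra v) W e c \<and> (\<Sum>k<sdim X. (cmod (c k))\<^sup>2) = (vnorm v)\<^sup>2"
proof -
  let ?n = "sdim X"
  obtain W e where W: "unitary ?n W" "ham X = W * rdiag ?n e * adj W" "\<forall>k<?n. 0 \<le> e k"
    using valid_spectral[OF assms(1)] by blast
  note c = unitaryD[OF W(1)]
  let ?x = "adj W *\<^sub>v v"
  have x: "?x \<in> carrier_vec ?n" by (rule mult_mat_vec_carrier[OF c(4) assms(2)])
  have v: "W *\<^sub>v ?x = v" using assoc_mult_mat_vec[OF c(1) c(4) assms(2)] c assms by simp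
  have ve: "vec ?n (\<lambda>i. ?x $ i) = ?x" using c(6) by (intro eq_vecI) (simp_all del: index_mult_mat_vec)
  have "ketbra v = W * ketbra (vec ?n (\<lambda>i. ?x $ i)) * adj W"
    unfolding ve using ketbra_mult_vec[OF c(1) x] v by simp
  moreover have "(\<Sum>k<?n. (cmod (?x $ k))\<^sup>2) = (vnorm v)\<^sup>2"
    unfolding vnorm_sq using vec_norm_unitary[OF W(1) x] v assms(2) by (simp del: index_mult_mat_vec)
  ultimately show ?thesis using W unfolding energy_frame_def by blast
qed

lemma energy_frame_Comp:
  assumes X: "energy_frame X \<rho> U d a" and Y: "energy_frame Y \<sigma> V e c"
  shows "energy_frame (Comp X Y) (kron \<rho> \<sigma>) (kron U V) (\<lambda>i. d (i div sdim Y) + e (i mod sdim Y))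
    (\<lambda>i. a (i div sdim Y) * c (i mod sdim Y))"
proof -
  note x = X[unfolded energy_frame_def] and y = Y[unfolded energy_frame_def]
  from x have U: "unitary (sdim X) U" by blast
  from y have V: "unitary (sdim Y) V" by blast
  have "kron \<rho> \<sigma> = kron U V * kron (ketbra (vec (sdim X) a)) (ketbra (vec (sdim Y) c)) * adj (kron U V)"
    using x y unitaryD[OF U] unitaryD[OF V] by (simp add: kron_mult)
  then show ?thesis
    using x y unitary_kron[OF U V] ham_Comp_spectral[OF U _ V, of d e] unfolding energy_frame_def sdim_Comp kron_ketbra
    by (auto simp: div_mod_less simp del: ham.simps adj_kron)
qed

text \<open>\<open>spow A 1\<close> is A itself and not a composite with the trivial system, so the
  recursion has this shape only from one copy on, and inductions over copies start at 1.\<close>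

lemma spow_Suc: "1 \<le> n \<Longrightarrow> spow A (Suc n) = Comp (spow A n) A"
  by (cases n) auto

lemma tpow_Suc: "1 \<le> n \<Longrightarrow> tpow \<rho> (Suc n) = kron (tpow \<rho> n) \<rho>"
  by (cases n) auto

lemma valid_spow:
  assumes A: "valid A" and n: "1 \<le> n" shows "valid (spow A n)"
  using n by (induction n rule: nat_induct_at_least) (simp_all add: A spow_Suc)

text \<open>Normalisation, mean \<mu> and variance s of the energy distribution. The mean is stated
  through the centred sum because this is the factor that kills the cross term for a tensor product,
  so that variances add.\<close>

definition energy_moments :: "nat \<Rightarrow> (nat \<Rightarrow> real) \<Rightarrow> (nat \<Rightarrow> complex) \<Rightarrow> real \<Rightarrow> real \<Rightarrow> bool" where
  "energy_moments D e c \<mu> s \<longleftrightarrow> (\<Sum>k<D. (cmod (c k))\<^sup>2) = 1 \<and> (\<Sum>k<D. (cmod (c k))\<^sup>2 * (e k - \<mu>)) = 0 \<and>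
     (\<Sum>k<D. (cmod (c k))\<^sup>2 * (e k - \<mu>)\<^sup>2) = s"

lemma energy_moments_product:
  assumes "energy_moments a d f \<mu> s" "energy_moments b e g \<nu> t"
  shows "energy_moments (a * b) (\<lambda>i. d (i div b) + e (i mod b)) (\<lambda>i. f (i div b) * g (i mod b)) (\<mu> + \<nu>) (s + t)"
proof -
  let ?p = "\<lambda>i. (cmod (f i))\<^sup>2" and ?q = "\<lambda>j. (cmod (g j))\<^sup>2"
  have F: "sum ?p {..<a} = 1" "(\<Sum>i<a. ?p i * (d i - \<mu>)) = 0" "(\<Sum>i<a. ?p i * (d i - \<mu>)\<^sup>2) = s"
    and G: "sum ?q {..<b} = 1" "(\<Sum>j<b. ?q j * (e j - \<nu>)) = 0" "(\<Sum>j<b. ?q j * (e j - \<nu>)\<^sup>2) = t"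
    using assms by (auto simp: energy_moments_def)
  have "(\<Sum>k<a * b. (cmod (f (k div b) * g (k mod b)))\<^sup>2) = (\<Sum>i<a. \<Sum>j<b. ?p i * ?q j)"
    using sum_divmod[of "\<lambda>i j. ?p i * ?q j" b a] by (simp add: norm_mult power_mult_distrib)
  also have "\<dots> = 1" by (simp add: sum_product[symmetric] F G)
  finally have 1: "(\<Sum>k<a * b. (cmod (f (k div b) * g (k mod b)))\<^sup>2) = 1" .
  have "(\<Sum>k<a * b. (cmod (f (k div b) * g (k mod b)))\<^sup>2 * (d (k div b) + e (k mod b) - (\<mu> + \<nu>))) =
      (\<Sum>i<a. \<Sum>j<b. ?p i * ?q j * (d i + e j - (\<mu> + \<nu>)))"
    using sum_divmod[of "\<lambda>i j. ?p i * ?q j * (d i + e j - (\<mu> + \<nu>))" b a] by (simp add: norm_mult power_mult_distrib)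
  also have "\<dots> = (\<Sum>i<a. \<Sum>j<b. (?p i * (d i - \<mu>)) * ?q j + ?p i * (?q j * (e j - \<nu>)))"
    by (intro sum.cong refl) (simp add: algebra_simps)
  also have "\<dots> = 0" by (simp add: sum.distrib sum_product[symmetric] F G)
  finally have 2: "(\<Sum>k<a * b. (cmod (f (k div b) * g (k mod b)))\<^sup>2 * (d (k div b) + e (k mod b) - (\<mu> + \<nu>))) = 0" .
  have "(\<Sum>k<a * b. (cmod (f (k div b) * g (k mod b)))\<^sup>2 * (d (k div b) + e (k mod b) - (\<mu> + \<nu>))\<^sup>2) =
      (\<Sum>i<a. \<Sum>j<b. ?p i * ?q j * (d i + e j - (\<mu> + \<nu>))\<^sup>2)"
    using sum_divmod[of "\<lambda>i j. ?p i * ?q j * (d i + e j - (\<mu> + \<nu>))\<^sup>2" b a] by (simp add: norm_mult power_mult_distrib)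
  also have "\<dots> = (\<Sum>i<a. \<Sum>j<b. (?p i * (d i - \<mu>)\<^sup>2) * ?q j + 2 * ((?p i * (d i - \<mu>)) * (?q j * (e j - \<nu>)))
      + ?p i * (?q j * (e j - \<nu>)\<^sup>2))"
    by (intro sum.cong refl) (simp add: algebra_simps power2_eq_square)
  also have "\<dots> = s + t"
    by (simp add: sum.distrib sum_product[symmetric] sum_distrib_left[symmetric] sum_distrib_right[symmetric] F G)
  finally show ?thesis using 1 2 by (simp add: energy_moments_def)
qed

lemma chebyshev:
  assumes m: "energy_moments D e c \<mu> s" and t: "0 < t"
  shows "1 - s / t\<^sup>2 \<le> (\<Sum>k | k < D \<and> \<bar>e k - \<mu>\<bar> \<le> t. (cmod (c k))\<^sup>2)"
proof -
  let ?p = "\<lambda>k. (cmod (c k))\<^sup>2" and ?S = "{k. k < D \<and> \<bar>e k - \<mu>\<bar> \<le> t}"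
  have fin: "?S \<subseteq> {..<D}" by auto
  have "(\<Sum>k\<in>{..<D} - ?S. ?p k) * t\<^sup>2 = (\<Sum>k\<in>{..<D} - ?S. ?p k * t\<^sup>2)" by (rule sum_distrib_right)
  also have "\<dots> \<le> (\<Sum>k\<in>{..<D} - ?S. ?p k * (e k - \<mu>)\<^sup>2)"
    using t by (intro sum_mono mult_left_mono) (auto simp: abs_le_square_iff[symmetric])
  also have "\<dots> \<le> (\<Sum>k<D. ?p k * (e k - \<mu>)\<^sup>2)" by (intro sum_mono2) auto
  also have "\<dots> = s" using m by (simp add: energy_moments_def)
  finally have "(\<Sum>k\<in>{..<D} - ?S. ?p k) \<le> s / t\<^sup>2" using t by (simp add: field_simps)
  moreover have "(\<Sum>k\<in>{..<D} - ?S. ?p k) = 1 - (\<Sum>k\<in>?S. ?p k)"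
    using m by (subst sum_diff[OF _ fin]) (auto simp: energy_moments_def)
  ultimately show ?thesis by simp
qed

text \<open>The energies of \<open>n\<close> copies are combinations of the single-copy energies with multiplicities at most \<open>n\<close>, hence polynomially many.\<close>

lemma spow_frame:
  assumes fr: "energy_frame A \<rho> W1 e1 c1" and mom: "energy_moments (sdim A) e1 c1 \<mu> s" and n: "1 \<le> n"
  shows "\<exists>W e c. energy_frame (spow A n) (tpow \<rho> n) W e c \<and> energy_moments (sdim (spow A n)) e c (n * \<mu>) (n * s) \<and>
    (\<Sum>k<sdim (spow A n). exp (- \<beta> * e k)) = (\<Sum>k<sdim A. exp (- \<beta> * e1 k)) ^ n \<and>
    card (e ` {..<sdim (spow A n)}) \<le> (n + 1) ^ sdim A"
proof -
  let ?d = "sdim A" and ?Z = "\<Sum>k<sdim A. exp (- \<beta> * e1 k)"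
  let ?F = "\<lambda>n. (\<lambda>f. \<Sum>i<?d. real (f i) * e1 i) ` ({..<?d} \<rightarrow>\<^sub>E {..n})"
  have "\<exists>W e c. energy_frame (spow A n) (tpow \<rho> n) W e c \<and> energy_moments (sdim (spow A n)) e c (n * \<mu>) (n * s) \<and>
    (\<Sum>k<sdim (spow A n). exp (- \<beta> * e k)) = ?Z ^ n \<and> e ` {..<sdim (spow A n)} \<subseteq> ?F n"
    using n
  proof (induction n rule: nat_induct_at_least)
    case base
    have "e1 i \<in> ?F 1" if i: "i < ?d" for i
    proof (rule image_eqI)
      show "e1 i = (\<Sum>j<?d. real ((\<lambda>j\<in>{..<?d}. if j = i then 1 else 0) j) * e1 j)"
        using i by (simp add: if_distrib[of real] if_distrib[of "\<lambda>x. x * _"] cong: if_cong)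
      show "(\<lambda>j\<in>{..<?d}. if j = i then 1 else 0) \<in> {..<?d} \<rightarrow>\<^sub>E {..1::nat}"
        unfolding restrict_PiE_iff by simp
    qed
    then show ?case using fr mom by (intro exI[of _ W1] exI[of _ e1] exI[of _ c1]) auto
  next
    case (Suc n)
    then obtain W e c where IH: "energy_frame (spow A n) (tpow \<rho> n) W e c"
      "energy_moments (sdim (spow A n)) e c (n * \<mu>) (n * s)"
      "(\<Sum>k<sdim (spow A n). exp (- \<beta> * e k)) = ?Z ^ n" "e ` {..<sdim (spow A n)} \<subseteq> ?F n" by blast
    let ?e = "\<lambda>i. e (i div ?d) + e1 (i mod ?d)" and ?c = "\<lambda>i. c (i div ?d) * c1 (i mod ?d)"
    have 1: "energy_frame (spow A (Suc n)) (tpow \<rho> (Suc n)) (kron W W1) ?e ?c"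
      unfolding spow_Suc[OF Suc.hyps] tpow_Suc[OF Suc.hyps] by (rule energy_frame_Comp[OF IH(1) fr])
    have 2: "energy_moments (sdim (spow A (Suc n))) ?e ?c (Suc n * \<mu>) (Suc n * s)"
      using energy_moments_product[OF IH(2) mom] unfolding spow_Suc[OF Suc.hyps] by (simp add: algebra_simps)
    have ex: "exp (- \<beta> * (x + y)) = exp (- \<beta> * x) * exp (- \<beta> * y)" for x y
      by (simp add: ring_distribs exp_add[symmetric])
    have "(\<Sum>k<sdim (spow A (Suc n)). exp (- \<beta> * ?e k)) =
        (\<Sum>i<sdim (spow A n). \<Sum>j<?d. exp (- \<beta> * e i) * exp (- \<beta> * e1 j))"
      unfolding spow_Suc[OF Suc.hyps] sdim_Comp ex by (rule sum_divmod)
    also have "\<dots> = ?Z ^ Suc n" by (simp only: sum_product[symmetric] IH(3) power_Suc2)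
    finally have 3: "(\<Sum>k<sdim (spow A (Suc n)). exp (- \<beta> * ?e k)) = ?Z ^ Suc n" .
    have "?e k \<in> ?F (Suc n)" if k: "k < sdim (spow A (Suc n))" for k
    proof -
      have dm: "k div ?d < sdim (spow A n)" "k mod ?d < ?d"
        using k div_mod_less[of k "sdim (spow A n)" ?d] unfolding spow_Suc[OF Suc.hyps] by auto
      obtain f where f: "f \<in> {..<?d} \<rightarrow>\<^sub>E {..n}" "e (k div ?d) = (\<Sum>i<?d. real (f i) * e1 i)"
        using IH(4) dm(1) by (metis (no_types, lifting) imageE image_subset_iff lessThan_iff)
      show ?thesis
      proof (rule image_eqI)
        \<comment> \<open>The new copy sits in level \<open>k mod ?d\<close>, whose multiplicity
          rises by one.\<close>
        let ?g = "\<lambda>j\<in>{..<?d}. f j + (if j = k mod ?d then 1 else 0)"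
        have "(\<Sum>j<?d. real (?g j) * e1 j) = (\<Sum>j<?d. real (f j) * e1 j + (if j = k mod ?d then e1 j else 0))"
          by (intro sum.cong) (auto simp: algebra_simps)
        then show "?e k = (\<Sum>j<?d. real (?g j) * e1 j)"
          using dm f by (simp add: sum.distrib)
        show "?g \<in> {..<?d} \<rightarrow>\<^sub>E {..Suc n}" using f(1) by (auto simp: restrict_PiE_iff PiE_def Pi_def intro: le_SucI)
      qed
    qed
    then show ?case using 1 2 3 by blast
  qed
  moreover have "card S \<le> (n + 1) ^ ?d" if "S \<subseteq> ?F n" for S
  proof -
    have "card S \<le> card (?F n)" using that by (intro card_mono) (auto intro!: finite_PiE)
    also have "\<dots> \<le> card ({..<?d} \<rightarrow>\<^sub>E {..n})" by (intro card_image_le finite_PiE) auto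
    also have "\<dots> = (n + 1) ^ ?d" by (simp add: card_PiE)
    finally show ?thesis .
  qed
  ultimately show ?thesis by meson
qed

subsection \<open>Lower bound on the cost\<close>

lemma cost_eps_ge:
  assumes "0 < L" "\<And>m. 1 < m \<Longrightarrow> conv_dist \<beta> (Atom (qubit_ham \<beta> m)) ket0 R B \<sigma> \<le> \<epsilon> \<Longrightarrow> L \<le> m"
  shows "ereal (log 2 L) \<le> cost_eps \<beta> R B \<sigma> \<epsilon>"
proof -
  let ?M = "Inf (ereal ` {m. 1 < m \<and> conv_dist \<beta> (Atom (qubit_ham \<beta> m)) ket0 R B \<sigma> \<le> \<epsilon>})"
  have M: "ereal L \<le> ?M" using assms by (intro Inf_greatest) auto
  show ?thesis
  proof (cases "?M = \<infinity>")
    case False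
    with M obtain r where r: "?M = ereal r" "L \<le> r" by (cases ?M) auto
    then have "log 2 L \<le> log 2 r" using assms by simp
    then show ?thesis using r by (simp add: cost_eps_def Let_def)
  qed (simp add: cost_eps_def Let_def)
qed

lemma cost_eps_le:
  assumes m: "1 < m" "conv_dist \<beta> (Atom (qubit_ham \<beta> m)) ket0 R B \<sigma> \<le> \<epsilon>"
  shows "cost_eps \<beta> R B \<sigma> \<epsilon> \<le> ereal (log 2 m)"
proof -
  let ?M = "Inf (ereal ` {m. 1 < m \<and> conv_dist \<beta> (Atom (qubit_ham \<beta> m)) ket0 R B \<sigma> \<le> \<epsilon>})"
  \<comment> \<open>Admissible m exceed 1, so the infimum is a real number at least 1, where the
    logarithm is monotone.\<close>
  have "ereal 1 \<le> ?M" by (intro Inf_greatest) auto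
  moreover have "?M \<le> ereal m" using m by (intro Inf_lower) auto
  ultimately obtain r where r: "?M = ereal r" "1 \<le> r" "r \<le> m" by (cases ?M) auto
  then have "log 2 r \<le> log 2 m" by simp
  then show ?thesis using r by (simp add: cost_eps_def Let_def)
qed

lemma density_exists: assumes "0 < n" shows "\<exists>\<omega>. density n \<omega>"
proof -
  let ?v = "vec n (\<lambda>i. if i = 0 then 1 else 0) :: complex vec"
  have "tr (ketbra ?v) = (\<Sum>i<n. if i = 0 then 1 else 0)" unfolding tr_def by (intro sum.cong) auto
  then have "tr (ketbra ?v) = 1" using assms by simp
  then have "density n (ketbra ?v)" by (simp add: density_def psd_ketbra)
  then show ?thesis by blast
qed

text \<open>The test vector is the part of the pure state supported on \<open>S\<close>, left
  unnormalised. Its quadratic form is Q^2 on \<rho>, and on the output it is smaller by at most the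
  trace norm of the difference, which is below 2 \<epsilon>. Gibbs domination bounds the value on
  the output by the dominating factor times the largest Gibbs weight possible on
  \<open>S\<close>.\<close>

lemma conversion_cost_ge:
  assumes b: "0 < \<beta>" and m: "1 < m" and B: "valid B" and R: "valid R"
    and fr: "energy_frame B \<rho> W e c" and c1: "(\<Sum>k<sdim B. (cmod (c k))\<^sup>2) \<le> 1"
    and d: "conv_dist \<beta> (Atom (qubit_ham \<beta> m)) ket0 R B \<rho> < \<epsilon>"
    and S: "S \<subseteq> {..<sdim B}" "\<And>k. k \<in> S \<Longrightarrow> l \<le> e k"
  shows "(\<Sum>k\<in>S. (cmod (c k))\<^sup>2)\<^sup>2 - 2 * \<epsilon> \<le>
    m * (sdim R * exp (\<beta> * opnorm (ham R))) * (exp (- \<beta> * l) / (\<Sum>k<sdim B. exp (- \<beta> * e k)))"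
proof -
  let ?X = "Atom (qubit_ham \<beta> m)" and ?D = "sdim B"
  let ?C = "m * (sdim R * exp (\<beta> * opnorm (ham R)))" and ?Z = "\<Sum>k<sdim B. exp (- \<beta> * e k)"
  let ?Q = "\<Sum>k\<in>S. (cmod (c k))\<^sup>2"
  have vXR: "valid (Comp ?X R)" using valid_qubit(1)[OF m b] R by simp
  obtain \<omega>0 E0 where "density (sdim R) \<omega>0" "E0 \<in> CTO \<beta> (Comp ?X R) B"
    using density_exists[OF sdim_pos[OF R]] CTO_nonempty[OF vXR B] by blast
  then have ne: "{1/2 * tnorm (\<rho> - E (kron ket0 \<omega>)) | \<omega> E. density (sdim R) \<omega> \<and> E \<in> CTO \<beta> (Comp ?X R) B} \<noteq> {}"
    by blast
  obtain \<omega> E where w: "density (sdim R) \<omega>" and E: "E \<in> CTO \<beta> (Comp ?X R) B"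
    and t: "1/2 * tnorm (\<rho> - E (kron ket0 \<omega>)) < \<epsilon>"
    using cInf_lessD[OF ne d[unfolded conv_dist_def]] by blast
  let ?\<tau> = "E (kron ket0 \<omega>)"
  note p = conversion_bound[OF b m B R w E]
  from fr have W: "unitary ?D W" "ham B = W * rdiag ?D e * adj W" "\<rho> = W * ketbra (vec ?D c) * adj W"
    by (auto simp: energy_frame_def)
  note cW = unitaryD[OF W(1)]
  define x where "x = vec ?D (\<lambda>k. if k \<in> S then c k else 0)"
  have x: "x \<in> carrier_vec ?D" by (simp add: x_def)
  let ?f = "W *\<^sub>v x"
  have f: "?f \<in> carrier_vec ?D" using cW x by simp
  have ifS: "(\<Sum>k<?D. if k \<in> S then h k else 0) = sum h S" for h :: "nat \<Rightarrow> 'a :: comm_monoid_add"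
    using sum.inter_restrict[of "{..<?D}" h S] S(1) by (simp add: inf.absorb2)
  have xQ: "(\<Sum>i<?D. (cmod (x $ i))\<^sup>2) = ?Q"
  proof -
    have "(\<Sum>i<?D. (cmod (x $ i))\<^sup>2) = (\<Sum>i<?D. if i \<in> S then (cmod (c i))\<^sup>2 else 0)"
      by (intro sum.cong) (auto simp: x_def)
    then show ?thesis by (simp add: ifS)
  qed
  have Q1: "?Q \<le> 1" "0 \<le> ?Q" using c1 sum_mono2[OF _ S(1), of "\<lambda>k. (cmod (c k))\<^sup>2"] by (auto intro: sum_nonneg)
  have f1: "(\<Sum>i<?D. (cmod (?f $ i))\<^sup>2) \<le> 1" unfolding vec_norm_unitary[OF W(1) x] xQ by (rule Q1)
  have cr: "\<rho> \<in> carrier_mat ?D ?D" "hermitian ?D \<rho>"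
    using psd_conj[OF psd_ketbra[of "vec ?D c" ?D] cW(1)] W(3) by (auto simp: psd_def hermitian_def)
  have ct: "?\<tau> \<in> carrier_mat ?D ?D" "hermitian ?D ?\<tau>" using p(1) by (auto simp: psd_def hermitian_def)
  have "qform \<rho> ?f = complex_of_real ((cmod (\<Sum>i<?D. cnj (x $ i) * vec ?D c $ i))\<^sup>2)"
    unfolding W(3) using qform_unitary_conj[OF W(1) _ x, of "ketbra (vec ?D c)"] by (simp add: ketbra_carrier qform_ketbra[OF _ x])
  also have "(\<Sum>i<?D. cnj (x $ i) * vec ?D c $ i) = (\<Sum>i<?D. if i \<in> S then complex_of_real ((cmod (c i))\<^sup>2) else 0)"
    by (intro sum.cong) (auto simp: x_def complex_norm_square mult.commute simp flip: of_real_power)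
  also have "\<dots> = complex_of_real ?Q" by (simp add: ifS)
  finally have q1: "Re (qform \<rho> ?f) = ?Q\<^sup>2" by (simp only: norm_of_real Re_complex_of_real power2_abs)
  have q2: "Re (qform (gibbs \<beta> (ham B)) ?f) \<le> exp (- \<beta> * l) / ?Z"
  proof -
    have "qform (gibbs \<beta> (ham B)) ?f = qform (rdiag ?D (\<lambda>i. exp (- \<beta> * e i) / ?Z)) x"
      unfolding gibbs_spectral[OF W(1,2)] by (rule qform_unitary_conj[OF W(1) _ x]) simp
    also have "\<dots> = (\<Sum>i<?D. \<Sum>j<?D. if j = i then complex_of_real (exp (- \<beta> * e i) / ?Z * (cmod (x $ i))\<^sup>2) else 0)"
      unfolding qform_def using x by (intro sum.cong) (auto simp: complex_norm_square mult_ac simp flip: of_real_power)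
    also have "\<dots> = complex_of_real (\<Sum>i<?D. exp (- \<beta> * e i) / ?Z * (cmod (x $ i))\<^sup>2)" by simp
    finally have "Re (qform (gibbs \<beta> (ham B)) ?f) = (\<Sum>i<?D. exp (- \<beta> * e i) / ?Z * (cmod (x $ i))\<^sup>2)" by simp
    also have "\<dots> \<le> (\<Sum>i<?D. exp (- \<beta> * l) / ?Z * (cmod (x $ i))\<^sup>2)"
    proof (intro sum_mono)
      fix i assume "i \<in> {..<?D}"
      have "?Z \<ge> 0" by (intro sum_nonneg) auto
      then show "exp (- \<beta> * e i) / ?Z * (cmod (x $ i))\<^sup>2 \<le> exp (- \<beta> * l) / ?Z * (cmod (x $ i))\<^sup>2"
        using S(2)[of i] b \<open>i \<in> {..<?D}\<close> by (cases "i \<in> S") (auto intro!: mult_right_mono divide_right_mono simp: x_def)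
    qed
    also have "\<dots> = exp (- \<beta> * l) / ?Z * ?Q" unfolding sum_distrib_left[symmetric] xQ ..
    also have "\<dots> \<le> exp (- \<beta> * l) / ?Z * 1" using Q1 by (intro mult_left_mono divide_nonneg_nonneg sum_nonneg) auto
    finally show ?thesis by simp
  qed
  have h: "hermitian ?D (\<rho> - ?\<tau>)" by (rule hermitian_minus[OF cr(2) ct(2)])
  have "Re (qform (\<rho> - ?\<tau>) ?f) \<le> tnorm (\<rho> - ?\<tau>)" using qform_le_tnorm[OF h f f1] by simp
  then have a: "?Q\<^sup>2 - Re (qform ?\<tau> ?f) \<le> 2 * \<epsilon>" using t q1 by (simp add: qform_minus[OF f cr(1) ct(1)])
  note g = gibbs_carrier[OF B, of \<beta>]
  have "0 \<le> Re (qform (complex_of_real ?C \<cdot>\<^sub>m gibbs \<beta> (ham B) - ?\<tau>) ?f)" using p(2) f by (simp add: psd_def)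
  also have "\<dots> = ?C * Re (qform (gibbs \<beta> (ham B)) ?f) - Re (qform ?\<tau> ?f)"
    using g ct f by (simp add: qform_minus[OF f smult_carrier_mat[OF g] ct(1)] qform_smult[OF f g] flip: of_real_mult)
  finally have "Re (qform ?\<tau> ?f) \<le> ?C * Re (qform (gibbs \<beta> (ham B)) ?f)" by simp
  also have "\<dots> \<le> ?C * (exp (- \<beta> * l) / ?Z)" using q2 m by (intro mult_left_mono) auto
  finally show ?thesis using a by simp
qed

lemma ln_over_n: "(\<lambda>n. ln (real n) / real n) \<longlonglongrightarrow> 0"
  by (rule filterlim_compose[OF ln_x_over_x_tendsto_0 filterlim_real_sequentially])

lemma ereal_le_of_all_less:
  assumes "\<And>\<delta>::real. 0 < \<delta> \<Longrightarrow> ereal (a - \<delta>) \<le> y" shows "ereal a \<le> y"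
proof (cases y)
  case (real r)
  have "a \<le> r"
  proof (rule field_le_epsilon)
    fix \<delta> :: real assume "0 < \<delta>"
    from assms[OF this] show "a \<le> r + \<delta>" by (simp add: real)
  qed
  then show ?thesis by (simp add: real)
qed (use assms[of 1] in auto)

text \<open>The test mass Q is made at least 9/10, and (9/10)^2 - 2 * (1/4) still exceeds 1/4. This
  constant disappears after taking the logarithm and dividing by n, so the bound does not degrade as
  \<epsilon> approaches 1/4.\<close>

theorem cost_rate_ge:
  assumes b: "0 < \<beta>" and A: "valid A" and fr: "energy_frame A \<rho> W1 e1 c1"
    and mom: "energy_moments (sdim A) e1 c1 \<mu> s" and eps: "\<epsilon> < 1/4"
  shows "ereal (log 2 (\<Sum>k<sdim A. exp (- \<beta> * e1 k)) + \<beta> * \<mu> / ln 2) \<le> cost_rate \<beta> A \<rho> \<epsilon>"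
  unfolding cost_rate_def
proof (rule INF_greatest)
  fix Rs assume "Rs \<in> {Rs. slar Rs}"
  then obtain C k c \<alpha> where R: "\<And>n. valid (Rs n)" and dimR: "\<And>n. 1 \<le> n \<Longrightarrow> real (sdim (Rs n)) \<le> C * real n ^ k"
    and c: "0 < c" "\<alpha> < 1" and opR: "\<And>n. 1 \<le> n \<Longrightarrow> opnorm (ham (Rs n)) \<le> c * real n powr \<alpha>"
    unfolding slar_def by auto
  let ?Z = "\<Sum>k<sdim A. exp (- \<beta> * e1 k)"
  let ?D = "log 2 ?Z + \<beta> * \<mu> / ln 2"
  have Z: "0 < ?Z" using sdim_pos[OF A] by (intro sum_pos) auto
  have C: "0 < C" using dimR[of 1] sdim_pos[OF R, of 1] by simp
  \<comment> \<open>The sublinear terms in the lower bound on log m: 2 from the constant 1/4, the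
    others from the dimension and the energy norm of R.\<close>
  define err where "err n = 2 + log 2 C + k * log 2 n + \<beta> * c * n powr \<alpha> / ln 2" for n :: nat
  have errlim: "(\<lambda>n. err n / n) \<longlonglongrightarrow> 0"
  proof -
    have p: "(\<lambda>n. real n powr (\<alpha> - 1)) \<longlonglongrightarrow> 0"
      using c filterlim_compose[OF tendsto_neg_powr[of "\<alpha> - 1" "\<lambda>x. x" at_top] filterlim_real_sequentially]
      by (simp add: filterlim_ident)
    have i: "(\<lambda>n. 1 / real n) \<longlonglongrightarrow> 0" by (rule lim_1_over_n)
    have "(\<lambda>n. (2 + log 2 C) * (1 / real n) + (k / ln 2) * (ln (real n) / real n) + (\<beta> * c / ln 2) * real n powr (\<alpha> - 1))
        \<longlonglongrightarrow> (2 + log 2 C) * 0 + (k / ln 2) * 0 + (\<beta> * c / ln 2) * 0"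
      by (intro tendsto_intros i ln_over_n p)
    moreover have "\<forall>\<^sub>F n in sequentially. (2 + log 2 C) * (1 / real n) + (k / ln 2) * (ln (real n) / real n) + (\<beta> * c / ln 2) * real n powr (\<alpha> - 1)
        = err n / n"
      using eventually_ge_at_top[of 1]
    proof eventually_elim
      case (elim n)
      then have "real n powr (\<alpha> - 1) = n powr \<alpha> / n" by (simp add: powr_diff)
      then show ?case by (simp add: err_def log_def add_divide_distrib)
    qed
    ultimately show ?thesis by (simp add: tendsto_cong)
  qed
  show "ereal ?D \<le> liminf (\<lambda>n. ereal (1 / real n) * cost_eps \<beta> (Rs n) (spow A n) (tpow \<rho> n) \<epsilon>)"
  proof (rule ereal_le_of_all_less)
    fix \<delta> :: real assume \<delta>: "0 < \<delta>"
    \<comment> \<open>Half of \<delta> pays for lowering the energy threshold to n (\<mu> - d), the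
      other half for \<open>err n / n\<close>.\<close>
    define d where "d = \<delta> * ln 2 / (2 * \<beta>)"
    have d: "0 < d" "\<beta> * d / ln 2 = \<delta> / 2" using \<delta> b by (auto simp: d_def)
    have "(\<lambda>n. s / d\<^sup>2 * (1 / real n)) \<longlonglongrightarrow> s / d\<^sup>2 * 0" by (intro tendsto_intros lim_1_over_n)
    then have ev1: "\<forall>\<^sub>F n in sequentially. s / d\<^sup>2 * (1 / real n) < 1/10" by (rule order_tendstoD) simp
    have ev2: "\<forall>\<^sub>F n in sequentially. err n / n < \<delta> / 2" using errlim \<delta> by (intro order_tendstoD) auto
    show "ereal (?D - \<delta>) \<le> liminf (\<lambda>n. ereal (1 / real n) * cost_eps \<beta> (Rs n) (spow A n) (tpow \<rho> n) \<epsilon>)"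
    proof (rule Liminf_bounded)
      show "\<forall>\<^sub>F n in sequentially. ereal (?D - \<delta>) \<le> ereal (1 / real n) * cost_eps \<beta> (Rs n) (spow A n) (tpow \<rho> n) \<epsilon>"
        using ev1 ev2 eventually_ge_at_top[of 1]
      proof eventually_elim
        case (elim n)
        let ?R = "Rs n" and ?B = "spow A n"
        obtain W e a where fB: "energy_frame ?B (tpow \<rho> n) W e a" and mB: "energy_moments (sdim ?B) e a (n * \<mu>) (n * s)"
          and ZB: "(\<Sum>k<sdim ?B. exp (- \<beta> * e k)) = ?Z ^ n"
          using spow_frame[OF fr mom elim(3)] by blast
        let ?S = "{k. k < sdim ?B \<and> \<bar>e k - n * \<mu>\<bar> \<le> n * d}" and ?l = "n * (\<mu> - d)"
        let ?Q = "\<Sum>k\<in>?S. (cmod (a k))\<^sup>2" and ?K = "sdim ?R * exp (\<beta> * opnorm (ham ?R))"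
        have "1 - n * s / (n * d)\<^sup>2 \<le> ?Q" using chebyshev[OF mB, of "n * d"] d elim(3) by simp
        moreover have "n * s / (n * d)\<^sup>2 = s / d\<^sup>2 * (1 / n)" using elim(3) by (simp add: power2_eq_square)
        ultimately have "?Q \<ge> 9/10" using elim(1) by linarith
        then have Q2: "?Q\<^sup>2 \<ge> (9/10)\<^sup>2" by (intro power_mono) auto
        have K: "0 < ?K" using sdim_pos[OF R, of n] by simp
        \<comment> \<open>The inequality of \<open>conversion_cost_ge\<close> solved for m, with 1/4
          as its left-hand side.\<close>
        define L where "L = 1/4 * ?Z ^ n * exp (\<beta> * ?l) / ?K"
        have L: "0 < L" using Z K by (simp add: L_def)
        have Lm: "L \<le> m" if m: "1 < m" "conv_dist \<beta> (Atom (qubit_ham \<beta> m)) ket0 ?R ?B (tpow \<rho> n) \<le> \<epsilon>" for m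
        proof -
          have "?Q\<^sup>2 - 2 * (1/4) \<le> m * ?K * (exp (- \<beta> * ?l) / (\<Sum>k<sdim ?B. exp (- \<beta> * e k)))"
          proof (rule conversion_cost_ge[OF b m(1) valid_spow[OF A elim(3)] R fB])
            show "conv_dist \<beta> (Atom (qubit_ham \<beta> m)) ket0 ?R ?B (tpow \<rho> n) < 1/4" using m(2) eps by simp
            show "(\<Sum>k<sdim ?B. (cmod (a k))\<^sup>2) \<le> 1" using mB by (simp add: energy_moments_def)
            show "?l \<le> e k" if "k \<in> ?S" for k using that by (auto simp: abs_le_iff algebra_simps)
          qed auto
          then have "1/4 \<le> m * ?K * (exp (- \<beta> * ?l) / ?Z ^ n)" using Q2 unfolding ZB by (simp add: power2_eq_square)
          then have "1/4 * (?Z ^ n * exp (\<beta> * ?l)) \<le> m * ?K * (exp (- \<beta> * ?l) / ?Z ^ n) * (?Z ^ n * exp (\<beta> * ?l))"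
            using Z by (intro mult_right_mono) auto
          also have "\<dots> = m * ?K * (exp (- \<beta> * ?l) * exp (\<beta> * ?l))" using Z by simp
          also have "exp (- \<beta> * ?l) * exp (\<beta> * ?l) = 1" by (simp add: exp_add[symmetric])
          finally show ?thesis using K by (simp add: L_def pos_divide_le_eq mult.assoc)
        qed
        have "ereal (1 / real n) * ereal (log 2 L) \<le> ereal (1 / real n) * cost_eps \<beta> ?R ?B (tpow \<rho> n) \<epsilon>"
          by (intro ereal_mult_left_mono cost_eps_ge L Lm) auto
        moreover have "?D - \<delta> \<le> 1 / real n * log 2 L"
        proof -
          have "ln L = ln (1/4) + n * ln ?Z + \<beta> * ?l - (ln (sdim ?R) + \<beta> * opnorm (ham ?R))"
            using Z sdim_pos[OF R, of n] by (simp add: L_def ln_mult ln_div ln_realpow)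
          moreover have "ln (1/4 :: real) = - 2 * ln 2" using ln_realpow[of 2 2] by (simp add: ln_div)
          ultimately have "log 2 L = - 2 + n * log 2 ?Z + \<beta> * ?l / ln 2 - log 2 (sdim ?R) - \<beta> * opnorm (ham ?R) / ln 2"
            by (simp add: log_def add_divide_distrib diff_divide_distrib)
          moreover have "log 2 (sdim ?R) \<le> log 2 C + k * log 2 n"
          proof -
            have "log 2 (sdim ?R) \<le> log 2 (C * n ^ k)" using dimR[OF elim(3)] sdim_pos[OF R, of n] by simp
            then show ?thesis using C elim(3) by (simp add: log_mult log_nat_power)
          qed
          moreover have "\<beta> * opnorm (ham ?R) / ln 2 \<le> \<beta> * c * n powr \<alpha> / ln 2"
            using opR[OF elim(3)] b by (simp add: divide_right_mono)
          ultimately have "log 2 L \<ge> n * log 2 ?Z + \<beta> * ?l / ln 2 - err n" unfolding err_def by linarith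
          moreover have "\<beta> * ?l / ln 2 = n * (\<beta> * \<mu> / ln 2 - \<delta> / 2)" unfolding d(2)[symmetric] by (simp add: field_simps)
          ultimately have "log 2 L \<ge> n * (?D - \<delta> / 2) - err n" by (simp add: algebra_simps)
          then have "1 / n * log 2 L \<ge> 1 / n * (n * (?D - \<delta> / 2) - err n)" by (intro mult_left_mono) auto
          also have "1 / n * (n * (?D - \<delta> / 2) - err n) = ?D - \<delta> / 2 - err n / n" using elim(3) by (simp add: field_simps)
          finally show ?thesis using elim(2) by linarith
        qed
        then have "ereal (?D - \<delta>) \<le> ereal (1 / real n) * ereal (log 2 L)"
          unfolding times_ereal.simps(1) ereal_less_eq .
        ultimately show ?case by (rule order_trans[rotated])
      qed
    qed
  qed
qed

subsection \<open>Energy-conserving dilation of a partial isometry\<close>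

lemma mult_minus_dims:
  fixes A B C :: "complex mat"
  assumes "dim_col A = dim_row B" "dim_row C = dim_row B" "dim_col C = dim_col B"
  shows "A * (B - C) = A * B - A * C"
  using assms by (intro mult_minus_distrib_mat[of _ "dim_row A" "dim_col A" _ "dim_col B"]) auto

lemma minus_mult_dims:
  fixes A B C :: "complex mat"
  assumes "dim_col A = dim_row C" "dim_row B = dim_row A" "dim_col B = dim_col A"
  shows "(A - B) * C = A * C - B * C"
  using assms by (intro minus_mult_distrib_mat[of _ "dim_row A" "dim_col A" _ _ "dim_col C"]) auto

lemma minus_zero_dims:
  fixes A :: "complex mat"
  assumes "dim_row A = n" "dim_col A = m"
  shows "A - 0\<^sub>m n m = A"
  by (rule eq_matI) (use assms in auto)

lemma adj_four_block:
  assumes "A \<in> carrier_mat a a" "B \<in> carrier_mat a b" "C \<in> carrier_mat b a" "D \<in> carrier_mat b b"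
  shows "adj (four_block_mat A B C D) = four_block_mat (adj A) (adj C) (adj B) (adj D)"
  by (rule eq_matI) (use assms in auto)

text \<open>On a qubit tensor an n-dimensional space this exchanges the initial space of K in block
  0 with the final space of K in block 1 and fixes the rest. For a partial isometry K it is
  therefore a self-adjoint unitary. The qubit will be X, which enters in block 0.\<close>

definition dilation :: "nat \<Rightarrow> complex mat \<Rightarrow> complex mat" where
  "dilation n K = four_block_mat (1\<^sub>m n - adj K * K) (adj K) K (1\<^sub>m n - K * adj K)"

context
  fixes n :: nat and K :: "complex mat"
  assumes K: "K \<in> carrier_mat n n" and pK: "K * (adj K * K) = K"
begin

private lemma dK: "dim_row K = n" "dim_col K = n" "adj K \<in> carrier_mat n n"
  using K by auto

private lemma pK': "adj K * (K * adj K) = adj K"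
  using arg_cong[OF pK, of adj] dK by (simp add: mat_assoc)

private lemma block_carriers: "1\<^sub>m n - adj K * K \<in> carrier_mat n n" "1\<^sub>m n - K * adj K \<in> carrier_mat n n"
  using dK by (auto intro!: carrier_matI)

private lemma block_absorb:
  "(1\<^sub>m n - adj K * K) * adj K = 0\<^sub>m n n" "adj K * (1\<^sub>m n - K * adj K) = 0\<^sub>m n n"
  "K * (1\<^sub>m n - adj K * K) = 0\<^sub>m n n" "(1\<^sub>m n - K * adj K) * K = 0\<^sub>m n n"
  using dK K by (auto simp: mult_minus_dims minus_mult_dims mat_assoc pK pK' intro!: eq_matI)

private lemma block_sq:
  "(1\<^sub>m n - adj K * K) * (1\<^sub>m n - adj K * K) = 1\<^sub>m n - adj K * K"
  "(1\<^sub>m n - K * adj K) * (1\<^sub>m n - K * adj K) = 1\<^sub>m n - K * adj K"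
proof -
  have 1: "(1\<^sub>m n - adj K * K) * (1\<^sub>m n - adj K * K) = (1\<^sub>m n - adj K * K) * 1\<^sub>m n - (1\<^sub>m n - adj K * K) * (adj K * K)"
    using dK by (intro mult_minus_dims) auto
  have "(1\<^sub>m n - adj K * K) * (adj K * K) = 0\<^sub>m n n"
    using dK K block_absorb(1) mat_assoc[of "1\<^sub>m n - adj K * K" "adj K" K] by simp
  then show "(1\<^sub>m n - adj K * K) * (1\<^sub>m n - adj K * K) = 1\<^sub>m n - adj K * K"
    unfolding 1 right_mult_one_mat[OF block_carriers(1)] using dK by (simp add: minus_zero_dims)
  have 2: "(1\<^sub>m n - K * adj K) * (1\<^sub>m n - K * adj K) = (1\<^sub>m n - K * adj K) * 1\<^sub>m n - (1\<^sub>m n - K * adj K) * (K * adj K)"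
    using dK by (intro mult_minus_dims) auto
  have "(1\<^sub>m n - K * adj K) * (K * adj K) = 0\<^sub>m n n"
    using dK K block_absorb(4) mat_assoc[of "1\<^sub>m n - K * adj K" K "adj K"] by simp
  then show "(1\<^sub>m n - K * adj K) * (1\<^sub>m n - K * adj K) = 1\<^sub>m n - K * adj K"
    unfolding 2 right_mult_one_mat[OF block_carriers(2)] using dK by (simp add: minus_zero_dims)
qed

lemma dilation_adj: "adj (dilation n K) = dilation n K"
  unfolding dilation_def adj_four_block[OF block_carriers(1) dK(3) K block_carriers(2)]
  using dK by (simp add: adj_minus)

lemma dilation_unitary: "unitary (n + n) (dilation n K)"
proof -
  have "dilation n K * dilation n K = 1\<^sub>m (n + n)"
    unfolding dilation_def
      mult_four_block_mat[OF block_carriers(1) dK(3) K block_carriers(2) block_carriers(1) dK(3) K block_carriers(2)]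
      block_absorb block_sq four_block_one_mat[symmetric]
    using dK by (intro cong_four_block_mat) (auto intro!: eq_matI)
  moreover have "dilation n K \<in> carrier_mat (n + n) (n + n)"
    unfolding dilation_def by (rule four_block_carrier_mat[OF block_carriers])
  ultimately show ?thesis by (simp add: unitary_def dilation_adj)
qed

text \<open>All four blocks reduce to the single relation K H0 = H1 K and its adjoint. For diagonal
  H0 and H1, energy conservation thus has to be checked only where K has a nonzero entry.\<close>

lemma dilation_commutes:
  assumes H: "H0 \<in> carrier_mat n n" "H1 \<in> carrier_mat n n" "adj H0 = H0" "adj H1 = H1"
    and com: "K * H0 = H1 * K"
  shows "dilation n K * four_block_mat H0 (0\<^sub>m n n) (0\<^sub>m n n) H1 = four_block_mat H0 (0\<^sub>m n n) (0\<^sub>m n n) H1 * dilation n K"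
proof -
  have dH: "dim_row H0 = n" "dim_col H0 = n" "dim_row H1 = n" "dim_col H1 = n" using H by auto
  have com': "H0 * adj K = adj K * H1" using arg_cong[OF com, of adj] dK dH H by simp
  have a: "adj K * K * H0 = H0 * (adj K * K)"
    using dK dH com com' mat_assoc[of H0 "adj K" K] mat_assoc[of "adj K" H1 K] by (simp add: mat_assoc)
  have b: "K * adj K * H1 = H1 * (K * adj K)"
    using dK dH com com' mat_assoc[of H1 K "adj K"] mat_assoc[of K H0 "adj K"] by (simp add: mat_assoc)
  have z: "0\<^sub>m n n \<in> carrier_mat n n" by simp
  have 1: "(1\<^sub>m n - adj K * K) * H0 = H0 * (1\<^sub>m n - adj K * K)" "(1\<^sub>m n - K * adj K) * H1 = H1 * (1\<^sub>m n - K * adj K)"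
    using dK dH H a b by (simp_all add: mult_minus_dims minus_mult_dims)
  show ?thesis
    unfolding dilation_def
      mult_four_block_mat[OF block_carriers(1) dK(3) K block_carriers(2) H(1) z z H(2)]
      mult_four_block_mat[OF H(1) z z H(2) block_carriers(1) dK(3) K block_carriers(2)] 1
    using dK dH H K com com' block_carriers mult_carrier_mat[OF dK(3) H(2)] by simp
qed

text \<open>Once the qubit is traced out only the diagonal blocks survive: the failure branch,
  compressed by 1 - adj K K, and the success branch K S adj K.\<close>

lemma dilation_conj_corner:
  assumes S: "S \<in> carrier_mat n n"
  shows "dilation n K * four_block_mat S (0\<^sub>m n n) (0\<^sub>m n n) (0\<^sub>m n n) * dilation n K =
    four_block_mat ((1\<^sub>m n - adj K * K) * S * (1\<^sub>m n - adj K * K)) ((1\<^sub>m n - adj K * K) * S * adj K)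
      (K * S * (1\<^sub>m n - adj K * K)) (K * S * adj K)"
proof -
  have z: "0\<^sub>m n n \<in> carrier_mat n n" by simp
  have "dilation n K * four_block_mat S (0\<^sub>m n n) (0\<^sub>m n n) (0\<^sub>m n n) =
    four_block_mat ((1\<^sub>m n - adj K * K) * S) (0\<^sub>m n n) (K * S) (0\<^sub>m n n)"
    unfolding dilation_def mult_four_block_mat[OF block_carriers(1) dK(3) K block_carriers(2) S z z z]
    using dK S K block_carriers by simp
  also have "\<dots> * dilation n K = four_block_mat ((1\<^sub>m n - adj K * K) * S * (1\<^sub>m n - adj K * K)) ((1\<^sub>m n - adj K * K) * S * adj K)
      (K * S * (1\<^sub>m n - adj K * K)) (K * S * adj K)"
    unfolding dilation_def
    by (subst mult_four_block_mat[of _ n n _ n _ n _ _ n _ n])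
      (use dK S K block_carriers in \<open>auto intro!: mult_carrier_mat[of _ n n] cong_four_block_mat right_add_zero_mat\<close>)
  finally show ?thesis .
qed

end

section \<open>Partial traces of block and conjugated matrices\<close>

lemma ptr1_four_block:
  assumes "A \<in> carrier_mat n n" "D \<in> carrier_mat n n"
  shows "ptr1 2 n (four_block_mat A B C D) = A + D"
  by (rule eq_matI) (use assms in \<open>auto simp: ptr1_def numeral_2_eq_2\<close>)

lemma ptr1_ptr1: "ptr1 b c (ptr1 a (b * c) M) = ptr1 (a * b) c M"
proof (rule eq_matI)
  fix i j assume "i < dim_row (ptr1 (a * b) c M)" "j < dim_col (ptr1 (a * b) c M)"
  then have ij: "i < c" "j < c" by auto
  have "ptr1 b c (ptr1 a (b * c) M) $$ (i,j) = (\<Sum>y<b. \<Sum>x<a. M $$ (x * (b * c) + (y * c + i), x * (b * c) + (y * c + j)))"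
    using ij by (simp add: ptr1_def mult_add_less)
  also have "\<dots> = (\<Sum>x<a. \<Sum>y<b. M $$ ((x * b + y) * c + i, (x * b + y) * c + j))"
    by (subst sum.swap) (simp add: algebra_simps)
  also have "\<dots> = (\<Sum>k<a * b. M $$ (k * c + i, k * c + j))" by (rule sum_mult_shift[symmetric])
  finally show "ptr1 b c (ptr1 a (b * c) M) $$ (i,j) = ptr1 (a * b) c M $$ (i,j)" using ij by (simp add: ptr1_def)
qed auto

lemma tr_ptr1:
  assumes "M \<in> carrier_mat (a * b) (a * b)"
  shows "tr (ptr1 a b M) = tr M"
  using assms by (simp add: tr_def ptr1_def sum_mult_shift sum.swap[of _ "{..<a}"])

lemma ptr1_add:
  assumes "M \<in> carrier_mat (a * b) (a * b)" "N \<in> carrier_mat (a * b) (a * b)"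
  shows "ptr1 a b (M + N) = ptr1 a b M + ptr1 a b N"
  by (rule eq_matI) (use assms in \<open>auto simp: ptr1_def mult_add_less sum.distrib\<close>)

text \<open>The sum over the traced index touches only the factor on which \<open>V\<close> does not
  act. This lets the protocol be evaluated in the energy basis of B, with the rotation back applied
  to the output alone.\<close>

lemma ptr1_conj:
  assumes V: "V \<in> carrier_mat b b" and M: "M \<in> carrier_mat (a * b) (a * b)"
  shows "ptr1 a b (kron (1\<^sub>m a) V * M * adj (kron (1\<^sub>m a) V)) = V * ptr1 a b M * adj V"
proof (rule eq_matI)
  let ?K = "kron (1\<^sub>m a) V"
  have K: "?K \<in> carrier_mat (a * b) (a * b)" using V by auto
  fix i j assume "i < dim_row (V * ptr1 a b M * adj V)" "j < dim_col (V * ptr1 a b M * adj V)"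
  then have ij: "i < b" "j < b" using V by auto
  have KM: "(?K * M) $$ (k * b + i, q) = (\<Sum>i'<b. V $$ (i,i') * M $$ (k * b + i', q))"
    if "k < a" "q < a * b" "i < b" for k q i
  proof -
    have "(?K * M) $$ (k * b + i, q) = (\<Sum>p<a * b. ?K $$ (k * b + i, p) * M $$ (p, q))"
      using that by (intro index_mult_sum[OF K M]) (auto simp: mult_add_less)
    also have "\<dots> = (\<Sum>k'<a. \<Sum>i'<b. if k' = k then V $$ (i,i') * M $$ (k * b + i', q) else 0)"
      unfolding sum_mult_shift using that V by (intro sum.cong refl) (auto simp: index_kron mult_add_less)
    also have "\<dots> = (\<Sum>k'<a. if k' = k then \<Sum>i'<b. V $$ (i,i') * M $$ (k * b + i', q) else 0)"
      by (intro sum.cong refl) simp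
    finally show ?thesis using that by simp
  qed
  have "(?K * M * adj ?K) $$ (k * b + i, k * b + j) = (\<Sum>j'<b. \<Sum>i'<b. V $$ (i,i') * M $$ (k * b + i', k * b + j') * cnj (V $$ (j,j')))"
    if k: "k < a" for k
  proof -
    have "(?K * M * adj ?K) $$ (k * b + i, k * b + j) = (\<Sum>p<a * b. (?K * M) $$ (k * b + i, p) * adj ?K $$ (p, k * b + j))"
      using k ij K M by (intro index_mult_sum[of _ "a * b" "a * b"]) (auto simp: mult_add_less simp del: adj_kron)
    also have "\<dots> = (\<Sum>k'<a. \<Sum>j'<b. if k' = k then (\<Sum>i'<b. V $$ (i,i') * M $$ (k * b + i', k * b + j')) * cnj (V $$ (j,j')) else 0)"
      unfolding sum_mult_shift using k ij V
      by (intro sum.cong refl) (auto simp: index_kron mult_add_less KM simp del: adj_kron index_mult_mat(1))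
    also have "\<dots> = (\<Sum>k'<a. if k' = k then \<Sum>j'<b. (\<Sum>i'<b. V $$ (i,i') * M $$ (k * b + i', k * b + j')) * cnj (V $$ (j,j')) else 0)"
      by (intro sum.cong refl) simp
    finally show ?thesis using k by (simp add: sum_distrib_right)
  qed
  then have "ptr1 a b (?K * M * adj ?K) $$ (i,j) =
      (\<Sum>k<a. \<Sum>j'<b. \<Sum>i'<b. V $$ (i,i') * M $$ (k * b + i', k * b + j') * cnj (V $$ (j,j')))"
    using ij by (simp add: ptr1_def del: index_mult_mat(1))
  also have "\<dots> = (\<Sum>j'<b. \<Sum>i'<b. \<Sum>k<a. V $$ (i,i') * M $$ (k * b + i', k * b + j') * cnj (V $$ (j,j')))"
    by (subst sum.swap, intro sum.cong refl sum.swap)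
  also have "\<dots> = (\<Sum>j'<b. (\<Sum>i'<b. V $$ (i,i') * ptr1 a b M $$ (i',j')) * cnj (V $$ (j,j')))"
    by (simp add: ptr1_def sum_distrib_left sum_distrib_right)
  also have "\<dots> = (\<Sum>j'<b. (V * ptr1 a b M) $$ (i,j') * adj V $$ (j',j))"
    using V ij by (intro sum.cong refl) (simp del: index_mult_mat(1) add: index_mult_sum[OF V ptr_carrier(1)])
  also have "\<dots> = (V * ptr1 a b M * adj V) $$ (i,j)"
    by (rule index_mult_sum[symmetric]) (use V ij in auto)
  finally show "ptr1 a b (?K * M * adj ?K) $$ (i,j) = (V * ptr1 a b M * adj V) $$ (i,j)" .
qed (use V in auto)

section \<open>Trace distance from a pure state to a mixture\<close>

lemma sum_qform_cols:
  assumes V: "unitary n V" and M: "M \<in> carrier_mat n n"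
  shows "(\<Sum>k<n. qform M (col V k)) = tr M"
proof -
  note cV = unitaryD[OF V]
  have "(\<Sum>k<n. qform M (col V k)) = (\<Sum>k<n. \<Sum>i<n. \<Sum>j<n. M $$ (i,j) * (V $$ (j,k) * cnj (V $$ (i,k))))"
    unfolding qform_def using cV by (intro sum.cong) (auto simp: mult_ac)
  also have "\<dots> = (\<Sum>i<n. \<Sum>j<n. \<Sum>k<n. M $$ (i,j) * (V $$ (j,k) * cnj (V $$ (i,k))))"
    by (subst sum.swap, intro sum.cong refl sum.swap)
  also have "\<dots> = (\<Sum>i<n. \<Sum>j<n. if j = i then M $$ (i,j) else 0)"
    by (intro sum.cong refl) (simp add: sum_distrib_left[symmetric] unitary_rows_orthonormal[OF V])
  finally show ?thesis using M by (simp add: tr_def)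
qed

text \<open>Diagonalise the difference and estimate its diagonal in the eigenbasis, where the two pure states contribute \<open>|\<alpha>|\<^sup>2 - |\<gamma>|\<^sup>2\<close>.\<close>

lemma tnorm_mixture_bound:
  assumes x: "x \<in> carrier_vec n" "(\<Sum>i<n. (cmod (x $ i))\<^sup>2) = 1"
    and y: "y \<in> carrier_vec n" "(\<Sum>i<n. (cmod (y $ i))\<^sup>2) = 1"
    and \<sigma>: "psd n \<sigma>" "tr \<sigma> = complex_of_real q" and p: "0 \<le> p" "p + q = 1" and q: "0 \<le> q" and W: "unitary n W"
  shows "1/2 * tnorm (W * (ketbra x - (complex_of_real p \<cdot>\<^sub>m ketbra y + \<sigma>)) * adj W) \<le>
    sqrt (\<Sum>i<n. (cmod (x $ i - y $ i))\<^sup>2) + q"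
proof -
  let ?\<Delta> = "ketbra x - (complex_of_real p \<cdot>\<^sub>m ketbra y + \<sigma>)"
  let ?\<delta> = "sqrt (\<Sum>i<n. (cmod (x $ i - y $ i))\<^sup>2)"
  note cx = ketbra_carrier[OF x(1)] and cy = ketbra_carrier[OF y(1)] and cs = psd_carrier[OF \<sigma>(1)]
  have py: "psd n (complex_of_real p \<cdot>\<^sub>m ketbra y + \<sigma>)" by (intro psd_add psd_smult psd_ketbra y p \<sigma>)
  then have h: "hermitian n ?\<Delta>"
    using psd_ketbra[OF x(1)] by (intro hermitian_minus) (auto simp: psd_def)
  obtain V d where V: "unitary n V" "?\<Delta> = V * rdiag n d * adj V" using hermitian_spectral[OF h] by blast
  note cV = unitaryD[OF V(1)] and cW = unitaryD[OF W]
  have "W * ?\<Delta> * adj W = (W * V) * rdiag n d * adj (W * V)" unfolding V(2) using cV cW by (simp add: mat_assoc)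
  then have tn: "tnorm (W * ?\<Delta> * adj W) = (\<Sum>k<n. \<bar>d k\<bar>)" by (rule tnorm_spectral[OF unitary_mult[OF W V(1)]])
  define \<alpha> where "\<alpha> k = (\<Sum>i<n. cnj (V $$ (i,k)) * x $ i)" for k
  define \<gamma> where "\<gamma> k = (\<Sum>i<n. cnj (V $$ (i,k)) * y $ i)" for k
  have sa: "(\<Sum>k<n. (cmod (\<alpha> k))\<^sup>2) = 1" "(\<Sum>k<n. (cmod (\<gamma> k))\<^sup>2) = 1"
    using parseval[OF V(1) x(1)] parseval[OF V(1) y(1)] x y by (simp_all add: \<alpha>_def \<gamma>_def)
  have sd: "(\<Sum>k<n. (cmod (\<alpha> k - \<gamma> k))\<^sup>2) = (\<Sum>i<n. (cmod (x $ i - y $ i))\<^sup>2)"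
    using parseval[OF V(1), of "x - y"] x y by (simp add: \<alpha>_def \<gamma>_def sum_subtractf[symmetric] algebra_simps)
  let ?s = "\<lambda>k. Re (qform \<sigma> (col V k))"
  have s0: "0 \<le> ?s k" if "k < n" for k using \<sigma>(1) cV that by (auto simp: psd_def)
  have ss: "(\<Sum>k<n. ?s k) = q"
    using arg_cong[OF sum_qform_cols[OF V(1) cs], of Re] \<sigma>(2) by (simp add: Re_sum)
  have dk: "\<bar>d k\<bar> \<le> cmod (\<alpha> k - \<gamma> k) * (cmod (\<alpha> k) + cmod (\<gamma> k)) + q * (cmod (\<gamma> k))\<^sup>2 + ?s k" if k: "k < n" for k
  proof -
    have cc: "col V k \<in> carrier_vec n" using cV k by auto
    have qx: "qform (ketbra x) (col V k) = complex_of_real ((cmod (\<alpha> k))\<^sup>2)"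
      "qform (ketbra y) (col V k) = complex_of_real ((cmod (\<gamma> k))\<^sup>2)"
      unfolding \<alpha>_def \<gamma>_def qform_ketbra[OF x(1) cc] qform_ketbra[OF y(1) cc] using cV k by simp_all
    have "complex_of_real (d k) = qform ?\<Delta> (col V k)" unfolding V(2) by (rule qform_eigenvector[OF V(1) k, symmetric])
    also have "\<dots> = qform (ketbra x) (col V k) - (complex_of_real p * qform (ketbra y) (col V k) + qform \<sigma> (col V k))"
      using cx cy cs by (simp add: qform_minus[OF cc] qform_add[OF cc] qform_smult[OF cc])
    finally have "d k = Re (qform (ketbra x) (col V k) - (complex_of_real p * qform (ketbra y) (col V k) + qform \<sigma> (col V k)))"
      by (metis Re_complex_of_real)
    then have "d k = (cmod (\<alpha> k))\<^sup>2 - (p * (cmod (\<gamma> k))\<^sup>2 + ?s k)"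
      unfolding qx by (simp flip: of_real_mult of_real_power)
    moreover have "p = 1 - q" using p(2) by simp
    \<comment> \<open>With p = 1 - q the mixture splits into a difference of two pure states and two
      nonnegative terms, each summing to q over k.\<close>
    ultimately have "d k = ((cmod (\<alpha> k))\<^sup>2 - (cmod (\<gamma> k))\<^sup>2) + q * (cmod (\<gamma> k))\<^sup>2 - ?s k"
      by (simp add: algebra_simps)
    moreover have "\<bar>(cmod (\<alpha> k))\<^sup>2 - (cmod (\<gamma> k))\<^sup>2\<bar> \<le> cmod (\<alpha> k - \<gamma> k) * (cmod (\<alpha> k) + cmod (\<gamma> k))"
    proof -
      have "\<bar>(cmod (\<alpha> k))\<^sup>2 - (cmod (\<gamma> k))\<^sup>2\<bar> = \<bar>cmod (\<alpha> k) - cmod (\<gamma> k)\<bar> * (cmod (\<alpha> k) + cmod (\<gamma> k))"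
        unfolding power2_eq_square square_diff_square_factored abs_mult by simp
      also have "\<dots> \<le> cmod (\<alpha> k - \<gamma> k) * (cmod (\<alpha> k) + cmod (\<gamma> k))"
        by (intro mult_right_mono norm_triangle_ineq3) auto
      finally show ?thesis .
    qed
    moreover have "0 \<le> q * (cmod (\<gamma> k))\<^sup>2" using q by simp
    ultimately show ?thesis using s0[OF k] by linarith
  qed
  have "(\<Sum>k<n. cmod (\<alpha> k - \<gamma> k) * (cmod (\<alpha> k) + cmod (\<gamma> k))) =
      (\<Sum>k<n. \<bar>cmod (\<alpha> k - \<gamma> k)\<bar> * \<bar>cmod (\<alpha> k) + cmod (\<gamma> k)\<bar>)" by simp
  \<comment> \<open>Cauchy-Schwarz: the first factor becomes the distance of the vectors, the second
    is at most 2 by the triangle inequality. The factor 1/2 of the trace distance absorbs this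
    2.\<close>
  also have "\<dots> \<le> L2_set (\<lambda>k. cmod (\<alpha> k - \<gamma> k)) {..<n} * L2_set (\<lambda>k. cmod (\<alpha> k) + cmod (\<gamma> k)) {..<n}"
    by (rule L2_set_mult_ineq)
  also have "\<dots> \<le> ?\<delta> * 2"
  proof (intro mult_mono)
    show "L2_set (\<lambda>k. cmod (\<alpha> k - \<gamma> k)) {..<n} \<le> ?\<delta>" by (simp add: L2_set_def sd)
    show "L2_set (\<lambda>k. cmod (\<alpha> k) + cmod (\<gamma> k)) {..<n} \<le> 2"
      using L2_set_triangle_ineq[of "\<lambda>k. cmod (\<alpha> k)" "\<lambda>k. cmod (\<gamma> k)" "{..<n}"] by (simp add: L2_set_def sa)
  qed (auto simp: sum_nonneg)
  finally have cs2: "(\<Sum>k<n. cmod (\<alpha> k - \<gamma> k) * (cmod (\<alpha> k) + cmod (\<gamma> k))) \<le> 2 * ?\<delta>" by simp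
  have "(\<Sum>k<n. \<bar>d k\<bar>) \<le> (\<Sum>k<n. cmod (\<alpha> k - \<gamma> k) * (cmod (\<alpha> k) + cmod (\<gamma> k)) + q * (cmod (\<gamma> k))\<^sup>2 + ?s k)"
    by (intro sum_mono dk) auto
  also have "\<dots> = (\<Sum>k<n. cmod (\<alpha> k - \<gamma> k) * (cmod (\<alpha> k) + cmod (\<gamma> k))) + q + q"
    by (simp add: sum.distrib sum_distrib_left[symmetric] sa ss)
  finally show ?thesis using cs2 unfolding tn by simp
qed

subsection \<open>The bath and the formation protocol\<close>

text \<open>Words over \<open>{..<D}\<close> are numbered in bijective base \<open>D\<close>: the empty word is \<open>0\<close>, and appending \<open>b\<close> to the word
  \<open>w\<close> gives \<open>w * D + b + 1\<close>. The words of length at most \<open>N\<close> are exactly the numbers below \<open>bath_dim D N\<close>,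
  and \<open>bath_energy x\<close> adds up the letter energies \<open>x\<close>.\<close>

function bath_energy :: "(nat \<Rightarrow> real) \<Rightarrow> nat \<Rightarrow> nat \<Rightarrow> real" where
  "bath_energy x D 0 = 0"
| "bath_energy x D (Suc c) = bath_energy x D (c div D) + x (c mod D)"
  by pat_completeness auto
termination by (relation "measure (\<lambda>(x, D, c). c)") (auto simp: le_imp_less_Suc)

primrec bath_dim :: "nat \<Rightarrow> nat \<Rightarrow> nat" where
  "bath_dim D 0 = 1"
| "bath_dim D (Suc N) = Suc (bath_dim D N * D)"

lemma bath_energy_nonneg:
  assumes "\<And>k. k < D \<Longrightarrow> 0 \<le> x k" "0 < D" shows "0 \<le> bath_energy x D c"
  using assms by (induction x D c rule: bath_energy.induct) auto

text \<open>All words of one length carry total weight 1, a power of the single-letter partition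
  function, so the sum counts the lengths 0, ..., N. Index 0 is the empty word, and splitting a
  successor index peels off the last letter.\<close>

lemma bath_partition:
  assumes x: "(\<Sum>k<D. exp (- \<beta> * x k)) = 1"
  shows "(\<Sum>c<bath_dim D N. exp (- \<beta> * bath_energy x D c)) = N + 1"
proof (induction N)
  case (Suc N)
  have ex: "exp (- \<beta> * (a + b)) = exp (- \<beta> * a) * exp (- \<beta> * b)" for a b
    by (simp add: ring_distribs exp_add[symmetric])
  have "(\<Sum>c<bath_dim D (Suc N). exp (- \<beta> * bath_energy x D c)) =
      1 + (\<Sum>c<bath_dim D N * D. exp (- \<beta> * bath_energy x D (c div D)) * exp (- \<beta> * x (c mod D)))"
    unfolding bath_dim.simps sum.lessThan_Suc_shift bath_energy.simps ex by simp
  also have "\<dots> = 1 + (\<Sum>i<bath_dim D N. \<Sum>j<D. exp (- \<beta> * bath_energy x D i) * exp (- \<beta> * x j))"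
    by (simp only: sum_divmod[of "\<lambda>i j. exp (- \<beta> * bath_energy x D i) * exp (- \<beta> * x j)"])
  also have "\<dots> = 1 + (N + 1)" by (simp only: sum_product[symmetric] Suc.IH x mult_1_right)
  finally show ?case by simp
qed simp

text \<open>Indices below \<open>Y\<close> stand for triples (level \<open>r\<close> of \<open>R\<close>, bath word \<open>c\<close>, basis vector \<open>b\<close> of \<open>B\<close>), encoded as
  \<open>r * S + (c * D + b)\<close>. Appending \<open>b\<close> to \<open>c\<close> is then the successor of the combined index \<open>c * D + b\<close>, so \<open>K\<close> maps
  \<open>|r\<rangle> |c\<rangle> |b\<rangle>\<close> to \<open>|g\<rangle> |c * D + b + 1\<rangle> |\<phi>\<^sub>r\<rangle>\<close>, or to \<open>0\<close> if the bath is exhausted.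
  \<open>F a\<close> adjoins the state \<open>\<Sum>\<^sub>r a\<^sub>r |r\<rangle>\<close> of \<open>R\<close>.\<close>

locale formation =
  fixes D dR g L :: nat and \<phi> :: "nat \<Rightarrow> nat \<Rightarrow> complex"
  assumes D: "0 < D" and L: "0 < L" and g: "g < dR"
    and orthonormal: "\<And>r r'. r < dR \<Longrightarrow> r' < dR \<Longrightarrow> (\<Sum>b<D. cnj (\<phi> r b) * \<phi> r' b) = (if r = r' then 1 else 0)"
begin

abbreviation "S \<equiv> L * D"
abbreviation "Y \<equiv> dR * S"

definition "K = mat Y Y (\<lambda>(i,j). if i div S = g \<and> i mod S div D = Suc (j mod S) then \<phi> (j div S) (i mod S mod D) else 0)"

definition "F a = mat Y S (\<lambda>(i,s). if i mod S = s then a (i div S) else 0 :: complex)"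

lemma S_pos: "0 < S" using D L by simp

lemma K_carrier: "K \<in> carrier_mat Y Y" by (simp add: K_def)
lemma F_carrier: "F a \<in> carrier_mat Y S" by (simp add: F_def)

lemma index_K: "i < Y \<Longrightarrow> j < Y \<Longrightarrow> K $$ (i,j) =
    (if i div S = g \<and> i mod S div D = Suc (j mod S) then \<phi> (j div S) (i mod S mod D) else 0)"
  by (simp add: K_def)

lemma sum_Y: "(\<Sum>i<Y. f i) = (\<Sum>r<dR. \<Sum>c<L. \<Sum>b<D. f (r * S + (c * D + b)))"
  by (simp only: sum_mult_shift[of f dR S] sum_mult_shift[of _ L D])

lemma index_split:
  assumes "c < L" "b < D"
  shows "(r * S + (c * D + b)) div S = r" "(r * S + (c * D + b)) mod S div D = c" "(r * S + (c * D + b)) mod S mod D = b"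
    "(r * S + (c * D + b)) mod S = c * D + b"
  using mult_add_less[OF assms] assms by auto

lemma index_less:
  assumes "r < dR" "c < L" "b < D" shows "r * S + (c * D + b) < Y"
  using assms by (intro mult_add_less)

lemma index_K_split:
  assumes "r < dR" "c < L" "b < D" "j < Y"
  shows "K $$ (r * S + (c * D + b), j) = (if r = g \<and> c = Suc (j mod S) then \<phi> (j div S) b else 0)"
  unfolding index_K[OF index_less[OF assms(1-3)] assms(4)] index_split(1-3)[OF assms(2,3)] ..

text \<open>Distinct pairs (c, b) produce distinct words, and distinct r with the same word produce
  orthogonal vectors \<phi> r. The columns of K are therefore orthonormal, except for those set to 0
  because the longer word does not fit.\<close>

lemma adj_K_K: "adj K * K = rdiag Y (\<lambda>j. if Suc (j mod S) < L then 1 else 0)"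
proof (rule eq_matI)
  fix j j' assume "j < dim_row (rdiag Y (\<lambda>j. if Suc (j mod S) < L then 1 else 0))"
    "j' < dim_col (rdiag Y (\<lambda>j. if Suc (j mod S) < L then 1 else 0))"
  then have j: "j < Y" "j' < Y" by auto
  note dj = div_mod_less[OF j(1)] div_mod_less[OF j(2)]
  have "(adj K * K) $$ (j,j') = (\<Sum>i<Y. cnj (K $$ (i,j)) * K $$ (i,j'))"
    by (rule index_adj_mult_self[OF K_carrier j])
  also have "\<dots> = (\<Sum>r<dR. \<Sum>c<L. \<Sum>b<D. if r = g then
      (if c = Suc (j mod S) \<and> c = Suc (j' mod S) then cnj (\<phi> (j div S) b) * \<phi> (j' div S) b else 0) else 0)"
    unfolding sum_Y using j by (intro sum.cong refl) (simp add: index_K_split)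
  also have "\<dots> = (\<Sum>r<dR. if r = g then (\<Sum>c<L. \<Sum>b<D.
      (if c = Suc (j mod S) \<and> c = Suc (j' mod S) then cnj (\<phi> (j div S) b) * \<phi> (j' div S) b else 0)) else 0)"
    by (intro sum.cong refl) simp
  also have "\<dots> = (\<Sum>c<L. \<Sum>b<D.
      (if c = Suc (j mod S) \<and> c = Suc (j' mod S) then cnj (\<phi> (j div S) b) * \<phi> (j' div S) b else 0))"
    using g by simp
  also have "\<dots> = (\<Sum>c<L. if c = Suc (j mod S) then if j mod S = j' mod S \<and> j div S = j' div S then 1 else 0 else 0)"
    using dj by (intro sum.cong refl, cases "j mod S = j' mod S") (simp_all add: orthonormal)
  also have "\<dots> = (if Suc (j mod S) < L \<and> j = j' then 1 else 0)"
    using div_mod_eq_iff[of j S j'] by auto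
  finally show "(adj K * K) $$ (j,j') = rdiag Y (\<lambda>j. if Suc (j mod S) < L then 1 else 0) $$ (j,j')"
    using j by auto
qed (use K_carrier in auto)

lemma K_nonzero:
  assumes "i < Y" "j < Y" "K $$ (i,j) \<noteq> 0"
  shows "i div S = g" "i mod S div D = Suc (j mod S)" "\<phi> (j div S) (i mod S mod D) \<noteq> 0" "Suc (j mod S) < L"
proof -
  show *: "i div S = g" "i mod S div D = Suc (j mod S)" "\<phi> (j div S) (i mod S mod D) \<noteq> 0"
    using assms by (auto simp: index_K split: if_splits)
  show "Suc (j mod S) < L" using *(2) div_mod_less(1)[of "i mod S" L D] S_pos by simp
qed

lemma K_partial_isometry: "K * (adj K * K) = K"
proof (rule eq_matI)
  fix i j assume "i < dim_row K" "j < dim_col K"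
  then have ij: "i < Y" "j < Y" using K_carrier by auto
  show "(K * (adj K * K)) $$ (i,j) = K $$ (i,j)"
    unfolding adj_K_K index_mult_rdiag[OF K_carrier ij] using K_nonzero(4)[OF ij] by auto
qed (use K_carrier in auto)

lemma K_intertwines:
  assumes "\<And>i j. i < Y \<Longrightarrow> j < Y \<Longrightarrow> K $$ (i,j) \<noteq> 0 \<Longrightarrow> h1 i = h0 j"
  shows "K * rdiag Y h0 = rdiag Y h1 * K"
proof (rule eq_matI)
  fix i j assume "i < dim_row (rdiag Y h1 * K)" "j < dim_col (rdiag Y h1 * K)"
  then have ij: "i < Y" "j < Y" using K_carrier by auto
  show "(K * rdiag Y h0) $$ (i,j) = (rdiag Y h1 * K) $$ (i,j)"
    unfolding index_mult_rdiag[OF K_carrier ij] index_rdiag_mult[OF K_carrier ij]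
    using assms[OF ij] by (cases "K $$ (i,j) = 0") simp_all
qed (use K_carrier in auto)

text \<open>Written as a rectangular factor around a diagonal, the input keeps this form under any
  further multiplication from the left, so \<open>index_spectral\<close> and
  \<open>psd_spectral_form\<close> apply to the outputs.\<close>

lemma kron_ketbra_rdiag: "kron (ketbra (vec dR a)) (rdiag S \<gamma>) = F a * rdiag S \<gamma> * adj (F a)"
proof (rule eq_matI)
  fix i j assume "i < dim_row (F a * rdiag S \<gamma> * adj (F a))" "j < dim_col (F a * rdiag S \<gamma> * adj (F a))"
  then have ij: "i < Y" "j < Y" using F_carrier[of a] by auto
  note d = div_mod_less[OF ij(1)] div_mod_less[OF ij(2)]
  have "(F a * rdiag S \<gamma> * adj (F a)) $$ (i,j) = (\<Sum>s<S. \<gamma> s * (F a $$ (i,s) * cnj (F a $$ (j,s))))"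
    by (rule index_spectral[OF F_carrier ij])
  also have "\<dots> = (\<Sum>s<S. if s = i mod S then if i mod S = j mod S then \<gamma> s * (a (i div S) * cnj (a (j div S))) else 0 else 0)"
    using ij by (intro sum.cong refl) (auto simp: F_def)
  also have "\<dots> = kron (ketbra (vec dR a)) (rdiag S \<gamma>) $$ (i,j)"
    using ij d by (simp add: index_kron)
  finally show "kron (ketbra (vec dR a)) (rdiag S \<gamma>) $$ (i,j) = (F a * rdiag S \<gamma> * adj (F a)) $$ (i,j)" by simp
qed (use F_carrier[of a] in auto)

text \<open>For bath content s, R ends in level g and the word becomes s + 1, neither of which
  depends on r. The amplitudes of R pass to the vectors \<phi> r without any record of the level
  staying behind.\<close>

lemma index_K_F:
  assumes "r < dR" "c < L" "b < D" "s < S"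
  shows "(K * F a) $$ (r * S + (c * D + b), s) = (if r = g \<and> c = Suc s then \<Sum>r<dR. \<phi> r b * a r else 0)"
proof -
  let ?i = "r * S + (c * D + b)"
  have "(K * F a) $$ (?i, s) = (\<Sum>j<Y. K $$ (?i,j) * F a $$ (j,s))"
    by (rule index_mult_sum[OF K_carrier F_carrier index_less[OF assms(1-3)] assms(4)])
  also have "\<dots> = (\<Sum>r'<dR. \<Sum>s'<S. K $$ (?i,r' * S + s') * F a $$ (r' * S + s',s))"
    by (rule sum_mult_shift)
  also have "\<dots> = (\<Sum>r'<dR. \<Sum>s'<S. if s' = s then if r = g \<and> c = Suc s then \<phi> r' b * a r' else 0 else 0)"
  proof (intro sum.cong refl)
    fix r' s' assume "r' \<in> {..<dR}" "s' \<in> {..<S}"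
    then have j: "r' < dR" "s' < S" by auto
    show "K $$ (?i, r' * S + s') * F a $$ (r' * S + s',s) = (if s' = s then if r = g \<and> c = Suc s then \<phi> r' b * a r' else 0 else 0)"
      unfolding index_K_split[OF assms(1-3) mult_add_less[OF j]] using j assms mult_add_less[OF j] by (simp add: F_def)
  qed
  also have "\<dots> = (\<Sum>r'<dR. if r = g \<and> c = Suc s then \<phi> r' b * a r' else 0)"
    using assms by simp
  finally show ?thesis by (cases "r = g \<and> c = Suc s") auto
qed

text \<open>Every bath content s that fits writes the same vector into B, so averaging over s with
  the weights \<gamma> leaves a multiple of a single pure state.\<close>

lemma output_success:
  "ptr1 (dR * L) D (K * (F a * rdiag S \<gamma> * adj (F a)) * adj K) =
    complex_of_real (\<Sum>s | s < S \<and> Suc s < L. \<gamma> s) \<cdot>\<^sub>m ketbra (vec D (\<lambda>b. \<Sum>r<dR. \<phi> r b * a r))"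
proof (rule eq_matI)
  let ?\<psi> = "\<lambda>b. \<Sum>r<dR. \<phi> r b * a r" and ?p = "complex_of_real (\<Sum>s | s < S \<and> Suc s < L. \<gamma> s)"
  fix b b' assume "b < dim_row (?p \<cdot>\<^sub>m ketbra (vec D ?\<psi>))" "b' < dim_col (?p \<cdot>\<^sub>m ketbra (vec D ?\<psi>))"
  then have b: "b < D" "b' < D" by auto
  have KF: "K * F a \<in> carrier_mat Y S" by (rule mult_carrier_mat[OF K_carrier F_carrier])
  have eq: "K * (F a * rdiag S \<gamma> * adj (F a)) * adj K = (K * F a) * rdiag S \<gamma> * adj (K * F a)"
    using K_carrier F_carrier[of a] by (simp add: mat_assoc)
  have "ptr1 (dR * L) D (K * (F a * rdiag S \<gamma> * adj (F a)) * adj K) $$ (b,b') =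
      (\<Sum>k<dR * L. ((K * F a) * rdiag S \<gamma> * adj (K * F a)) $$ (k * D + b, k * D + b'))"
    unfolding eq using b by (simp add: ptr1_def del: index_mult_mat(1))
  also have "\<dots> = (\<Sum>r<dR. \<Sum>c<L. ((K * F a) * rdiag S \<gamma> * adj (K * F a)) $$ (r * S + (c * D + b), r * S + (c * D + b')))"
    unfolding sum_mult_shift by (intro sum.cong refl) (simp add: algebra_simps del: index_mult_mat(1))
  also have "\<dots> = (\<Sum>r<dR. \<Sum>c<L. \<Sum>s<S. if r = g then if c = Suc s then \<gamma> s * (?\<psi> b * cnj (?\<psi> b')) else 0 else 0)"
  proof (intro sum.cong refl)
    fix r c assume "r \<in> {..<dR}" "c \<in> {..<L}"
    then have rc: "r < dR" "c < L" by auto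
    show "((K * F a) * rdiag S \<gamma> * adj (K * F a)) $$ (r * S + (c * D + b), r * S + (c * D + b')) =
        (\<Sum>s<S. if r = g then if c = Suc s then \<gamma> s * (?\<psi> b * cnj (?\<psi> b')) else 0 else 0)"
      unfolding index_spectral[OF KF index_less[OF rc b(1)] index_less[OF rc b(2)]]
      using rc b by (intro sum.cong refl) (simp del: index_mult_mat(1) add: index_K_F)
  qed
  also have "\<dots> = (\<Sum>r<dR. if r = g then \<Sum>c<L. \<Sum>s<S. if c = Suc s then \<gamma> s * (?\<psi> b * cnj (?\<psi> b')) else 0 else 0)"
    by (intro sum.cong refl) simp
  also have "\<dots> = (\<Sum>c<L. \<Sum>s<S. if c = Suc s then \<gamma> s * (?\<psi> b * cnj (?\<psi> b')) else 0)" using g by simp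
  also have "\<dots> = (\<Sum>s<S. \<Sum>c<L. if c = Suc s then \<gamma> s * (?\<psi> b * cnj (?\<psi> b')) else 0)" by (rule sum.swap)
  also have "\<dots> = (\<Sum>s<S. if Suc s < L then \<gamma> s * (?\<psi> b * cnj (?\<psi> b')) else 0)"
    by (intro sum.cong refl) simp
  also have "\<dots> = (\<Sum>s | s < S \<and> Suc s < L. \<gamma> s * (?\<psi> b * cnj (?\<psi> b')))"
    by (subst sum.inter_filter[symmetric]) (auto simp: lessThan_def)
  also have "\<dots> = (?p \<cdot>\<^sub>m ketbra (vec D ?\<psi>)) $$ (b,b')"
    using b by (simp add: sum_distrib_right)
  finally show "ptr1 (dR * L) D (K * (F a * rdiag S \<gamma> * adj (F a)) * adj K) $$ (b,b') = (?p \<cdot>\<^sub>m ketbra (vec D ?\<psi>)) $$ (b,b')" .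
qed auto

text \<open>The projection 1 - adj K K is diagonal, so this branch is a compression of the input to
  the contents that do not fit. Positivity and total weight are all that
  \<open>tnorm_mixture_bound\<close> asks of it.\<close>

lemma output_failure:
  assumes \<gamma>: "\<And>s. s < S \<Longrightarrow> 0 \<le> \<gamma> s" and a: "(\<Sum>r<dR. (cmod (a r))\<^sup>2) = 1"
  shows "psd D (ptr1 (dR * L) D ((1\<^sub>m Y - adj K * K) * (F a * rdiag S \<gamma> * adj (F a)) * (1\<^sub>m Y - adj K * K)))"
    "tr (ptr1 (dR * L) D ((1\<^sub>m Y - adj K * K) * (F a * rdiag S \<gamma> * adj (F a)) * (1\<^sub>m Y - adj K * K))) =
      complex_of_real (\<Sum>s | s < S \<and> \<not> Suc s < L. \<gamma> s)"
proof -
  let ?w = "\<lambda>j. if Suc (j mod S) < L then 0 else 1 :: real"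
  let ?M = "(1\<^sub>m Y - adj K * K) * (F a * rdiag S \<gamma> * adj (F a)) * (1\<^sub>m Y - adj K * K)"
  let ?G = "rdiag Y ?w * F a"
  have P: "1\<^sub>m Y - adj K * K = rdiag Y ?w" unfolding adj_K_K by (rule eq_matI) auto
  have G: "?G \<in> carrier_mat Y S" by (rule mult_carrier_mat[OF rdiag_carrier F_carrier])
  have M: "?M = ?G * rdiag S \<gamma> * adj ?G"
    unfolding P using F_carrier[of a] by (simp add: mat_assoc)
  have pM: "psd Y ?M" unfolding M by (rule psd_spectral_form[OF G \<gamma>])
  have Y': "dR * L * D = Y" by simp
  show "psd D (ptr1 (dR * L) D ?M)" by (rule psd_ptr1) (use pM in \<open>unfold Y'\<close>)
  have cM: "?M \<in> carrier_mat (dR * L * D) (dR * L * D)" using psd_carrier[OF pM] unfolding Y' .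
  have "tr (ptr1 (dR * L) D ?M) = tr ?M" by (rule tr_ptr1[OF cM])
  also have "\<dots> = (\<Sum>i<Y. \<Sum>s<S. \<gamma> s * (?G $$ (i,s) * cnj (?G $$ (i,s))))"
    unfolding M tr_def using G by (intro sum.cong) (auto simp del: index_mult_mat(1) simp: index_spectral[OF G])
  also have "\<dots> = (\<Sum>r<dR. \<Sum>t<S. \<Sum>s<S. \<gamma> s * (?G $$ (r * S + t,s) * cnj (?G $$ (r * S + t,s))))"
    by (rule sum_mult_shift)
  also have "\<dots> = (\<Sum>r<dR. \<Sum>t<S. \<Sum>s<S. if s = t then if Suc t < L then 0 else complex_of_real (\<gamma> t * (cmod (a r))\<^sup>2) else 0)"
  proof (intro sum.cong refl)
    fix r t s assume "r \<in> {..<dR}" "t \<in> {..<S}" "s \<in> {..<S}"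
    then have j: "r < dR" "t < S" "s < S" by auto
    have "(r * S + t) div S = r" "(r * S + t) mod S = t" using j S_pos by auto
    then have "?G $$ (r * S + t, s) = (if s = t then if Suc t < L then 0 else a r else 0)"
      unfolding index_rdiag_mult[OF F_carrier mult_add_less[OF j(1,2)] j(3)] using j mult_add_less[OF j(1,2)] by (simp add: F_def)
    then show "\<gamma> s * (?G $$ (r * S + t,s) * cnj (?G $$ (r * S + t,s))) =
        (if s = t then if Suc t < L then 0 else complex_of_real (\<gamma> t * (cmod (a r))\<^sup>2) else 0)"
      by (simp del: index_mult_mat(1) of_real_power add: complex_norm_square)
  qed
  also have "\<dots> = (\<Sum>r<dR. \<Sum>t<S. complex_of_real ((cmod (a r))\<^sup>2) * (if Suc t < L then 0 else \<gamma> t))"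
    by (intro sum.cong refl) (auto simp: mult.commute)
  also have "\<dots> = complex_of_real (\<Sum>r<dR. (cmod (a r))\<^sup>2) * (\<Sum>t<S. if Suc t < L then 0 else complex_of_real (\<gamma> t))"
    by (simp add: sum_product if_distrib[of complex_of_real] cong: if_cong)
  also have "(\<Sum>t<S. if Suc t < L then 0 else complex_of_real (\<gamma> t)) = (\<Sum>t<S. if \<not> Suc t < L then complex_of_real (\<gamma> t) else 0)"
    by (intro sum.cong refl) auto
  also have "\<dots> = (\<Sum>s | s < S \<and> \<not> Suc s < L. complex_of_real (\<gamma> s))"
    by (subst sum.inter_filter[symmetric]) (auto simp: lessThan_def)
  finally show "tr (ptr1 (dR * L) D ?M) = complex_of_real (\<Sum>s | s < S \<and> \<not> Suc s < L. \<gamma> s)"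
    by (simp add: a)
qed

end

section \<open>Realising the map by a thermal operation\<close>

lemma rdiag_four_block:
  "rdiag (n + n) f = four_block_mat (rdiag n f) (0\<^sub>m n n) (0\<^sub>m n n) (rdiag n (\<lambda>i. f (i + n)))"
  by (rule eq_matI) auto

lemma kron_ket0: "M \<in> carrier_mat n n \<Longrightarrow> kron ket0 M = four_block_mat M (0\<^sub>m n n) (0\<^sub>m n n) (0\<^sub>m n n)"
proof (rule eq_matI)
  assume M: "M \<in> carrier_mat n n"
  fix i j assume "i < dim_row (four_block_mat M (0\<^sub>m n n) (0\<^sub>m n n) (0\<^sub>m n n))" "j < dim_col (four_block_mat M (0\<^sub>m n n) (0\<^sub>m n n) (0\<^sub>m n n))"
  then have ij: "i < 2 * n" "j < 2 * n" using M by auto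
  have d: "k div n = (if k < n then 0 else 1)" "k mod n = (if k < n then k else k - n)" if "k < 2 * n" for k
    using that by (auto simp: div_if mod_if)
  show "kron ket0 M $$ (i,j) = four_block_mat M (0\<^sub>m n n) (0\<^sub>m n n) (0\<^sub>m n n) $$ (i,j)"
    using ij M d by (auto simp: index_kron ket0_def)
qed (auto simp: ket0_def)

lemma conv_dist_le:
  assumes b: "0 < \<beta>" and m: "1 < m" and B: "valid B" and R: "valid R" and \<sigma>: "hermitian (sdim B) \<sigma>"
    and w: "density (sdim R) \<omega>" and E: "E \<in> CTO \<beta> (Comp (Atom (qubit_ham \<beta> m)) R) B"
    and le: "1/2 * tnorm (\<sigma> - E (kron ket0 \<omega>)) \<le> x"
  shows "conv_dist \<beta> (Atom (qubit_ham \<beta> m)) ket0 R B \<sigma> \<le> x"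
proof -
  let ?S = "{1/2 * tnorm (\<sigma> - E (kron ket0 \<omega>)) | \<omega> E. density (sdim R) \<omega> \<and> E \<in> CTO \<beta> (Comp (Atom (qubit_ham \<beta> m)) R) B}"
  \<comment> \<open>A real \<open>Inf\<close> lies below its members only if the set is bounded from
    below, here by 0.\<close>
  have "bdd_below ?S"
  proof (rule bdd_belowI)
    fix y assume "y \<in> ?S"
    then obtain \<omega> E where y: "y = 1/2 * tnorm (\<sigma> - E (kron ket0 \<omega>))" and w: "density (sdim R) \<omega>"
      and E: "E \<in> CTO \<beta> (Comp (Atom (qubit_ham \<beta> m)) R) B" by blast
    have h: "hermitian (sdim B) (\<sigma> - E (kron ket0 \<omega>))"
      using conversion_bound(1)[OF b m B R w E] by (intro hermitian_minus \<sigma>) (simp add: psd_def)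
    show "0 \<le> y" using tnorm_nonneg[OF h] y by simp
  qed
  moreover have "1/2 * tnorm (\<sigma> - E (kron ket0 \<omega>)) \<in> ?S" using w E by blast
  ultimately have "Inf ?S \<le> 1/2 * tnorm (\<sigma> - E (kron ket0 \<omega>))" by (rule cInf_lower[rotated])
  then show ?thesis using le unfolding conv_dist_def by linarith
qed

context formation
begin

text \<open>The factors are ordered ((X R) (C B)). C is the bath; B is absent from the input and is
  appended together with C in its Gibbs state, and afterwards X, R and C are traced out. In the
  energy basis the total Hamiltonian is \<Delta> + h on block 0 of X and h on block 1, so
  \<open>res\<close> is exactly what the dilation of K needs to conserve energy.\<close>

lemma formation_map:
  assumes \<Delta>: "0 \<le> \<Delta>" and eR: "\<And>r. r < dR \<Longrightarrow> 0 \<le> eR r" and eC: "\<And>k. k < L \<Longrightarrow> 0 \<le> eC k"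
    and B: "valid B" "sdim B = D" and W: "unitary D W" "ham B = W * rdiag D e * adj W"
    and h: "h = (\<lambda>i. eR (i div S) + (eC (i mod S div D) + e (i mod S mod D)))"
    and res: "\<And>i j. i < Y \<Longrightarrow> j < Y \<Longrightarrow> K $$ (i,j) \<noteq> 0 \<Longrightarrow> h i = \<Delta> + h j"
    and \<gamma>: "\<gamma> = (\<lambda>s. (exp (- \<beta> * eC (s div D)) / (\<Sum>k<L. exp (- \<beta> * eC k))) *
       (exp (- \<beta> * e (s mod D)) / (\<Sum>k<D. exp (- \<beta> * e k))))"
    and \<Sigma>: "\<Sigma> = F a * rdiag S \<gamma> * adj (F a)"
  shows "\<exists>E \<in> CTO \<beta> (Comp (Atom (rdiag 2 (\<lambda>i. if i = 0 then \<Delta> else 0))) (Atom (rdiag dR eR))) B.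
    E (kron ket0 (ketbra (vec dR a))) =
      W * (ptr1 (dR * L) D ((1\<^sub>m Y - adj K * K) * \<Sigma> * (1\<^sub>m Y - adj K * K)) + ptr1 (dR * L) D (K * \<Sigma> * adj K)) * adj W"
proof -
  let ?fX = "\<lambda>i::nat. if i = 0 then \<Delta> else 0"
  let ?X = "Atom (rdiag 2 ?fX)" and ?R = "Atom (rdiag dR eR)" and ?C = "Atom (rdiag L eC)"
  let ?XR = "Comp ?X ?R" and ?CB = "Comp ?C B"
  let ?T = "Comp ?XR ?CB"
  have vX: "valid ?X" using \<Delta> by (intro valid_rdiag) auto
  have vR: "valid ?R" using g eR by (intro valid_rdiag) auto
  have vC: "valid ?C" using L eC by (intro valid_rdiag) auto
  have v: "valid ?XR" "valid ?CB" "valid ?T" using vX vR vC B by simp_all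
  note cW = unitaryD[OF W(1)]
  define V where "V = kron (1\<^sub>m L) W"
  have V: "unitary S V" unfolding V_def by (rule unitary_kron[OF unitary_one W(1)])
  \<comment> \<open>A change of basis in the factor B alone: X, R and the bath have diagonal
    Hamiltonians from the start.\<close>
  define Q where "Q = kron (1\<^sub>m (2 * dR)) V"
  have Q: "unitary (2 * dR * S) Q" unfolding Q_def by (rule unitary_kron[OF unitary_one V])
  have YY: "2 * dR * S = Y + Y" by simp
  have sd: "sdim ?X = 2" "sdim ?R = dR" "sdim ?C = L" "sdim ?XR = 2 * dR" "sdim ?CB = S" "sdim ?T = Y + Y"
    using B(2) by simp_all
  have hCB: "ham ?CB = V * rdiag S (\<lambda>i. eC (i div D) + e (i mod D)) * adj V"
    using ham_Comp_spectral[of ?C "1\<^sub>m L" eC B W e] W B(2) rdiag_spectral[of L eC]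
    unfolding V_def by (simp del: ham.simps(2) adj_kron)
  have hXR: "ham ?XR = 1\<^sub>m (2 * dR) * rdiag (2 * dR) (\<lambda>i. ?fX (i div dR) + eR (i mod dR)) * adj (1\<^sub>m (2 * dR))"
    using ham_Comp_spectral[of ?X "1\<^sub>m 2" ?fX ?R "1\<^sub>m dR" eR] rdiag_spectral[of 2 ?fX] rdiag_spectral[of dR eR]
    by (simp del: ham.simps(2))
  let ?H = "\<lambda>i. (?fX (i div S div dR) + eR (i div S mod dR)) + (eC (i mod S div D) + e (i mod S mod D))"
  have hT: "ham ?T = Q * rdiag (Y + Y) ?H * adj Q"
    using ham_Comp_spectral[of ?XR "1\<^sub>m (2 * dR)" _ ?CB V, OF _ _ _ hCB[folded sd(5)]] hXR V
    unfolding Q_def sd YY by (simp del: ham.simps adj_kron)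
  have H4: "rdiag (Y + Y) ?H = four_block_mat (rdiag Y (\<lambda>i. \<Delta> + h i)) (0\<^sub>m Y Y) (0\<^sub>m Y Y) (rdiag Y h)"
    unfolding rdiag_four_block
  proof (intro cong_four_block_mat refl rdiag_cong)
    fix i assume i: "i < Y"
    note d = div_mod_less[OF i]
    show "?H i = \<Delta> + h i" using d by (simp add: h)
    have "(i + dR * S) div S = i div S + dR" "(i + dR * S) mod S = i mod S" using S_pos by simp_all
    then show "?H (i + Y) = h i" using d g by (simp add: h)
  qed
  define U0 where "U0 = dilation Y K"
  note dil = K_carrier K_partial_isometry
  have U0: "unitary (Y + Y) U0" unfolding U0_def by (rule dilation_unitary[OF dil])
  have aU0: "adj U0 = U0" unfolding U0_def by (rule dilation_adj[OF dil])
  have com0: "U0 * rdiag (Y + Y) ?H = rdiag (Y + Y) ?H * U0"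
    unfolding H4 U0_def
    by (rule dilation_commutes[OF dil]) (use K_intertwines[of h "\<lambda>i. \<Delta> + h i"] res in auto)
  define U where "U = Q * U0 * adj Q"
  have Q': "unitary (Y + Y) Q" using Q unfolding YY .
  note cQ = unitaryD[OF Q'] and cU0 = unitaryD[OF U0]
  have U: "unitary (Y + Y) U" unfolding U_def by (intro unitary_mult unitary_adj Q' U0)
  have aU: "adj U = Q * U0 * adj Q" using cQ cU0 aU0 unfolding U_def by (simp add: mat_assoc)
  have com: "U * ham ?T = ham ?T * U"
    unfolding hT U_def using cQ cU0 com0 by (simp add: unitary_conj_mult[OF Q'] del: ham.simps)
  define E where "E = ptr1 L D \<circ> (ptr1 (2 * dR) S \<circ> ((\<lambda>\<rho>. U * \<rho> * adj U) \<circ> (\<lambda>\<rho>. kron \<rho> (gibbs \<beta> (ham ?CB)))))"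
  have "(?XR, B, E) \<in> TO \<beta>"
  proof -
    have 1: "(?XR, ?T, \<lambda>\<rho>. kron \<rho> (gibbs \<beta> (ham ?CB))) \<in> TO \<beta>" by (rule TO.append_r[OF v(1,2)])
    have 2: "(?T, ?T, \<lambda>\<rho>. U * \<rho> * adj U) \<in> TO \<beta>" by (rule TO.unitary_op[OF v(3) _ com]) (unfold sd, rule U)
    have 3: "(?T, ?CB, ptr1 (2 * dR) S) \<in> TO \<beta>" using TO.trace_l[OF v(1,2), of \<beta>] unfolding sd .
    have 4: "(?CB, B, ptr1 L D) \<in> TO \<beta>" using TO.trace_l[OF vC B(1), of \<beta>] unfolding sd B(2) .
    show ?thesis unfolding E_def by (intro TO.compose[OF TO.compose[OF TO.compose[OF 1 2] 3] 4])
  qed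
  then have E: "E \<in> CTO \<beta> ?XR B" by (rule TO_imp_CTO)
  let ?\<omega> = "ketbra (vec dR a)"
  have gCB: "gibbs \<beta> (ham ?CB) = V * rdiag S \<gamma> * adj V"
  proof -
    have "gibbs \<beta> (ham ?CB) = kron (1\<^sub>m L * rdiag L (\<lambda>i. exp (- \<beta> * eC i) / (\<Sum>k<L. exp (- \<beta> * eC k))) * adj (1\<^sub>m L))
        (W * rdiag D (\<lambda>i. exp (- \<beta> * e i) / (\<Sum>k<D. exp (- \<beta> * e k))) * adj W)"
      unfolding gibbs_Comp[OF vC B(1)] gibbs_spectral[OF W] ham.simps(1) gibbs_rdiag rdiag_spectral[symmetric] ..
    also have "\<dots> = V * rdiag S \<gamma> * adj V"
      unfolding kron_spectral[OF one_carrier_mat cW(1)] V_def \<gamma> ..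
    finally show ?thesis .
  qed
  have \<Sigma>': "kron ?\<omega> (rdiag S \<gamma>) = \<Sigma>" unfolding \<Sigma> by (rule kron_ketbra_rdiag)
  have c\<Sigma>: "\<Sigma> \<in> carrier_mat Y Y" unfolding \<Sigma> using F_carrier[of a] by (intro carrier_matI) auto
  have k0: "dim_row ket0 = 2" "dim_col ket0 = 2" by (simp_all add: ket0_def)
  let ?M = "four_block_mat \<Sigma> (0\<^sub>m Y Y) (0\<^sub>m Y Y) (0\<^sub>m Y Y)"
  have cM: "?M \<in> carrier_mat (Y + Y) (Y + Y)" by (rule four_block_carrier_mat[OF c\<Sigma>]) simp
  have st: "kron (kron ket0 ?\<omega>) (gibbs \<beta> (ham ?CB)) = Q * ?M * adj Q"
  proof -
    have "?M = kron (kron ket0 ?\<omega>) (rdiag S \<gamma>)" unfolding kron_assoc \<Sigma>' by (rule kron_ket0[OF c\<Sigma>, symmetric])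
    then show ?thesis unfolding gCB Q_def using k0 unitaryD[OF V] by (simp add: kron_mult)
  qed
  let ?N = "U0 * ?M * U0"
  have cN: "?N \<in> carrier_mat (Y + Y) (Y + Y)" using cU0 cM by (intro mult_carrier_mat[of _ _ "Y + Y"])
  have UMU: "U * (Q * ?M * adj Q) * adj U = Q * ?N * adj Q"
  proof -
    have "U * (Q * ?M * adj Q) * adj U = (Q * (U0 * ?M) * adj Q) * (Q * U0 * adj Q)"
      unfolding aU unfolding U_def using cU0 cM by (subst unitary_conj_mult[OF Q']) auto
    also have "\<dots> = Q * ?N * adj Q" using cU0 cM by (subst unitary_conj_mult[OF Q']) auto
    finally show ?thesis .
  qed
  have "E (kron ket0 ?\<omega>) = ptr1 L D (ptr1 (2 * dR) S (Q * ?N * adj Q))"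
    unfolding E_def comp_def st UMU ..
  also have "ptr1 (2 * dR) S (Q * ?N * adj Q) = V * ptr1 (2 * dR) S ?N * adj V"
    unfolding Q_def by (rule ptr1_conj[OF unitaryD(1)[OF V]]) (use cN in \<open>unfold YY\<close>)
  also have "ptr1 L D (V * ptr1 (2 * dR) S ?N * adj V) = W * ptr1 L D (ptr1 (2 * dR) S ?N) * adj W"
    unfolding V_def by (rule ptr1_conj[OF cW(1)]) auto
  \<comment> \<open>Regrouping the traced indices: the thermal operation discards X R and then C,
    the block computation discards X and then R C.\<close>
  also have "ptr1 L D (ptr1 (2 * dR) S ?N) = ptr1 (dR * L) D (ptr1 2 Y ?N)"
    using ptr1_ptr1[of "dR * L" D 2 ?N] by (simp only: ptr1_ptr1 mult.assoc)
  also have "ptr1 2 Y ?N = (1\<^sub>m Y - adj K * K) * \<Sigma> * (1\<^sub>m Y - adj K * K) + K * \<Sigma> * adj K"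
    unfolding U0_def dilation_conj_corner[OF dil c\<Sigma>]
    by (rule ptr1_four_block) (use K_carrier c\<Sigma> in \<open>auto intro!: mult_carrier_mat[of _ Y Y]\<close>)
  also have "ptr1 (dR * L) D \<dots> = ptr1 (dR * L) D ((1\<^sub>m Y - adj K * K) * \<Sigma> * (1\<^sub>m Y - adj K * K)) + ptr1 (dR * L) D (K * \<Sigma> * adj K)"
    by (rule ptr1_add) (use K_carrier c\<Sigma> in \<open>auto simp: mult.assoc intro!: mult_carrier_mat[of _ Y Y]\<close>)
  finally show ?thesis using E by blast
qed

end

text \<open>R gets the level energies t - Min T for t in \<open>T\<close>, and the qubit has to
  supply Min T + ln Z / \<beta>, which fixes m. The bound holds with an extra 1 / (N + 2) for every
  N; the larger bath removes this term and leaves the truncation error alone.\<close>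

theorem conv_dist_formation:
  fixes T :: "real set"
  assumes b: "0 < \<beta>" and B: "valid B" and fr: "energy_frame B \<rho> W e c" and c1: "(\<Sum>k<sdim B. (cmod (c k))\<^sup>2) = 1"
    and T: "finite T" "T \<noteq> {}" "\<And>t. t \<in> T \<Longrightarrow> \<exists>k<sdim B. e k = t \<and> c k \<noteq> 0"
  shows "\<exists>R. valid R \<and> sdim R = card T \<and> opnorm (ham R) \<le> Max T - Min T \<and>
    conv_dist \<beta> (Atom (qubit_ham \<beta> (1 + (\<Sum>k<sdim B. exp (- \<beta> * e k)) * exp (\<beta> * Min T)))) ket0 R B \<rho>
      \<le> sqrt (2 * (1 - (\<Sum>k<sdim B. if e k \<in> T then (cmod (c k))\<^sup>2 else 0)))"
proof -
  define D where "D = sdim B"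
  define dR where "dR = card T"
  define t0 where "t0 = Min T"
  define Z where "Z = (\<Sum>k<D. exp (- \<beta> * e k))"
  define q where "q t = (\<Sum>k<D. if e k = t then (cmod (c k))\<^sup>2 else 0)" for t
  define Q where "Q = (\<Sum>k<D. if e k \<in> T then (cmod (c k))\<^sup>2 else 0)"
  have D: "0 < D" using sdim_pos[OF B] by (simp add: D_def)
  from fr have W: "unitary D W" "ham B = W * rdiag D e * adj W" "\<rho> = W * ketbra (vec D c) * adj W"
    and e: "\<And>k. k < D \<Longrightarrow> 0 \<le> e k" by (auto simp: energy_frame_def D_def)
  obtain h where h: "bij_betw h {..<dR} T"
    using ex_bij_betw_nat_finite[OF T(1)] by (auto simp: dR_def lessThan_atLeast0)
  have t0: "t0 \<in> T" "\<And>t. t \<in> T \<Longrightarrow> t0 \<le> t" using T by (auto simp: t0_def)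
  then obtain g where g: "g < dR" and hg: "h g = t0" using h unfolding bij_betw_def by (metis imageE lessThan_iff)
  have hT: "h r \<in> T" if "r < dR" for r using h that by (auto simp: bij_betw_def)
  have h_inj: "h r = h r' \<longleftrightarrow> r = r'" if "r < dR" "r' < dR" for r r'
    using h that by (auto simp: bij_betw_def inj_on_eq_iff)
  have q0: "0 < q t" if t: "t \<in> T" for t
  proof -
    obtain k where k: "k < D" "e k = t" "c k \<noteq> 0" using T(3)[OF t] by (auto simp: D_def)
    then show ?thesis unfolding q_def by (intro sum_pos2[of _ k]) auto
  qed
  have qQ: "(\<Sum>r<dR. q (h r)) = Q"
  proof -
    have "(\<Sum>r<dR. q (h r)) = (\<Sum>t\<in>T. q t)" by (rule sum.reindex_bij_betw[OF h])
    also have "\<dots> = (\<Sum>k<D. \<Sum>t\<in>T. if e k = t then (cmod (c k))\<^sup>2 else 0)" unfolding q_def by (rule sum.swap)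
    also have "\<dots> = Q" unfolding Q_def using T(1) by (intro sum.cong refl) simp
    finally show ?thesis .
  qed
  have Q0: "0 < Q" unfolding qQ[symmetric] using g q0 hT by (intro sum_pos) auto
  have Q1: "Q \<le> 1" unfolding Q_def c1[symmetric] D_def by (intro sum_mono) auto
  have Zpos: "0 < Z" unfolding Z_def using D by (intro sum_pos) auto
  \<comment> \<open>One Boltzmann factor is at most the whole sum. The shifted energies are the
    letter energies of the bath, whose Hamiltonian must be positive semidefinite.\<close>
  have Zk: "0 \<le> e k + ln Z / \<beta>" if k: "k < D" for k
  proof -
    have "exp (- \<beta> * e k) \<le> Z" unfolding Z_def using k by (intro member_le_sum) auto
    then have "- \<beta> * e k \<le> ln Z" using Zpos by (simp add: ln_ge_iff)
    then show ?thesis using b by (simp add: field_simps)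
  qed
  define \<Delta> where "\<Delta> = t0 + ln Z / \<beta>"
  have \<Delta>: "0 \<le> \<Delta>" using T(3)[OF t0(1)] Zk by (auto simp: \<Delta>_def D_def)
  define m where "m = 1 + Z * exp (\<beta> * t0)"
  have lnm: "ln (m - 1) = \<beta> * \<Delta>" using Zpos b by (simp add: m_def \<Delta>_def ln_mult field_simps)
  have "0 \<le> ln (m - 1)" unfolding lnm using b \<Delta> by simp
  moreover have "0 < m - 1" using Zpos by (simp add: m_def)
  \<comment> \<open>As \<Delta> is nonnegative, |0> is the upper level of X, and the first branch of
    \<open>qubit_ham\<close> applies.\<close>
  ultimately have m2: "2 \<le> m" by (simp add: ln_ge_zero_iff)
  then have m1: "1 < m" by simp
  have qh: "qubit_ham \<beta> m = rdiag 2 (\<lambda>i. if i = 0 then \<Delta> else 0)"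
    using m2 b by (auto simp: qubit_ham_def lnm intro!: rdiag_cong)
  \<comment> \<open>\<phi> r is the normalised component of the state at energy h r, and a r its
    amplitude within the retained part. Together they reassemble y, the normalised truncation of
    c.\<close>
  define \<phi> where "\<phi> r k = (if e k = h r then c k / complex_of_real (sqrt (q (h r))) else 0)" for r k
  define a where "a r = complex_of_real (sqrt (q (h r) / Q))" for r
  define eR where "eR r = h r - t0" for r
  define x where "x k = e k + ln Z / \<beta>" for k
  define y where "y k = (if e k \<in> T then c k / complex_of_real (sqrt Q) else 0)" for k
  have eR: "0 \<le> eR r" "eR r \<le> Max T - t0" if "r < dR" for r using t0(2) hT[OF that] T(1) by (auto simp: eR_def)
  let ?R = "Atom (rdiag dR eR)"
  have vR: "valid ?R" using g eR(1) by (intro valid_rdiag) auto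
  have "0 \<le> Max T - Min T" using eR[OF g] unfolding t0_def by linarith
  then have opR: "opnorm (ham ?R) \<le> Max T - Min T"
    unfolding ham.simps by (intro opnorm_le[OF _ unitary_one rdiag_spectral]) (use g eR in \<open>auto simp: t0_def\<close>)
  have orth: "(\<Sum>k<D. cnj (\<phi> r k) * \<phi> r' k) = (if r = r' then 1 else 0)" if r: "r < dR" "r' < dR" for r r'
  proof (cases "r = r'")
    case True
    have "complex_of_real (sqrt (q (h r))) * complex_of_real (sqrt (q (h r))) = complex_of_real (q (h r))"
      using q0[OF hT[OF r(1)]] by (simp flip: of_real_mult)
    then have "(\<Sum>k<D. cnj (\<phi> r k) * \<phi> r k) = (\<Sum>k<D. complex_of_real (if e k = h r then (cmod (c k))\<^sup>2 else 0) / complex_of_real (q (h r)))"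
      by (intro sum.cong refl) (simp add: \<phi>_def complex_norm_square mult.commute del: of_real_power)
    also have "\<dots> = 1" unfolding sum_divide_distrib[symmetric] of_real_sum[symmetric] q_def[symmetric] using q0[OF hT[OF r(1)]] by simp
    finally show ?thesis using True by simp
  next
    case False
    then show ?thesis using h_inj[OF r] by (auto simp: \<phi>_def intro!: sum.neutral)
  qed
  have y_eq: "(\<Sum>r<dR. \<phi> r k * a r) = y k" for k
  proof (cases "e k \<in> T")
    case True
    then obtain r0 where r0: "r0 < dR" "h r0 = e k" using h unfolding bij_betw_def by (metis imageE lessThan_iff)
    have "(\<Sum>r<dR. \<phi> r k * a r) = (\<Sum>r<dR. if r = r0 then y k else 0)"
    proof (intro sum.cong refl)
      fix r assume "r \<in> {..<dR}"
      then show "\<phi> r k * a r = (if r = r0 then y k else 0)"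
        using h_inj[of r r0] r0 q0[OF True] True by (auto simp: \<phi>_def a_def y_def real_sqrt_divide)
    qed
    then show ?thesis using r0 by simp
  next
    case False
    then show ?thesis using hT by (auto simp: \<phi>_def y_def intro!: sum.neutral)
  qed
  have a1: "(\<Sum>r<dR. (cmod (a r))\<^sup>2) = 1"
  proof -
    have "(\<Sum>r<dR. (cmod (a r))\<^sup>2) = (\<Sum>r<dR. q (h r) / Q)"
      using q0[OF hT] Q0 by (intro sum.cong refl) (auto simp: a_def abs_of_nonneg less_imp_le)
    also have "\<dots> = 1" unfolding sum_divide_distrib[symmetric] qQ using Q0 by simp
    finally show ?thesis .
  qed
  let ?\<omega> = "ketbra (vec dR a)"
  have "tr ?\<omega> = complex_of_real (\<Sum>r<dR. (cmod (a r))\<^sup>2)"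
    unfolding tr_def of_real_sum by (intro sum.cong) (auto simp: complex_norm_square simp del: of_real_power)
  then have dens: "density (sdim ?R) ?\<omega>" using a1 by (simp add: density_def psd_ketbra)
  have y1: "(\<Sum>k<D. (cmod (y k))\<^sup>2) = 1"
  proof -
    have "(\<Sum>k<D. (cmod (y k))\<^sup>2) = (\<Sum>k<D. (if e k \<in> T then (cmod (c k))\<^sup>2 else 0) / Q)"
      using Q0 by (intro sum.cong refl) (auto simp: y_def norm_divide power_divide)
    then show ?thesis unfolding sum_divide_distrib[symmetric] Q_def[symmetric] using Q0 by simp
  qed
  \<comment> \<open>The squared distance from a unit vector to its normalised projection of weight Q
    is 2 - 2 sqrt Q, and Q \<le> sqrt Q.\<close>
  have dist: "(\<Sum>k<D. (cmod (c k - y k))\<^sup>2) \<le> 2 * (1 - Q)"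
  proof -
    have "(\<Sum>k<D. (cmod (c k - y k))\<^sup>2) =
        (\<Sum>k<D. (cmod (c k))\<^sup>2 - (if e k \<in> T then (cmod (c k))\<^sup>2 else 0) + (1 - 1 / sqrt Q)\<^sup>2 * (if e k \<in> T then (cmod (c k))\<^sup>2 else 0))"
    proof (intro sum.cong refl)
      fix k
      have "c k - c k / complex_of_real (sqrt Q) = complex_of_real (1 - 1 / sqrt Q) * c k"
        by (simp add: algebra_simps)
      then have "cmod (c k - c k / complex_of_real (sqrt Q)) = \<bar>1 - 1 / sqrt Q\<bar> * cmod (c k)"
        by (simp only: norm_mult norm_of_real)
      then show "(cmod (c k - y k))\<^sup>2 = (cmod (c k))\<^sup>2 - (if e k \<in> T then (cmod (c k))\<^sup>2 else 0) +
          (1 - 1 / sqrt Q)\<^sup>2 * (if e k \<in> T then (cmod (c k))\<^sup>2 else 0)"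
        by (simp add: y_def power_mult_distrib)
    qed
    also have "\<dots> = 1 - Q + (1 - 1 / sqrt Q)\<^sup>2 * Q"
      by (simp only: sum.distrib sum_subtractf sum_distrib_left[symmetric] Q_def[symmetric] c1[folded D_def])
    also have "(1 - 1 / sqrt Q)\<^sup>2 * Q = ((1 - 1 / sqrt Q) * sqrt Q)\<^sup>2" using Q0 by (simp add: power_mult_distrib)
    also have "(1 - 1 / sqrt Q) * sqrt Q = sqrt Q - 1" using Q0 by (simp add: left_diff_distrib)
    also have "1 - Q + (sqrt Q - 1)\<^sup>2 = 2 - 2 * sqrt Q" using Q0 by (simp add: power2_eq_square algebra_simps)
    also have "\<dots> \<le> 2 * (1 - Q)"
    proof -
      have "Q\<^sup>2 \<le> Q" using Q0 Q1 by (simp add: power2_eq_square mult_le_one mult_left_le)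
      then have "Q \<le> sqrt Q" by (rule real_le_rsqrt)
      then show ?thesis by simp
    qed
    finally show ?thesis .
  qed
  have bound: "conv_dist \<beta> (Atom (qubit_ham \<beta> m)) ket0 ?R B \<rho> \<le> sqrt (2 * (1 - Q)) + 1 / real (N + 2)" for N
  proof -
    define L where "L = bath_dim D (Suc N)"
    have L: "0 < L" by (simp add: L_def)
    interpret formation D dR g L \<phi> by unfold_locales (use D L g orth in auto)
    define eC where "eC = bath_energy x D"
    have eC: "0 \<le> eC k" for k unfolding eC_def by (rule bath_energy_nonneg) (use Zk D in \<open>auto simp: x_def\<close>)
    define hh where "hh = (\<lambda>i. eR (i div S) + (eC (i mod S div D) + e (i mod S mod D)))"
    have res: "hh i = \<Delta> + hh j" if ij: "i < Y" "j < Y" and nz: "K $$ (i,j) \<noteq> 0" for i j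
    proof -
      note nz = K_nonzero[OF ij nz]
      have "e (i mod S mod D) = h (j div S)" using nz(3) by (auto simp: \<phi>_def split: if_splits)
      moreover have "eC (Suc (j mod S)) = eC (j mod S div D) + e (j mod S mod D) + ln Z / \<beta>" by (simp add: eC_def x_def)
      moreover have "eR (i div S) = 0" "eR (j div S) = h (j div S) - t0" using nz(1) hg by (simp_all add: eR_def)
      ultimately show ?thesis unfolding hh_def nz(2) by (simp add: \<Delta>_def)
    qed
    have ex: "exp (- \<beta> * x k) = exp (- \<beta> * e k) / Z" for k
      using Zpos b by (simp add: x_def ring_distribs exp_diff)
    have x1: "(\<Sum>k<D. exp (- \<beta> * x k)) = 1"
      unfolding ex sum_divide_distrib[symmetric] Z_def[symmetric] using Zpos by simp
    note part = bath_partition[OF x1, folded eC_def]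
    have ZC: "(\<Sum>k<L. exp (- \<beta> * eC k)) = N + 2" unfolding L_def part by simp
    define \<gamma> where "\<gamma> = (\<lambda>s. (exp (- \<beta> * eC (s div D)) / (\<Sum>k<L. exp (- \<beta> * eC k))) *
       (exp (- \<beta> * e (s mod D)) / (\<Sum>k<D. exp (- \<beta> * e k))))"
    have \<gamma>0: "0 \<le> \<gamma> s" for s unfolding \<gamma>_def by (intro mult_nonneg_nonneg divide_nonneg_nonneg sum_nonneg) auto
    have \<gamma>sum: "(\<Sum>s<l * D. \<gamma> s) = (\<Sum>k<l. exp (- \<beta> * eC k)) / (N + 2)" for l
    proof -
      have "(\<Sum>s<l * D. \<gamma> s) = (\<Sum>i<l. \<Sum>j<D. (exp (- \<beta> * eC i) / (N + 2)) * (exp (- \<beta> * e j) / Z))"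
        unfolding \<gamma>_def ZC Z_def[symmetric] by (rule sum_divmod)
      also have "\<dots> = (\<Sum>k<l. exp (- \<beta> * eC k)) / (N + 2)"
        unfolding sum_product[symmetric] sum_divide_distrib[symmetric] Z_def[symmetric] using Zpos by simp
      finally show ?thesis .
    qed
    define p where "p = real (N + 1) / real (N + 2)"
    have Lle: "bath_dim D N * D < L" by (simp add: L_def)
    have "bath_dim D N * 1 \<le> bath_dim D N * D" using D by (intro mult_le_mono2) simp
    then have "bath_dim D N \<le> L" using Lle by linarith
    then have "bath_dim D N * D \<le> S" by (rule mult_le_mono1)
    \<comment> \<open>L equals \<open>bath_dim D N * D + 1\<close>, so the word s + 1 fits exactly
      if the word contained in s has length at most N.\<close>
    then have suc: "{s. s < S \<and> Suc s < L} = {..<bath_dim D N * D}" by (auto simp: L_def)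
    have succ_sum: "(\<Sum>s | s < S \<and> Suc s < L. \<gamma> s) = p"
      unfolding suc \<gamma>sum part p_def by simp
    have fail_sum: "(\<Sum>s | s < S \<and> \<not> Suc s < L. \<gamma> s) = 1 / real (N + 2)"
    proof -
      have "(\<Sum>s<S. \<gamma> s) = 1" unfolding \<gamma>sum ZC by simp
      moreover have "{..<S} = {s. s < S \<and> Suc s < L} \<union> {s. s < S \<and> \<not> Suc s < L}" by auto
      ultimately have "(\<Sum>s | s < S \<and> Suc s < L. \<gamma> s) + (\<Sum>s | s < S \<and> \<not> Suc s < L. \<gamma> s) = 1"
        by (subst sum.union_disjoint[symmetric]) auto
      then show ?thesis unfolding succ_sum p_def by (simp add: field_simps)
    qed
    let ?\<Sigma> = "F a * rdiag S \<gamma> * adj (F a)"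
    let ?O1 = "ptr1 (dR * L) D ((1\<^sub>m Y - adj K * K) * ?\<Sigma> * (1\<^sub>m Y - adj K * K))"
    let ?O2 = "complex_of_real p \<cdot>\<^sub>m ketbra (vec D y)"
    obtain E where E: "E \<in> CTO \<beta> (Comp (Atom (qubit_ham \<beta> m)) ?R) B"
      and Eout: "E (kron ket0 ?\<omega>) = W * (?O1 + ptr1 (dR * L) D (K * ?\<Sigma> * adj K)) * adj W"
      using formation_map[OF \<Delta> eR(1) eC B D_def[symmetric] W(1,2) hh_def res \<gamma>_def refl, of a] unfolding qh by blast
    have O2: "ptr1 (dR * L) D (K * ?\<Sigma> * adj K) = ?O2"
      unfolding output_success succ_sum y_eq ..
    note O1 = output_failure[of \<gamma> a, OF \<gamma>0 a1, unfolded fail_sum]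
    have cO: "?O1 \<in> carrier_mat D D" "?O2 \<in> carrier_mat D D" "ketbra (vec D c) \<in> carrier_mat D D"
      by (auto intro!: ketbra_carrier)
    have "?O1 + ?O2 = ?O2 + ?O1" by (rule comm_add_mat[OF cO(1,2)])
    then have eq: "\<rho> - E (kron ket0 ?\<omega>) = W * (ketbra (vec D c) - (?O2 + ?O1)) * adj W"
      unfolding Eout O2 W(3) using cO unitaryD[OF W(1)] by (simp add: mult_minus_dims minus_mult_dims)
    have tb: "1/2 * tnorm (W * (ketbra (vec D c) - (?O2 + ?O1)) * adj W) \<le>
        sqrt (\<Sum>k<D. (cmod (vec D c $ k - vec D y $ k))\<^sup>2) + 1 / real (N + 2)"
    proof (rule tnorm_mixture_bound)
      show "psd D ?O1" "tr ?O1 = complex_of_real (1 / real (N + 2))" by (rule O1)+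
      show "unitary D W" by (rule W(1))
    qed (use c1 y1 in \<open>auto simp: D_def p_def field_simps\<close>)
    have "sqrt (\<Sum>k<D. (cmod (vec D c $ k - vec D y $ k))\<^sup>2) \<le> sqrt (2 * (1 - Q))"
      using dist by simp
    then have le: "1/2 * tnorm (\<rho> - E (kron ket0 ?\<omega>)) \<le> sqrt (2 * (1 - Q)) + 1 / real (N + 2)"
      unfolding eq using tb by linarith
    have hr: "hermitian (sdim B) \<rho>"
      using psd_conj[OF psd_ketbra unitaryD(1)[OF W(1)], of "vec D c"] unfolding W(3) by (simp add: psd_def D_def)
    show ?thesis by (rule conv_dist_le[OF b m1 B vR hr dens E le])
  qed
  have "conv_dist \<beta> (Atom (qubit_ham \<beta> m)) ket0 ?R B \<rho> \<le> sqrt (2 * (1 - Q))"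
  proof (rule LIMSEQ_le_const)
    have "(\<lambda>N. sqrt (2 * (1 - Q)) + 1 / real (N + 2)) \<longlonglongrightarrow> sqrt (2 * (1 - Q)) + 0"
      by (intro tendsto_intros LIMSEQ_ignore_initial_segment[OF lim_1_over_n, of 2])
    then show "(\<lambda>N. sqrt (2 * (1 - Q)) + 1 / real (N + 2)) \<longlonglongrightarrow> sqrt (2 * (1 - Q))" by simp
  qed (use bound in auto)
  then show ?thesis using vR opR unfolding m_def Z_def Q_def t0_def D_def dR_def by (intro exI[of _ ?R]) (auto simp: dR_def)
qed

subsection \<open>Upper bound on the cost\<close>

lemma log_one_plus_le:
  fixes y :: real
  assumes "1 \<le> y" shows "log 2 (1 + y) \<le> 1 + log 2 y"
proof -
  have "log 2 (1 + y) \<le> log 2 (2 * y)" using assms by simp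
  then show ?thesis using assms by (simp add: log_mult)
qed

text \<open>The two halves of \<open>dev\<close> serve different ends: below 1 the window has
  positive mass, so that \<open>T\<close> is not empty; below \<epsilon>^2 / 2 the truncation error
  sqrt (2 (1 - Q)) is at most \<epsilon>.\<close>

lemma spow_formation:
  assumes b: "0 < \<beta>" and A: "valid A" and fr: "energy_frame A \<rho> W1 e1 c1"
    and mom: "energy_moments (sdim A) e1 c1 \<mu> s" and n: "1 \<le> n" and \<epsilon>: "0 < \<epsilon>" and t: "0 < t"
    and dev: "n * s / t\<^sup>2 < min 1 (\<epsilon>\<^sup>2 / 2)"
  shows "\<exists>R. valid R \<and> sdim R \<le> (n + 1) ^ sdim A \<and> opnorm (ham R) \<le> 2 * t \<and>
    cost_eps \<beta> R (spow A n) (tpow \<rho> n) \<epsilon> \<le>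
      ereal (1 + n * (log 2 (\<Sum>k<sdim A. exp (- \<beta> * e1 k)) + \<beta> * \<mu> / ln 2) + \<beta> * t / ln 2)"
proof -
  let ?Z = "\<Sum>k<sdim A. exp (- \<beta> * e1 k)" and ?B = "spow A n"
  have Z: "0 < ?Z" using sdim_pos[OF A] by (intro sum_pos) auto
  obtain W e c where fB: "energy_frame ?B (tpow \<rho> n) W e c" and mB: "energy_moments (sdim ?B) e c (n * \<mu>) (n * s)"
    and ZB: "(\<Sum>k<sdim ?B. exp (- \<beta> * e k)) = ?Z ^ n" and cB: "card (e ` {..<sdim ?B}) \<le> (n + 1) ^ sdim A"
    using spow_frame[OF fr mom n] by blast
  have c1: "(\<Sum>k<sdim ?B. (cmod (c k))\<^sup>2) = 1" using mB by (simp add: energy_moments_def)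
  let ?w = "\<lambda>k. k < sdim ?B \<and> \<bar>e k - n * \<mu>\<bar> \<le> t"
  \<comment> \<open>Energies at which the state vanishes are left out: their components could not be
    normalised.\<close>
  define T where "T = e ` {k. ?w k \<and> c k \<noteq> 0}"
  let ?Q = "\<Sum>k<sdim ?B. if e k \<in> T then (cmod (c k))\<^sup>2 else 0"
  have "1 - n * s / t\<^sup>2 \<le> (\<Sum>k | ?w k. (cmod (c k))\<^sup>2)" by (rule chebyshev[OF mB t])
  moreover have wQ: "(\<Sum>k | ?w k. (cmod (c k))\<^sup>2) \<le> ?Q"
  proof -
    have "(\<Sum>k | ?w k. (cmod (c k))\<^sup>2) = (\<Sum>k<sdim ?B. if ?w k then (cmod (c k))\<^sup>2 else 0)"
      by (subst sum.inter_filter[symmetric]) (auto intro: sum.cong)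
    also have "\<dots> \<le> ?Q" by (intro sum_mono) (auto simp: T_def)
    finally show ?thesis .
  qed
  ultimately have Q: "1 - n * s / t\<^sup>2 \<le> ?Q" by simp
  have "T \<noteq> {}"
  proof
    assume "T = {}"
    then have "?Q = 0" by simp
    then show False using Q dev by simp
  qed
  have finT: "finite T" unfolding T_def by simp
  have Tsub: "T \<subseteq> e ` {..<sdim ?B}" unfolding T_def by auto
  have Twin: "\<bar>x - n * \<mu>\<bar> \<le> t" if "x \<in> T" for x using that unfolding T_def by auto
  have Tw: "\<exists>k<sdim ?B. e k = x \<and> c k \<noteq> 0" if "x \<in> T" for x using that unfolding T_def by auto
  obtain R where R: "valid R" "sdim R = card T" "opnorm (ham R) \<le> Max T - Min T"
    and conv: "conv_dist \<beta> (Atom (qubit_ham \<beta> (1 + ?Z ^ n * exp (\<beta> * Min T)))) ket0 R ?B (tpow \<rho> n) \<le> sqrt (2 * (1 - ?Q))"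
    using conv_dist_formation[OF b valid_spow[OF A n] fB c1 finT \<open>T \<noteq> {}\<close> Tw] unfolding ZB by blast
  have MT: "Max T \<in> T" "Min T \<in> T" using finT \<open>T \<noteq> {}\<close> by auto
  have "sdim R \<le> (n + 1) ^ sdim A" using R(2) card_mono[OF _ Tsub] cB by simp
  moreover have "opnorm (ham R) \<le> 2 * t"
    using R(3) Twin[OF MT(1)] Twin[OF MT(2)] unfolding abs_le_iff by linarith
  moreover have "cost_eps \<beta> R ?B (tpow \<rho> n) \<epsilon> \<le>
      ereal (1 + n * (log 2 ?Z + \<beta> * \<mu> / ln 2) + \<beta> * t / ln 2)"
  proof -
    let ?y = "?Z ^ n * exp (\<beta> * Min T)"
    have y0: "0 < ?y" using Z by simp
    have "sqrt (2 * (1 - ?Q)) \<le> \<epsilon>"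
    proof (rule real_le_lsqrt)
      show "2 * (1 - ?Q) \<le> \<epsilon>\<^sup>2" using Q dev by simp
    qed (use \<epsilon> in auto)
    with conv have "conv_dist \<beta> (Atom (qubit_ham \<beta> (1 + ?y))) ket0 R ?B (tpow \<rho> n) \<le> \<epsilon>" by linarith
    then have "cost_eps \<beta> R ?B (tpow \<rho> n) \<epsilon> \<le> ereal (log 2 (1 + ?y))" using y0 by (intro cost_eps_le) auto
    also have "log 2 (1 + ?y) \<le> 1 + n * (log 2 ?Z + \<beta> * \<mu> / ln 2) + \<beta> * t / ln 2"
    proof -
      \<comment> \<open>The level of energy Min T alone contributes exp (- \<beta> Min T) to the
        partition function. Hence \<open>?y\<close> is at least 1, and the summand 1 in m costs at
        most one bit.\<close>
      obtain k where k: "k < sdim ?B" "e k = Min T" using Tsub MT(2) by auto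
      have "exp (- \<beta> * Min T) \<le> ?Z ^ n" unfolding ZB[symmetric] k(2)[symmetric] using k(1) by (intro member_le_sum) auto
      then have "exp (- \<beta> * Min T) * exp (\<beta> * Min T) \<le> ?y" by (intro mult_right_mono) auto
      then have y1: "1 \<le> ?y" by (simp add: exp_add[symmetric])
      have "log 2 (1 + ?y) \<le> 1 + log 2 ?y" by (rule log_one_plus_le[OF y1])
      also have "log 2 ?y = n * log 2 ?Z + \<beta> * Min T / ln 2"
        using Z by (simp add: log_def ln_mult ln_realpow add_divide_distrib)
      also have "\<beta> * Min T / ln 2 \<le> \<beta> * (n * \<mu> + t) / ln 2"
        using Twin[OF MT(2)] b by (intro divide_right_mono mult_left_mono) (auto simp: abs_le_iff)
      finally show ?thesis by (simp add: algebra_simps add_divide_distrib)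
    qed
    finally show ?thesis by simp
  qed
  ultimately show ?thesis using R(1) by blast
qed

text \<open>With half-width t = n^(2/3), both n / t^2 and t / n equal n^(-1/3) and vanish together.
  The first controls the truncation error, the second the surplus in the cost rate, and \<alpha> =
  2/3 keeps the norm of the Hamiltonian of R sublinear.\<close>

theorem cost_rate_le:
  assumes b: "0 < \<beta>" and A: "valid A" and fr: "energy_frame A \<rho> W1 e1 c1"
    and mom: "energy_moments (sdim A) e1 c1 \<mu> s" and \<epsilon>: "0 < \<epsilon>"
  shows "cost_rate \<beta> A \<rho> \<epsilon> \<le> ereal (log 2 (\<Sum>k<sdim A. exp (- \<beta> * e1 k)) + \<beta> * \<mu> / ln 2)"
proof -
  let ?Z = "\<Sum>k<sdim A. exp (- \<beta> * e1 k)"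
  let ?D = "log 2 ?Z + \<beta> * \<mu> / ln 2"
  let ?t = "\<lambda>n. real n powr (2/3)"
  let ?ok = "\<lambda>n. n * s / (?t n)\<^sup>2 < min 1 (\<epsilon>\<^sup>2 / 2)"
  let ?P = "\<lambda>n R. valid R \<and> (1 \<le> n \<longrightarrow> sdim R \<le> (n + 1) ^ sdim A \<and> opnorm (ham R) \<le> 2 * ?t n \<and>
    (?ok n \<longrightarrow> cost_eps \<beta> R (spow A n) (tpow \<rho> n) \<epsilon> \<le> ereal (1 + n * ?D + \<beta> * ?t n / ln 2)))"
  have "\<exists>R. ?P n R" for n
  proof (cases "1 \<le> n \<and> ?ok n")
    case True
    then show ?thesis using spow_formation[OF b A fr mom _ \<epsilon>, of n "?t n"] by auto
  next
    case False
    \<comment> \<open>For the finitely many n at which the window is too narrow, a one-level system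
      keeps the sequence admissible; the liminf does not see them.\<close>
    let ?R = "Atom (rdiag 1 (\<lambda>_. 0))"
    have "valid ?R" by (rule valid_rdiag) auto
    moreover have "opnorm (ham ?R) \<le> 0"
      unfolding ham.simps by (rule opnorm_le[OF _ unitary_one rdiag_spectral]) auto
    then have "opnorm (ham ?R) \<le> 2 * ?t n" by (rule order_trans) simp
    ultimately show ?thesis using False by (intro exI[of _ ?R]) auto
  qed
  then obtain Rs where Rs: "\<And>n. ?P n (Rs n)" by metis
  have "slar Rs"
    unfolding slar_def
  proof (intro conjI)
    show "\<forall>n. valid (Rs n)" using Rs by blast
    have "real (sdim (Rs n)) \<le> 2 ^ sdim A * real n ^ sdim A" if n: "1 \<le> n" for n
    proof -
      have "real (sdim (Rs n)) \<le> real ((n + 1) ^ sdim A)" using Rs n of_nat_le_iff by blast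
      also have "\<dots> = (real n + 1) ^ sdim A" by (simp add: add.commute)
      also have "\<dots> \<le> (2 * real n) ^ sdim A" using n by (intro power_mono) auto
      finally show ?thesis by (simp add: power_mult_distrib)
    qed
    then show "\<exists>C k. \<forall>n\<ge>1. real (sdim (Rs n)) \<le> C * real n ^ k" by blast
    have "\<forall>n\<ge>1. opnorm (ham (Rs n)) \<le> 2 * real n powr (2/3)" using Rs by blast
    then show "\<exists>c \<alpha>. 0 < c \<and> 0 \<le> \<alpha> \<and> \<alpha> < 1 \<and> (\<forall>n\<ge>1. opnorm (ham (Rs n)) \<le> c * real n powr \<alpha>)"
      by (intro exI[of _ 2] exI[of _ "2/3"]) auto
  qed
  define g where "g n = ?D + (1 / real n + \<beta> / ln 2 * real n powr (- (1/3)))" for n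
  have p3: "(\<lambda>n. real n powr (- (1/3))) \<longlonglongrightarrow> 0"
    using filterlim_compose[OF tendsto_neg_powr[of "- (1/3)" "\<lambda>x. x" at_top] filterlim_real_sequentially]
    by (simp add: filterlim_ident)
  have "g \<longlonglongrightarrow> ?D + (0 + \<beta> / ln 2 * 0)" unfolding g_def by (intro tendsto_intros lim_1_over_n p3)
  then have "(\<lambda>n. ereal (g n)) \<longlonglongrightarrow> ereal ?D" by simp
  then have lg: "liminf (\<lambda>n. ereal (g n)) = ereal ?D" by (rule lim_imp_Liminf[OF sequentially_bot])
  have powr_sq: "(?t n)\<^sup>2 = n * real n powr (1/3)" if "1 \<le> n" for n :: nat
  proof -
    have "(?t n)\<^sup>2 = real n powr (2/3 + 2/3)" unfolding power2_eq_square powr_add ..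
    also have "\<dots> = real n powr (1 + 1/3)" by simp
    also have "\<dots> = real n powr 1 * real n powr (1/3)" by (rule powr_add)
    also have "real n powr 1 = n" using that by simp
    finally show ?thesis .
  qed
  have "(\<lambda>n. s * real n powr (- (1/3))) \<longlonglongrightarrow> s * 0" by (intro tendsto_intros p3)
  then have "\<forall>\<^sub>F n in sequentially. s * real n powr (- (1/3)) < min 1 (\<epsilon>\<^sup>2 / 2)"
    using \<epsilon> by (intro order_tendstoD(2)) auto
  then have "\<forall>\<^sub>F n in sequentially. ereal (1 / real n) * cost_eps \<beta> (Rs n) (spow A n) (tpow \<rho> n) \<epsilon> \<le> ereal (g n)"
    using eventually_ge_at_top[of 1]
  proof eventually_elim
    case (elim n)
    have "n * s / (?t n)\<^sup>2 = s * real n powr (- (1/3))"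
      unfolding powr_sq[OF elim(2)] powr_minus_divide using elim(2) by simp
    then have "cost_eps \<beta> (Rs n) (spow A n) (tpow \<rho> n) \<epsilon> \<le> ereal (1 + n * ?D + \<beta> * ?t n / ln 2)"
      using Rs[of n] elim by simp
    then have "ereal (1 / real n) * cost_eps \<beta> (Rs n) (spow A n) (tpow \<rho> n) \<epsilon> \<le>
        ereal (1 / real n) * ereal (1 + n * ?D + \<beta> * ?t n / ln 2)" by (intro ereal_mult_left_mono) auto
    also have "\<dots> = ereal (g n)"
    proof -
      have "?t n / n = real n powr (2/3 - 1)" using elim(2) by (simp only: powr_diff) simp
      also have "real n powr (2/3 - 1) = real n powr (- (1/3))" by simp
      finally have t: "?t n = n * real n powr (- (1/3))" using elim(2) by (simp add: divide_eq_eq mult.commute)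
      have "1 / n * (1 + n * ?D + \<beta> * ?t n / ln 2) = g n"
        unfolding t g_def using elim(2) by (simp add: ring_distribs)
      then show ?thesis by simp
    qed
    finally show ?case .
  qed
  then have "liminf (\<lambda>n. ereal (1 / real n) * cost_eps \<beta> (Rs n) (spow A n) (tpow \<rho> n) \<epsilon>) \<le> ereal ?D"
    unfolding lg[symmetric] by (rule Liminf_mono)
  then show ?thesis unfolding cost_rate_def using \<open>slar Rs\<close> by (intro INF_lower2[of Rs]) auto
qed

subsection \<open>The relative entropy of a pure state\<close>

lemma tr_mult_commute:
  assumes "A \<in> carrier_mat n m" "B \<in> carrier_mat m n"
  shows "tr (A * B) = tr (B * A)"
proof -
  have "tr (A * B) = (\<Sum>i<n. \<Sum>k<m. A $$ (i,k) * B $$ (k,i))"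
    unfolding tr_def using assms by (intro sum.cong) (auto simp del: index_mult_mat(1) simp: index_mult_sum[OF assms])
  also have "\<dots> = (\<Sum>k<m. \<Sum>i<n. B $$ (k,i) * A $$ (i,k))" by (subst sum.swap) (simp add: mult.commute)
  also have "\<dots> = tr (B * A)"
    unfolding tr_def using assms by (intro sum.cong) (auto simp del: index_mult_mat(1) simp: index_mult_sum[OF assms(2,1)])
  finally show ?thesis .
qed

lemma tr_unitary_conj:
  assumes W: "unitary n W" and M: "M \<in> carrier_mat n n"
  shows "tr (W * M * adj W) = tr M"
  using tr_mult_commute[of "W * M" n n "adj W"] unitaryD[OF W] unitary_cancel[OF W, of M] M by (simp add: mat_assoc)

text \<open>A normalised \<open>ketbra v\<close> is a projection, so its eigenvalues are 0 and 1,
  and both have logarithm 0 under the convention log 0 = 0.\<close>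

lemma mlog_ketbra:
  assumes v: "v \<in> carrier_vec n" "vnorm v = 1"
  shows "ketbra v * mlog (ketbra v) = 0\<^sub>m n n"
proof -
  have h: "hermitian n (ketbra v)" using psd_ketbra[OF v(1)] by (simp add: psd_def)
  obtain U d where U: "unitary n U" "ketbra v = U * rdiag n d * adj U" using hermitian_spectral[OF h] by blast
  note c = unitaryD[OF U(1)]
  have kk: "adj (ketbra v) * ketbra v = ketbra v"
  proof (rule eq_matI)
    fix i j assume "i < dim_row (ketbra v)" "j < dim_col (ketbra v)"
    then have ij: "i < n" "j < n" using v by auto
    have "(adj (ketbra v) * ketbra v) $$ (i,j) = (\<Sum>k<n. cnj (ketbra v $$ (k,i)) * ketbra v $$ (k,j))"
      by (rule index_adj_mult_self[OF ketbra_carrier[OF v(1)] ij])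
    also have "\<dots> = v $ i * cnj (v $ j) * (\<Sum>k<n. complex_of_real ((cmod (v $ k))\<^sup>2))"
      unfolding sum_distrib_left using v ij by (intro sum.cong refl) (simp add: complex_norm_square mult_ac del: of_real_power)
    also have "(\<Sum>k<n. complex_of_real ((cmod (v $ k))\<^sup>2)) = complex_of_real ((vnorm v)\<^sup>2)"
      unfolding vnorm_sq using v(1) by simp
    finally show "(adj (ketbra v) * ketbra v) $$ (i,j) = ketbra v $$ (i,j)" using v ij by simp
  qed simp_all
  have d01: "d k = 0 \<or> d k = 1" if k: "k < n" for k
  proof -
    have "complex_of_real ((d k)\<^sup>2) = qform (adj (ketbra v) * ketbra v) (col U k)"
      unfolding spectral_sq[OF U] by (rule qform_eigenvector[OF U(1) k, symmetric])
    also have "\<dots> = complex_of_real (d k)" unfolding kk unfolding U(2) by (rule qform_eigenvector[OF U(1) k])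
    finally have "(d k)\<^sup>2 = d k" unfolding of_real_eq_iff .
    then show ?thesis by (simp add: power2_eq_square)
  qed
  have "(log 2 \<circ> d) k = 0" if "k < n" for k using d01[OF that] by (auto simp: log_def)
  then have "rdiag n (log 2 \<circ> d) = rdiag n (\<lambda>_. 0)" by (rule rdiag_cong)
  also have "\<dots> = 0\<^sub>m n n" by (rule eq_matI) auto
  finally have "mlog (ketbra v) = 0\<^sub>m n n"
    unfolding mlog_def herm_fun_spectral[OF U] using c by simp
  then show ?thesis using right_mult_zero_mat[OF ketbra_carrier[OF v(1)]] by simp
qed

text \<open>The entropy term vanishes, and log \<gamma> has eigenvalues - \<beta> e_k / ln 2 - log Z
  in the energy basis, so only the populations |c_k|^2 enter.\<close>

lemma rel_ent_pure:
  assumes A: "valid A" and v: "v \<in> carrier_vec (sdim A)" "vnorm v = 1"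
    and fr: "energy_frame A (ketbra v) W e c" and c1: "(\<Sum>k<sdim A. (cmod (c k))\<^sup>2) = 1"
  shows "rel_ent (ketbra v) (gibbs \<beta> (ham A)) =
    log 2 (\<Sum>k<sdim A. exp (- \<beta> * e k)) + \<beta> * (\<Sum>k<sdim A. (cmod (c k))\<^sup>2 * e k) / ln 2"
proof -
  let ?n = "sdim A" and ?Z = "\<Sum>k<sdim A. exp (- \<beta> * e k)"
  have Z: "0 < ?Z" using sdim_pos[OF A] by (intro sum_pos) auto
  from fr have W: "unitary ?n W" "ham A = W * rdiag ?n e * adj W" "ketbra v = W * ketbra (vec ?n c) * adj W"
    by (auto simp: energy_frame_def)
  note cW = unitaryD[OF W(1)]
  define l where "l = log 2 \<circ> (\<lambda>i. exp (- \<beta> * e i) / ?Z)"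
  have l: "l k = - (\<beta> * e k / ln 2) - log 2 ?Z" for k
    using Z by (simp add: l_def log_def ln_div diff_divide_distrib)
  have ml: "mlog (gibbs \<beta> (ham A)) = W * rdiag ?n l * adj W"
    unfolding mlog_def l_def by (rule herm_fun_spectral[OF W(1) gibbs_spectral[OF W(1,2)]])
  have kc: "ketbra (vec ?n c) \<in> carrier_mat ?n ?n" by (rule ketbra_carrier) simp
  have "tr (ketbra v * mlog (gibbs \<beta> (ham A))) = tr (W * (ketbra (vec ?n c) * rdiag ?n l) * adj W)"
    unfolding ml unfolding W(3) using kc by (subst unitary_conj_mult[OF W(1)]) auto
  also have "\<dots> = tr (ketbra (vec ?n c) * rdiag ?n l)" by (rule tr_unitary_conj[OF W(1)]) (use kc in auto)
  also have "\<dots> = (\<Sum>k<?n. complex_of_real ((cmod (c k))\<^sup>2 * l k))"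
    unfolding tr_def using kc
    by (intro sum.cong) (auto simp del: index_mult_mat(1) of_real_power simp: index_mult_rdiag[OF kc] complex_norm_square)
  also have "\<dots> = complex_of_real (\<Sum>k<?n. (cmod (c k))\<^sup>2 * l k)" by simp
  finally have "Re (tr (ketbra v * mlog (gibbs \<beta> (ham A)))) = (\<Sum>k<?n. (cmod (c k))\<^sup>2 * l k)" by simp
  also have "\<dots> = (\<Sum>k<?n. - (\<beta> / ln 2) * ((cmod (c k))\<^sup>2 * e k) - log 2 ?Z * (cmod (c k))\<^sup>2)"
    by (intro sum.cong refl) (simp add: l algebra_simps)
  also have "\<dots> = - (\<beta> / ln 2) * (\<Sum>k<?n. (cmod (c k))\<^sup>2 * e k) - log 2 ?Z"
    unfolding sum_subtractf sum_distrib_left[symmetric] c1 by simp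
  finally have "Re (tr (ketbra v * mlog (gibbs \<beta> (ham A)))) = - (\<beta> / ln 2) * (\<Sum>k<?n. (cmod (c k))\<^sup>2 * e k) - log 2 ?Z" .
  moreover have "Re (tr (ketbra v * mlog (ketbra v))) = 0" unfolding mlog_ketbra[OF v] by (simp add: tr_def)
  ultimately show ?thesis unfolding rel_ent_def by simp
qed

theorem theorem8:
  fixes \<beta> :: real and A :: sys and v :: "complex vec"
  assumes "0 < \<beta>" and "valid A"
    and "v \<in> carrier_vec (sdim A)" and "vnorm v = 1"
  shows "(cost_rate \<beta> A (ketbra v) \<longlongrightarrow> ereal (rel_ent (ketbra v) (gibbs \<beta> (ham A)))) (at_right 0)"
proof -
  obtain W e c where fr: "energy_frame A (ketbra v) W e c" and c1: "(\<Sum>k<sdim A. (cmod (c k))\<^sup>2) = 1"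
    using energy_frame_exists[OF assms(2,3)] assms(4) by auto
  define \<mu> where "\<mu> = (\<Sum>k<sdim A. (cmod (c k))\<^sup>2 * e k)"
  define s where "s = (\<Sum>k<sdim A. (cmod (c k))\<^sup>2 * (e k - \<mu>)\<^sup>2)"
  have "(\<Sum>k<sdim A. (cmod (c k))\<^sup>2 * (e k - \<mu>)) = \<mu> - \<mu>"
    by (simp add: right_diff_distrib sum_subtractf sum_distrib_right[symmetric] c1 \<mu>_def[symmetric])
  then have mom: "energy_moments (sdim A) e c \<mu> s" by (simp add: energy_moments_def c1 s_def)
  \<comment> \<open>The rate equals the relative entropy for each \<epsilon> in (0, 1/4) already,
    although the sequence attaining the upper bound varies with \<epsilon>; the limit is that of an
    eventually constant function.\<close>
  have "cost_rate \<beta> A (ketbra v) \<epsilon> = ereal (rel_ent (ketbra v) (gibbs \<beta> (ham A)))" if "0 < \<epsilon>" "\<epsilon> < 1/4" for \<epsilon>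
    unfolding rel_ent_pure[OF assms(2-4) fr c1] \<mu>_def[symmetric]
    using cost_rate_le[OF assms(1,2) fr mom that(1)] cost_rate_ge[OF assms(1,2) fr mom that(2)] by (rule antisym)
  then have "\<forall>\<^sub>F \<epsilon> in at_right 0. cost_rate \<beta> A (ketbra v) \<epsilon> = ereal (rel_ent (ketbra v) (gibbs \<beta> (ham A)))"
    unfolding eventually_at_right_field by (intro exI[of _ "1/4"]) auto
  then show ?thesis by (simp add: tendsto_eventually)
qed

end
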